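(* Let $Q$ be a manifold, with a fixed torsion-free connection, and let $\mathfrak{U}$ be the set of triples $(H,\mathcal{W},\alpha^{\bullet})$ where $H:T^{\ast}Q\to\mathbb{R}$ is simple, $\mathcal{W}$ is the vertical subbundle of $TT^{\ast}Q$ given by a linear subbundle $W\subset T^{\ast}Q$, and $\alpha^{\bullet}\in T^{\ast}Q$ is a critical point of $X_H$. Then the simple LCB method and the simple CH method are equivalent on $\mathfrak{U}$: for every $(H,\mathcal{W},\alpha^{\bullet})\in\mathfrak{U}$, the set $\digamma_{LCB}(H,\mathcal{W},\alpha^{\bullet})\subset\mathfrak{X}(T^{\ast}Q)$ of control laws $Y$ produced by the simple LCB method equals the set $\digamma_{CH}(H,\mathcal{W},\alpha^{\bullet})\subset\mathfrak{X}(T^{\ast}Q)$ of control laws $Y$ produced by the simple CH method.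
   Context: All manifolds are smooth and finite dimensional and all maps are smooth. $\pi:T^{\ast}Q\to Q$ is the cotangent bundle; $X_H$ is the Hamiltonian vector field of $H$ for the canonical symplectic form (in canonical coordinates $\dot q^i=\partial H/\partial p_i$, $\dot p_i=-\partial H/\partial q^i$); $\{F,G\}=\frac{\partial F}{\partial q^i}\frac{\partial G}{\partial p_i}-\frac{\partial G}{\partial q^i}\frac{\partial F}{\partial p_i}$. A critical point of a vector field is a zero of it. For $\alpha,y\in T^{\ast}_qQ$, $\operatorname{vlift}_\alpha(y)=\frac{d}{ds}|_0(\alpha+sy)\in T_\alpha T^{\ast}Q$. The vertical lift of a fiber preserving map $y:T^{\ast}Q\to T^{\ast}Q$ is the vector field $Y(\alpha)=\operatorname{vlift}_\alpha(y(\alpha))$. "$\mathcal{W}$ is given by $W$" means $\mathcal{W}_\alpha=\operatorname{vlift}_\alpha(W_{\pi(\alpha)})$ for all $\alpha$; the rank of $W$ (number of actuators) is at least 1. A function $H$ on $T^{\ast}Q$ is simple if $H=\mathfrak{H}+h\circ\pi$ with $h\in C^\infty(Q)$ and $\mathfrak{H}(\alpha)=\frac12\langle\alpha,\rho^\sharp(\alpha)\rangle$ for a Riemannian metric $\rho$ on $Q$. For another simple function write $\hat H=\hat{\mathfrak{H}}+\hat h\circ\pi$, with Riemannian metric $\hat\rho$. A function is positive definite w.r.t. $\alpha^{\bullet}$ if it is non-negative and vanishes only at $\alpha^{\bullet}$. Fiber derivative: $\mathbb{F}F:T^{\ast}Q\to TQ$, $\langle\sigma,\mathbb{F}F(\alpha)\rangle=\frac{d}{ds}|_0F(\alpha+s\sigma)$;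 so $\mathbb{F}H=\mathbb{F}\mathfrak{H}=\rho^\sharp$, $\mathbb{F}\hat H=\mathbb{F}\hat{\mathfrak{H}}=\hat\rho^\sharp$. A torsion-free connection on $TQ$, and hence the dual one on $T^{\ast}Q$, is fixed. Base derivative: $\mathbb{B}F:T^{\ast}Q\to T^{\ast}Q$, $\langle\mathbb{B}F(\alpha),v\rangle=\frac{d}{ds}|_0F(u(s))$, where $u$ is a horizontal (parallel) curve in $T^{\ast}Q$ with $u(0)=\alpha$ whose projection to $Q$ has velocity $v$ at $s=0$. For $F$ defined on the Whitney sum $T^{\ast}Q\times T^{\ast}Q$, $\langle\mathbb{B}F(\alpha_1,\alpha_2),v\rangle=\frac{d}{ds}|_0F(u_1(s),u_2(s))$ with $u_1,u_2$ horizontal over the same base curve, of velocity $v$ at $s=0$, and $u_i(0)=\alpha_i$. A tensor is a function on a Whitney sum of vector bundles that is multilinear on fibers; all arguments lie over the same base point. Given simple $H,\hat H$, put $\mathfrak{b}(\alpha,\sigma)=\frac12\langle\alpha,\rho^\sharp(\sigma)\rangle$, $\hat{\mathfrak{b}}(\alpha,\sigma)=\frac12\langle\alpha,\hat\rho^\sharp(\sigma)\rangle$, $\hat g(\alpha,\sigma)=\langle\alpha,\mathbb{F}\hat H(\sigma)\rangle=2\hat{\mathfrak b}(\alpha,\sigma)$, $$\Upsilon(\alpha_1,\alpha_2,\alpha_3)=\langle\mathbb{B}\hat{\mathfrak{b}}(\alpha_1,\alpha_2),\mathbb{F}\mathfrak{H}(\alpha_3)\rangle-\langle\mathbb{B}\mathfrak{b}(\alpha_1,\alpha_2),\mathbb{F}\hat{\mathfrak{H}}(\alpha_3)\rangle,$$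 $\hat W=\mathbb{F}\hat{\mathfrak{H}}^{-1}(W^0)$, where $W^0\subset TQ$ is the annihilator of $W$. Thus $\hat W$ is the $\hat g$-orthogonal complement of $W$ and $T^{\ast}Q=W\oplus\hat W$; let $P$ be the orthogonal projection onto $W$. Simple CH method. $Y\in\digamma_{CH}(H,\mathcal{W},\alpha^\bullet)$ iff it is obtained as follows. (1) Find a simple $\hat H$, positive definite w.r.t. $\alpha^{\bullet}$, such that for all $\sigma\in\hat W$: $\langle\mathbb{B}\hat{\mathfrak{H}}(\sigma),\mathbb{F}\mathfrak{H}(\sigma)\rangle-\langle\mathbb{B}\mathfrak{H}(\sigma),\mathbb{F}\hat{\mathfrak{H}}(\sigma)\rangle=0$ and $\langle d\hat h(\pi(\sigma)),\mathbb{F}\mathfrak{H}(\sigma)\rangle-\langle dh(\pi(\sigma)),\mathbb{F}\hat{\mathfrak{H}}(\sigma)\rangle=0$. (2) Fix a tensor $A:W\times W\times\hat W\to\mathbb{R}$ antisymmetric in its first two arguments and a tensor $B:W\times W\times W\to\mathbb{R}$ symmetric in its first two arguments with $B(\gamma,\gamma,\gamma)=0$ for all $\gamma\in W$; define the tensor $\mathfrak{Z}_g:T^{\ast}Q\times T^{\ast}Q\times T^{\ast}Q\to\mathbb{R}$ by, for $\alpha_i\in T^{\ast}Q$, $\sigma,\sigma_i\in\hat W$, $\gamma,\gamma_i\in W$: $\mathfrak{Z}_g(\alpha_1,\alpha_2,\sigma)=\Upsilon(\alpha_1,\alpha_2,\sigma)$; $\mathfrak{Z}_g(\sigma_1,\sigma_2,\gamma)=-\Upsilon(\gamma,\sigma_2,\sigma_1)-\Upsilon(\gamma,\sigma_1,\sigma_2)$;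 $\mathfrak{Z}_g(\gamma_1,\sigma,\gamma_2)=\mathfrak{Z}_g(\sigma,\gamma_1,\gamma_2)=-\frac12[\Upsilon(\gamma_1,\gamma_2,\sigma)+A(\gamma_1,\gamma_2,\sigma)]$; $\mathfrak{Z}_g(\gamma_1,\gamma_2,\gamma_3)=B(\gamma_1,\gamma_2,\gamma_3)$. (3) Fix a non-negative $\mu:T^{\ast}Q\to\mathbb{R}$ vanishing on $\hat W$ and a fiber preserving map $x:T^{\ast}Q\to T^{\ast}Q$ with image in $W$ such that the formula $x(\alpha)-\frac{\hat g(x(\alpha),P(\alpha))+\mu(\alpha)}{\hat g(P(\alpha),P(\alpha))}P(\alpha)$, $\alpha\notin\hat W$, extends to a smooth map on all of $T^{\ast}Q$ and tends to $0$ as $\alpha\to\alpha^{\bullet}$; let $z_d$ be that extension. (4) Put $y(\alpha)=z_d(\alpha)+\mathfrak{Z}_g(\alpha,\alpha,\mathbb{F}\hat H^{-1}(\cdot))-\mathbb{F}\hat H^{-1}\big(\mathbb{F}H(\mathbb{B}\hat H(\alpha))-\mathbb{F}\hat H(\mathbb{B}H(\alpha))\big)$ and let $Y$ be the vertical lift of $y$. Simple LCB method. $Y\in\digamma_{LCB}(H,\mathcal{W},\alpha^\bullet)$ iff it is obtained as follows. (1') Find a simple $\hat H$, positive definite w.r.t. $\alpha^{\bullet}$, with $\{\hat H,H\}(\sigma)=0$ for all $\sigma\in\hat W$. (2') Define $z_\perp:T^{\ast}Q\to\hat W$ by $\hat g(z_\perp(\alpha),\sigma)=0$ for $\sigma\in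 W$ and $\hat g(z_\perp(\alpha),\sigma)=-\Upsilon(\alpha,\alpha,\sigma)$ for $\sigma\in\hat W$. (3') Fix a non-negative $\mu:T^{\ast}Q\to\mathbb{R}$ and a fiber preserving map $x:T^{\ast}Q\to T^{\ast}Q$ with image in $W$ such that the formula $x(\alpha)-\frac{\hat g(x(\alpha),P(\alpha))+\mu(\alpha)-\hat g(z_\perp(\alpha),\alpha)}{\hat g(P(\alpha),P(\alpha))}P(\alpha)$, $\alpha\notin\hat W$, extends to a smooth map on all of $T^{\ast}Q$ and tends to $0$ as $\alpha\to\alpha^{\bullet}$; let $z_{\parallel}$ be that extension. (4') Put $z=z_{\parallel}-z_\perp$, $y(\alpha)=z(\alpha)-\mathbb{F}\hat H^{-1}\big(\mathbb{F}H(\mathbb{B}\hat H(\alpha))-\mathbb{F}\hat H(\mathbb{B}H(\alpha))\big)$ and let $Y$ be the vertical lift of $y$. *)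

theory Defs
  imports "HOL-Analysis.Analysis"
begin

section \<open>Smooth maps between Euclidean spaces\<close>

fun Ck_on :: "nat \<Rightarrow> ('a::euclidean_space \<Rightarrow> 'b::euclidean_space) \<Rightarrow> 'a set \<Rightarrow> bool" where
  "Ck_on 0 f S \<longleftrightarrow> continuous_on S f"
| "Ck_on (Suc k) f S \<longleftrightarrow>
     (\<forall>x\<in>S. f differentiable (at x)) \<and>
     (\<forall>v. Ck_on k (\<lambda>x. frechet_derivative f (at x) v) S)"

text \<open>Only ever used for open \<open>S\<close>.\<close>

definition smooth_on :: "'a::euclidean_space set \<Rightarrow> ('a \<Rightarrow> 'b::euclidean_space) \<Rightarrow> bool" where
  "smooth_on S f \<longleftrightarrow> (\<forall>k. Ck_on k f S)"

definition grad :: "('a::euclidean_space \<Rightarrow> real) \<Rightarrow> 'a \<Rightarrow> 'a" where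
  "grad f x = (\<Sum>b\<in>Basis. frechet_derivative f (at x) b *\<^sub>R b)"


section \<open>Manifolds\<close>

text \<open>
  A chart is a domain together with a coordinate map; the values of the coordinate map
  outside the domain are irrelevant. An atlas is a set of charts. The underlying point set
  and its topology are those determined by the atlas, and the atlas need not be maximal.
\<close>

type_synonym ('m, 'e) chart = "'m set \<times> ('m \<Rightarrow> 'e)"

definition chart_inv :: "('m, 'e) chart \<Rightarrow> 'e \<Rightarrow> 'm" where
  "chart_inv c = inv_into (fst c) (snd c)"

definition transition :: "('m, 'e) chart \<Rightarrow> ('m, 'e) chart \<Rightarrow> 'e \<Rightarrow> 'e" where
  "transition c d = snd d \<circ> chart_inv c"

definition points :: "('m, 'e) chart set \<Rightarrow> 'm set" where
  "points M = (\<Union>c\<in>M. fst c)"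

definition charts_at :: "('m, 'e) chart set \<Rightarrow> 'm \<Rightarrow> ('m, 'e) chart set" where
  "charts_at M q = {c \<in> M. q \<in> fst c}"

text \<open>An arbitrary chart around a point, for quantities that do not depend on the chart.\<close>

definition chart_at :: "('m, 'e) chart set \<Rightarrow> 'm \<Rightarrow> ('m, 'e) chart" where
  "chart_at M q = (SOME c. c \<in> charts_at M q)"

definition manifold_topology :: "('m, 'e::euclidean_space) chart set \<Rightarrow> 'm topology" where
  "manifold_topology M =
     topology (\<lambda>U. U \<subseteq> points M \<and> (\<forall>c\<in>M. open (snd c ` (U \<inter> fst c))))"

definition smooth_atlas :: "('m, 'e::euclidean_space) chart set \<Rightarrow> bool" where
  "smooth_atlas M \<longleftrightarrow>
     (\<forall>c\<in>M. inj_on (snd c) (fst c) \<and> open (snd c ` fst c)) \<and>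
     (\<forall>c\<in>M. \<forall>d\<in>M. open (snd c ` (fst c \<inter> fst d)) \<and>
        smooth_on (snd c ` (fst c \<inter> fst d)) (transition c d))"

definition smooth_manifold :: "('m, 'e::euclidean_space) chart set \<Rightarrow> bool" where
  "smooth_manifold M \<longleftrightarrow> smooth_atlas M \<and>
     Hausdorff_space (manifold_topology M) \<and> second_countable (manifold_topology M)"

definition euclidean_atlas :: "'e set \<Rightarrow> ('e, 'e::euclidean_space) chart set" where
  "euclidean_atlas S = {(S, \<lambda>x. x)}"

text \<open>The openness requirement expresses continuity.\<close>

definition smooth_map ::
  "('m, 'e::euclidean_space) chart set \<Rightarrow> ('n, 'f::euclidean_space) chart set \<Rightarrow> ('m \<Rightarrow> 'n) \<Rightarrow> bool" where
  "smooth_map M N f \<longleftrightarrow> f ` points M \<subseteq> points N \<and>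
     (\<forall>c\<in>M. \<forall>d\<in>N.
        open (snd c ` {m \<in> fst c. f m \<in> fst d}) \<and>
        smooth_on (snd c ` {m \<in> fst c. f m \<in> fst d}) (snd d \<circ> f \<circ> chart_inv c))"

abbreviation smooth_fun :: "('m, 'e::euclidean_space) chart set \<Rightarrow> ('m \<Rightarrow> real) \<Rightarrow> bool" where
  "smooth_fun M f \<equiv> smooth_map M (euclidean_atlas UNIV) f"

text \<open>Smoothness of a function on a subset: locally it is the restriction of a smooth function.\<close>

definition smooth_fun_on_subset ::
  "('m, 'e::euclidean_space) chart set \<Rightarrow> 'm set \<Rightarrow> ('m \<Rightarrow> real) \<Rightarrow> bool" where
  "smooth_fun_on_subset M S f \<longleftrightarrow>
     (\<forall>m\<in>S. \<exists>c\<in>charts_at M m. \<exists>V G. open V \<and> snd c m \<in> V \<and> V \<subseteq> snd c ` fst c \<and>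
        smooth_on V G \<and> (\<forall>x\<in>V. chart_inv c x \<in> S \<longrightarrow> G x = f (chart_inv c x)))"


section \<open>Tangent and cotangent bundle\<close>

text \<open>
  A tangent vector at \<open>q\<close> is the family of its coordinate vectors in all charts around \<open>q\<close>,
  related by the Jacobians of the transition maps; a covector is the family of its coordinate
  covectors, related by the transposed Jacobians, where a covector on the model space is
  represented through the inner product. The components at charts not around \<open>q\<close> are \<open>0\<close>.
  Elements of both bundles carry their base point as first component.
\<close>

type_synonym ('m, 'e) fvec = "'m \<times> (('m, 'e) chart \<Rightarrow> 'e)"

definition tangent_bundle :: "('m, 'e::euclidean_space) chart set \<Rightarrow> ('m, 'e) fvec set" where
  "tangent_bundle M = {(q, v). q \<in> points M \<and>
     (\<forall>c. c \<notin> charts_at M q \<longrightarrow> v c = 0) \<and>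
     (\<forall>c\<in>charts_at M q. \<forall>d\<in>charts_at M q.
        v d = frechet_derivative (transition c d) (at (snd c q)) (v c))}"

definition cotangent_bundle :: "('m, 'e::euclidean_space) chart set \<Rightarrow> ('m, 'e) fvec set" where
  "cotangent_bundle M = {(q, p). q \<in> points M \<and>
     (\<forall>c. c \<notin> charts_at M q \<longrightarrow> p c = 0) \<and>
     (\<forall>c\<in>charts_at M q. \<forall>d\<in>charts_at M q. \<forall>e.
        p c \<bullet> e = p d \<bullet> frechet_derivative (transition c d) (at (snd c q)) e)}"

definition pairing :: "('m, 'e::euclidean_space) chart set \<Rightarrow> ('m, 'e) fvec \<Rightarrow> ('m, 'e) fvec \<Rightarrow> real" where
  "pairing M \<alpha> v = snd \<alpha> (chart_at M (fst \<alpha>)) \<bullet> snd v (chart_at M (fst \<alpha>))"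

text \<open>Fiberwise operations; they are only applied to elements over the same base point.\<close>

definition vadd :: "('m, 'e::real_vector) fvec \<Rightarrow> ('m, 'e) fvec \<Rightarrow> ('m, 'e) fvec" where
  "vadd a b = (fst a, \<lambda>c. snd a c + snd b c)"

definition vscale :: "real \<Rightarrow> ('m, 'e::real_vector) fvec \<Rightarrow> ('m, 'e) fvec" where
  "vscale s a = (fst a, \<lambda>c. s *\<^sub>R snd a c)"

definition vsub :: "('m, 'e::real_vector) fvec \<Rightarrow> ('m, 'e) fvec \<Rightarrow> ('m, 'e) fvec" where
  "vsub a b = vadd a (vscale (-1) b)"

definition vzero :: "'m \<Rightarrow> ('m, 'e::real_vector) fvec" where
  "vzero q = (q, \<lambda>_. 0)"

text \<open>
  Induced atlases of a bundle \<open>E\<close> (tangent or cotangent) and of the Whitney sums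
  \<open>E \<oplus> E\<close> and \<open>E \<oplus> E \<oplus> E\<close>. For the cotangent bundle these are the canonical coordinates.
\<close>

definition bundle_chart ::
  "('m, 'e) fvec set \<Rightarrow> ('m, 'e) chart \<Rightarrow> (('m, 'e) fvec, 'e \<times> 'e) chart" where
  "bundle_chart E c = ({a \<in> E. fst a \<in> fst c}, \<lambda>a. (snd c (fst a), snd a c))"

definition whitney2_chart ::
  "('m, 'e) fvec set \<Rightarrow> ('m, 'e) chart \<Rightarrow>
   (('m, 'e) fvec \<times> ('m, 'e) fvec, 'e \<times> 'e \<times> 'e) chart" where
  "whitney2_chart E c =
     ({(a1, a2). a1 \<in> E \<and> a2 \<in> E \<and> fst a1 = fst a2 \<and> fst a1 \<in> fst c},
      \<lambda>(a1, a2). (snd c (fst a1), snd a1 c, snd a2 c))"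

definition whitney3_chart ::
  "('m, 'e) fvec set \<Rightarrow> ('m, 'e) chart \<Rightarrow>
   (('m, 'e) fvec \<times> ('m, 'e) fvec \<times> ('m, 'e) fvec, 'e \<times> 'e \<times> 'e \<times> 'e) chart" where
  "whitney3_chart E c =
     ({(a1, a2, a3). a1 \<in> E \<and> a2 \<in> E \<and> a3 \<in> E \<and> fst a1 = fst a2 \<and> fst a1 = fst a3 \<and>
        fst a1 \<in> fst c},
      \<lambda>(a1, a2, a3). (snd c (fst a1), snd a1 c, snd a2 c, snd a3 c))"

definition tangent_atlas ::
  "('m, 'e::euclidean_space) chart set \<Rightarrow> (('m, 'e) fvec, 'e \<times> 'e) chart set" where
  "tangent_atlas M = bundle_chart (tangent_bundle M) ` M"

definition cotangent_atlas ::
  "('m, 'e::euclidean_space) chart set \<Rightarrow> (('m, 'e) fvec, 'e \<times> 'e) chart set" where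
  "cotangent_atlas M = bundle_chart (cotangent_bundle M) ` M"

definition velocity ::
  "('m, 'e::euclidean_space) chart set \<Rightarrow> (real \<Rightarrow> 'm) \<Rightarrow> real \<Rightarrow> ('m, 'e) fvec" where
  "velocity M u s =
     (u s, \<lambda>c. if c \<in> charts_at M (u s) then vector_derivative (snd c \<circ> u) (at s) else 0)"

definition differential ::
  "('m, 'e::euclidean_space) chart set \<Rightarrow> ('m \<Rightarrow> real) \<Rightarrow> 'm \<Rightarrow> ('m, 'e) fvec" where
  "differential M f m =
     (m, \<lambda>c. if c \<in> charts_at M m then grad (f \<circ> chart_inv c) (snd c m) else 0)"

text \<open>Extensional, so that equality of functions is equality on the manifold.\<close>

definition vector_fields ::
  "('m, 'e::euclidean_space) chart set \<Rightarrow> ('m \<Rightarrow> ('m, 'e) fvec) set" where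
  "vector_fields M = {X \<in> extensional (points M).
     smooth_map M (tangent_atlas M) X \<and> (\<forall>m\<in>points M. fst (X m) = m)}"


section \<open>Tensors and subbundles\<close>

definition fiber_linear :: "('m, 'e::real_vector) fvec set \<Rightarrow> 'm \<Rightarrow> (('m, 'e) fvec \<Rightarrow> real) \<Rightarrow> bool" where
  "fiber_linear V q L \<longleftrightarrow>
     (\<forall>a\<in>V. \<forall>b\<in>V. fst a = q \<longrightarrow> fst b = q \<longrightarrow> L (vadd a b) = L a + L b) \<and>
     (\<forall>a\<in>V. \<forall>s. fst a = q \<longrightarrow> L (vscale s a) = s * L a)"

definition tangent_tensor2 ::
  "('m, 'e::euclidean_space) chart set \<Rightarrow> (('m, 'e) fvec \<Rightarrow> ('m, 'e) fvec \<Rightarrow> real) \<Rightarrow> bool" where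
  "tangent_tensor2 M T \<longleftrightarrow>
     smooth_fun (whitney2_chart (tangent_bundle M) ` M) (\<lambda>(v, w). T v w) \<and>
     (\<forall>v\<in>tangent_bundle M.
        fiber_linear (tangent_bundle M) (fst v) (\<lambda>w. T v w) \<and>
        fiber_linear (tangent_bundle M) (fst v) (\<lambda>w. T w v))"

definition tensor3 ::
  "('m, 'e::euclidean_space) chart set \<Rightarrow>
   ('m, 'e) fvec set \<Rightarrow> ('m, 'e) fvec set \<Rightarrow> ('m, 'e) fvec set \<Rightarrow>
   (('m, 'e) fvec \<Rightarrow> ('m, 'e) fvec \<Rightarrow> ('m, 'e) fvec \<Rightarrow> real) \<Rightarrow> bool" where
  "tensor3 M V1 V2 V3 T \<longleftrightarrow>
     smooth_fun_on_subset (whitney3_chart (cotangent_bundle M) ` M)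
       {(a1, a2, a3). a1 \<in> V1 \<and> a2 \<in> V2 \<and> a3 \<in> V3 \<and> fst a1 = fst a2 \<and> fst a1 = fst a3}
       (\<lambda>(a1, a2, a3). T a1 a2 a3) \<and>
     (\<forall>a2\<in>V2. \<forall>a3\<in>V3. fst a2 = fst a3 \<longrightarrow> fiber_linear V1 (fst a2) (\<lambda>a1. T a1 a2 a3)) \<and>
     (\<forall>a1\<in>V1. \<forall>a3\<in>V3. fst a1 = fst a3 \<longrightarrow> fiber_linear V2 (fst a1) (\<lambda>a2. T a1 a2 a3)) \<and>
     (\<forall>a1\<in>V1. \<forall>a2\<in>V2. fst a1 = fst a2 \<longrightarrow> fiber_linear V3 (fst a1) (\<lambda>a3. T a1 a2 a3))"

text \<open>The functions \<open>b i\<close>, for \<open>i < k\<close>, are the coordinate expression of a smooth local frame.\<close>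

definition linear_subbundle ::
  "('m, 'e::euclidean_space) chart set \<Rightarrow> nat \<Rightarrow> ('m, 'e) fvec set \<Rightarrow> bool" where
  "linear_subbundle M k W \<longleftrightarrow> W \<subseteq> cotangent_bundle M \<and>
     (\<forall>q\<in>points M. \<exists>c\<in>charts_at M q. \<exists>V b.
        open V \<and> snd c q \<in> V \<and> V \<subseteq> snd c ` fst c \<and>
        (\<forall>i<k. smooth_on V (b i)) \<and>
        (\<forall>x\<in>V. inj_on (\<lambda>i. b i x) {..<k} \<and> independent ((\<lambda>i. b i x) ` {..<k}) \<and>
           {snd a c | a. a \<in> W \<and> fst a = chart_inv c x} = span ((\<lambda>i. b i x) ` {..<k})))"

definition annihilator ::
  "('m, 'e::euclidean_space) chart set \<Rightarrow> ('m, 'e) fvec set \<Rightarrow> ('m, 'e) fvec set" where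
  "annihilator M W = {v \<in> tangent_bundle M. \<forall>\<alpha>\<in>W. fst \<alpha> = fst v \<longrightarrow> pairing M \<alpha> v = 0}"

definition vlift ::
  "('m, 'e::euclidean_space) chart set \<Rightarrow> ('m, 'e) fvec \<Rightarrow> ('m, 'e) fvec \<Rightarrow>
   (('m, 'e) fvec, 'e \<times> 'e) fvec" where
  "vlift M \<alpha> y = velocity (cotangent_atlas M) (\<lambda>s. vadd \<alpha> (vscale s y)) 0"

definition vertical_subbundle ::
  "('m, 'e::euclidean_space) chart set \<Rightarrow> ('m, 'e) fvec set \<Rightarrow>
   (('m, 'e) fvec, 'e \<times> 'e) fvec set" where
  "vertical_subbundle M W =
     {vlift M \<alpha> y | \<alpha> y. \<alpha> \<in> cotangent_bundle M \<and> y \<in> W \<and> fst y = fst \<alpha>}"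

definition fiber_preserving ::
  "('m, 'e::euclidean_space) chart set \<Rightarrow> (('m, 'e) fvec \<Rightarrow> ('m, 'e) fvec) \<Rightarrow> bool" where
  "fiber_preserving M y \<longleftrightarrow>
     smooth_map (cotangent_atlas M) (cotangent_atlas M) y \<and>
     (\<forall>\<alpha>\<in>cotangent_bundle M. fst (y \<alpha>) = fst \<alpha>)"


section \<open>Connections, horizontal curves, fiber and base derivative\<close>

text \<open>
  A connection on the tangent bundle is given by its Christoffel symbols: in a chart \<open>c\<close>, the
  covariant derivative of a vector field \<open>w\<close> in direction \<open>v\<close> is \<open>Dw v + \<Gamma> c x v w\<close>. That this
  is a vector amounts to the transformation rule.
\<close>

type_synonym ('m, 'e) christoffel = "('m, 'e) chart \<Rightarrow> 'e \<Rightarrow> 'e \<Rightarrow> 'e \<Rightarrow> 'e"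

definition connection ::
  "('m, 'e::euclidean_space) chart set \<Rightarrow> ('m, 'e) christoffel \<Rightarrow> bool" where
  "connection M \<Gamma> \<longleftrightarrow>
     (\<forall>c\<in>M. \<forall>x\<in>snd c ` fst c. bilinear (\<Gamma> c x)) \<and>
     (\<forall>c\<in>M. \<forall>v w. smooth_on (snd c ` fst c) (\<lambda>x. \<Gamma> c x v w)) \<and>
     (\<forall>c\<in>M. \<forall>d\<in>M. \<forall>x\<in>snd c ` (fst c \<inter> fst d). \<forall>v w.
        let \<tau> = transition c d; D = (\<lambda>z. frechet_derivative \<tau> (at z)) in
        \<Gamma> d (\<tau> x) (D x v) (D x w) =
          D x (\<Gamma> c x v w) - frechet_derivative (\<lambda>z. D z w) (at x) v)"

definition torsion_free ::
  "('m, 'e::euclidean_space) chart set \<Rightarrow> ('m, 'e) christoffel \<Rightarrow> bool" where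
  "torsion_free M \<Gamma> \<longleftrightarrow>
     (\<forall>c\<in>M. \<forall>x\<in>snd c ` fst c. \<forall>v w. \<Gamma> c x v w = \<Gamma> c x w v)"

text \<open>
  Parallel curves for the dual connection on the cotangent bundle: in coordinates,
  \<open>dp\<^sub>j/ds = \<Gamma>\<^sup>k\<^sub>i\<^sub>j (dq\<^sup>i/ds) p\<^sub>k\<close>, i.e. the pairing with parallel vector fields along the base
  curve is constant.
\<close>

definition horizontal_curve ::
  "('m, 'e::euclidean_space) chart set \<Rightarrow> ('m, 'e) christoffel \<Rightarrow> real \<Rightarrow>
   (real \<Rightarrow> ('m, 'e) fvec) \<Rightarrow> bool" where
  "horizontal_curve M \<Gamma> \<epsilon> u \<longleftrightarrow>
     smooth_map (euclidean_atlas {-\<epsilon><..<\<epsilon>}) (cotangent_atlas M) u \<and>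
     (\<forall>s\<in>{-\<epsilon><..<\<epsilon>}. \<forall>c\<in>charts_at M (fst (u s)). \<forall>w.
        vector_derivative (\<lambda>t. snd (u t) c) (at s) \<bullet> w =
          snd (u s) c \<bullet> \<Gamma> c (snd c (fst (u s))) (vector_derivative (\<lambda>t. snd c (fst (u t))) (at s)) w)"

definition fiber_deriv ::
  "('m, 'e::euclidean_space) chart set \<Rightarrow> (('m, 'e) fvec \<Rightarrow> real) \<Rightarrow> ('m, 'e) fvec \<Rightarrow> ('m, 'e) fvec" where
  "fiber_deriv M F \<alpha> = (THE v. v \<in> tangent_bundle M \<and> fst v = fst \<alpha> \<and>
     (\<forall>\<sigma>\<in>cotangent_bundle M. fst \<sigma> = fst \<alpha> \<longrightarrow>
        ((\<lambda>s. F (vadd \<alpha> (vscale s \<sigma>))) has_real_derivative pairing M \<sigma> v) (at 0)))"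

definition fiber_deriv_inv ::
  "('m, 'e::euclidean_space) chart set \<Rightarrow> (('m, 'e) fvec \<Rightarrow> real) \<Rightarrow> ('m, 'e) fvec \<Rightarrow> ('m, 'e) fvec" where
  "fiber_deriv_inv M F = inv_into (cotangent_bundle M) (fiber_deriv M F)"

definition base_deriv ::
  "('m, 'e::euclidean_space) chart set \<Rightarrow> ('m, 'e) christoffel \<Rightarrow>
   (('m, 'e) fvec \<Rightarrow> real) \<Rightarrow> ('m, 'e) fvec \<Rightarrow> ('m, 'e) fvec" where
  "base_deriv M \<Gamma> F \<alpha> = (THE \<beta>. \<beta> \<in> cotangent_bundle M \<and> fst \<beta> = fst \<alpha> \<and>
     (\<forall>v\<in>tangent_bundle M. fst v = fst \<alpha> \<longrightarrow>
       (\<forall>\<epsilon>>0. \<forall>u. horizontal_curve M \<Gamma> \<epsilon> u \<and> u 0 = \<alpha> \<and> velocity M (fst \<circ> u) 0 = v \<longrightarrow>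
          ((\<lambda>s. F (u s)) has_real_derivative pairing M \<beta> v) (at 0))))"

definition base_deriv2 ::
  "('m, 'e::euclidean_space) chart set \<Rightarrow> ('m, 'e) christoffel \<Rightarrow>
   (('m, 'e) fvec \<Rightarrow> ('m, 'e) fvec \<Rightarrow> real) \<Rightarrow> ('m, 'e) fvec \<Rightarrow> ('m, 'e) fvec \<Rightarrow> ('m, 'e) fvec" where
  "base_deriv2 M \<Gamma> F \<alpha>1 \<alpha>2 = (THE \<beta>. \<beta> \<in> cotangent_bundle M \<and> fst \<beta> = fst \<alpha>1 \<and>
     (\<forall>v\<in>tangent_bundle M. fst v = fst \<alpha>1 \<longrightarrow>
       (\<forall>\<epsilon>>0. \<forall>u1 u2.
          horizontal_curve M \<Gamma> \<epsilon> u1 \<and> horizontal_curve M \<Gamma> \<epsilon> u2 \<and>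
          (\<forall>s\<in>{-\<epsilon><..<\<epsilon>}. fst (u1 s) = fst (u2 s)) \<and>
          u1 0 = \<alpha>1 \<and> u2 0 = \<alpha>2 \<and> velocity M (fst \<circ> u1) 0 = v \<longrightarrow>
          ((\<lambda>s. F (u1 s) (u2 s)) has_real_derivative pairing M \<beta> v) (at 0))))"


section \<open>Simple Hamiltonian systems\<close>

text \<open>
  In a canonical chart, \<open>grad (H \<circ> chart_inv \<Phi>)\<close> is the pair \<open>(\<partial>H/\<partial>q, \<partial>H/\<partial>p)\<close>.
\<close>

definition hamiltonian_vector_field ::
  "('m, 'e::euclidean_space) chart set \<Rightarrow> (('m, 'e) fvec \<Rightarrow> real) \<Rightarrow> ('m, 'e) fvec \<Rightarrow>
   (('m, 'e) fvec, 'e \<times> 'e) fvec" where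
  "hamiltonian_vector_field M H \<alpha> =
     (\<alpha>, \<lambda>\<Phi>. if \<Phi> \<in> charts_at (cotangent_atlas M) \<alpha>
        then let g = grad (H \<circ> chart_inv \<Phi>) (snd \<Phi> \<alpha>) in (snd g, - fst g) else 0)"

definition poisson_bracket ::
  "('m, 'e::euclidean_space) chart set \<Rightarrow> (('m, 'e) fvec \<Rightarrow> real) \<Rightarrow> (('m, 'e) fvec \<Rightarrow> real) \<Rightarrow>
   ('m, 'e) fvec \<Rightarrow> real" where
  "poisson_bracket M F G \<alpha> =
     (let \<Phi> = chart_at (cotangent_atlas M) \<alpha>;
          f = grad (F \<circ> chart_inv \<Phi>) (snd \<Phi> \<alpha>);
          g = grad (G \<circ> chart_inv \<Phi>) (snd \<Phi> \<alpha>)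
      in fst f \<bullet> snd g - fst g \<bullet> snd f)"

definition riemannian_metric ::
  "('m, 'e::euclidean_space) chart set \<Rightarrow> (('m, 'e) fvec \<Rightarrow> ('m, 'e) fvec \<Rightarrow> real) \<Rightarrow> bool" where
  "riemannian_metric M \<rho> \<longleftrightarrow> tangent_tensor2 M \<rho> \<and>
     (\<forall>v\<in>tangent_bundle M. \<forall>w\<in>tangent_bundle M. fst v = fst w \<longrightarrow> \<rho> v w = \<rho> w v) \<and>
     (\<forall>v\<in>tangent_bundle M. v \<noteq> vzero (fst v) \<longrightarrow> \<rho> v v > 0)"

definition sharp ::
  "('m, 'e::euclidean_space) chart set \<Rightarrow> (('m, 'e) fvec \<Rightarrow> ('m, 'e) fvec \<Rightarrow> real) \<Rightarrow>
   ('m, 'e) fvec \<Rightarrow> ('m, 'e) fvec" where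
  "sharp M \<rho> \<alpha> = (THE v. v \<in> tangent_bundle M \<and> fst v = fst \<alpha> \<and>
     (\<forall>w\<in>tangent_bundle M. fst w = fst \<alpha> \<longrightarrow> \<rho> v w = pairing M \<alpha> w))"

definition half_form ::
  "('m, 'e::euclidean_space) chart set \<Rightarrow> (('m, 'e) fvec \<Rightarrow> ('m, 'e) fvec \<Rightarrow> real) \<Rightarrow>
   ('m, 'e) fvec \<Rightarrow> ('m, 'e) fvec \<Rightarrow> real" where
  "half_form M \<rho> \<alpha> \<sigma> = 1/2 * pairing M \<alpha> (sharp M \<rho> \<sigma>)"

definition kinetic ::
  "('m, 'e::euclidean_space) chart set \<Rightarrow> (('m, 'e) fvec \<Rightarrow> ('m, 'e) fvec \<Rightarrow> real) \<Rightarrow>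
   ('m, 'e) fvec \<Rightarrow> real" where
  "kinetic M \<rho> \<alpha> = 1/2 * pairing M \<alpha> (sharp M \<rho> \<alpha>)"

definition simple_with ::
  "('m, 'e::euclidean_space) chart set \<Rightarrow> (('m, 'e) fvec \<Rightarrow> real) \<Rightarrow>
   (('m, 'e) fvec \<Rightarrow> ('m, 'e) fvec \<Rightarrow> real) \<Rightarrow> ('m \<Rightarrow> real) \<Rightarrow> bool" where
  "simple_with M H \<rho> h \<longleftrightarrow> riemannian_metric M \<rho> \<and> smooth_fun M h \<and>
     (\<forall>\<alpha>\<in>cotangent_bundle M. H \<alpha> = kinetic M \<rho> \<alpha> + h (fst \<alpha>))"

definition simple ::
  "('m, 'e::euclidean_space) chart set \<Rightarrow> (('m, 'e) fvec \<Rightarrow> real) \<Rightarrow> bool" where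
  "simple M H \<longleftrightarrow> (\<exists>\<rho> h. simple_with M H \<rho> h)"

definition positive_definite_wrt ::
  "('m, 'e::euclidean_space) chart set \<Rightarrow> (('m, 'e) fvec \<Rightarrow> real) \<Rightarrow> ('m, 'e) fvec \<Rightarrow> bool" where
  "positive_definite_wrt M F \<alpha>0 \<longleftrightarrow>
     (\<forall>\<alpha>\<in>cotangent_bundle M. F \<alpha> \<ge> 0 \<and> (F \<alpha> = 0 \<longleftrightarrow> \<alpha> = \<alpha>0))"


section \<open>The two methods\<close>

text \<open>
  Throughout, unprimed \<open>H, \<rho>, h\<close> belong to the given Hamiltonian, primed \<open>H', \<rho>', h'\<close> to the
  function written with a hat in the mathematical text.
\<close>

definition ghat ::
  "('m, 'e::euclidean_space) chart set \<Rightarrow> (('m, 'e) fvec \<Rightarrow> real) \<Rightarrow>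
   ('m, 'e) fvec \<Rightarrow> ('m, 'e) fvec \<Rightarrow> real" where
  "ghat M H' \<alpha> \<sigma> = pairing M \<alpha> (fiber_deriv M H' \<sigma>)"

definition Upsilon ::
  "('m, 'e::euclidean_space) chart set \<Rightarrow> ('m, 'e) christoffel \<Rightarrow>
   (('m, 'e) fvec \<Rightarrow> ('m, 'e) fvec \<Rightarrow> real) \<Rightarrow> (('m, 'e) fvec \<Rightarrow> ('m, 'e) fvec \<Rightarrow> real) \<Rightarrow>
   ('m, 'e) fvec \<Rightarrow> ('m, 'e) fvec \<Rightarrow> ('m, 'e) fvec \<Rightarrow> real" where
  "Upsilon M \<Gamma> \<rho> \<rho>' \<alpha>1 \<alpha>2 \<alpha>3 =
     pairing M (base_deriv2 M \<Gamma> (half_form M \<rho>') \<alpha>1 \<alpha>2) (fiber_deriv M (kinetic M \<rho>) \<alpha>3) -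
     pairing M (base_deriv2 M \<Gamma> (half_form M \<rho>) \<alpha>1 \<alpha>2) (fiber_deriv M (kinetic M \<rho>') \<alpha>3)"

definition What ::
  "('m, 'e::euclidean_space) chart set \<Rightarrow> ('m, 'e) fvec set \<Rightarrow>
   (('m, 'e) fvec \<Rightarrow> ('m, 'e) fvec \<Rightarrow> real) \<Rightarrow> ('m, 'e) fvec set" where
  "What M W \<rho>' = fiber_deriv_inv M (kinetic M \<rho>') ` annihilator M W"

definition projW ::
  "('m, 'e::euclidean_space) chart set \<Rightarrow> ('m, 'e) fvec set \<Rightarrow>
   (('m, 'e) fvec \<Rightarrow> ('m, 'e) fvec \<Rightarrow> real) \<Rightarrow> ('m, 'e) fvec \<Rightarrow> ('m, 'e) fvec" where
  "projW M W \<rho>' \<alpha> = (THE \<gamma>. \<gamma> \<in> W \<and> fst \<gamma> = fst \<alpha> \<and>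
     (\<exists>\<sigma>\<in>What M W \<rho>'. fst \<sigma> = fst \<alpha> \<and> \<alpha> = vadd \<gamma> \<sigma>))"

text \<open>
  \<open>f\<close>, considered on the cotangent bundle outside \<open>S\<close>, extends to the smooth map \<open>z\<close> and
  tends to \<open>0\<close> at \<open>\<alpha>0\<close>.
\<close>

definition extends_and_vanishes ::
  "('m, 'e::euclidean_space) chart set \<Rightarrow> ('m, 'e) fvec set \<Rightarrow> ('m, 'e) fvec \<Rightarrow>
   (('m, 'e) fvec \<Rightarrow> ('m, 'e) fvec) \<Rightarrow> (('m, 'e) fvec \<Rightarrow> ('m, 'e) fvec) \<Rightarrow> bool" where
  "extends_and_vanishes M S \<alpha>0 f z \<longleftrightarrow>
     fiber_preserving M z \<and> (\<forall>\<alpha>\<in>cotangent_bundle M - S. z \<alpha> = f \<alpha>) \<and>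
     limitin (manifold_topology (cotangent_atlas M)) f (vzero (fst \<alpha>0))
       (atin_within (manifold_topology (cotangent_atlas M)) \<alpha>0 (cotangent_bundle M - S))"

definition matching_term ::
  "('m, 'e::euclidean_space) chart set \<Rightarrow> ('m, 'e) christoffel \<Rightarrow>
   (('m, 'e) fvec \<Rightarrow> real) \<Rightarrow> (('m, 'e) fvec \<Rightarrow> real) \<Rightarrow> ('m, 'e) fvec \<Rightarrow> ('m, 'e) fvec" where
  "matching_term M \<Gamma> H H' \<alpha> = fiber_deriv_inv M H'
     (vsub (fiber_deriv M H (base_deriv M \<Gamma> H' \<alpha>)) (fiber_deriv M H' (base_deriv M \<Gamma> H \<alpha>)))"

definition vertical_lift_field ::
  "('m, 'e::euclidean_space) chart set \<Rightarrow> (('m, 'e) fvec \<Rightarrow> ('m, 'e) fvec) \<Rightarrow>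
   ('m, 'e) fvec \<Rightarrow> (('m, 'e) fvec, 'e \<times> 'e) fvec" where
  "vertical_lift_field M y = (\<lambda>\<alpha>\<in>cotangent_bundle M. vlift M \<alpha> (y \<alpha>))"

subsection \<open>The simple CH method\<close>

definition CH_equations ::
  "('m, 'e::euclidean_space) chart set \<Rightarrow> ('m, 'e) christoffel \<Rightarrow> ('m, 'e) fvec set \<Rightarrow>
   (('m, 'e) fvec \<Rightarrow> ('m, 'e) fvec \<Rightarrow> real) \<Rightarrow> ('m \<Rightarrow> real) \<Rightarrow>
   (('m, 'e) fvec \<Rightarrow> ('m, 'e) fvec \<Rightarrow> real) \<Rightarrow> ('m \<Rightarrow> real) \<Rightarrow> bool" where
  "CH_equations M \<Gamma> W \<rho> h \<rho>' h' \<longleftrightarrow> (\<forall>\<sigma>\<in>What M W \<rho>'.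
     pairing M (base_deriv M \<Gamma> (kinetic M \<rho>') \<sigma>) (fiber_deriv M (kinetic M \<rho>) \<sigma>) -
     pairing M (base_deriv M \<Gamma> (kinetic M \<rho>) \<sigma>) (fiber_deriv M (kinetic M \<rho>') \<sigma>) = 0 \<and>
     pairing M (differential M h' (fst \<sigma>)) (fiber_deriv M (kinetic M \<rho>) \<sigma>) -
     pairing M (differential M h (fst \<sigma>)) (fiber_deriv M (kinetic M \<rho>') \<sigma>) = 0)"

text \<open>
  Since the cotangent bundle is the direct sum of \<open>W\<close> and its orthogonal complement, the last
  four clauses determine \<open>Z\<close> on the cotangent bundle.
\<close>

definition gyroscopic_tensor ::
  "('m, 'e::euclidean_space) chart set \<Rightarrow> ('m, 'e) christoffel \<Rightarrow> ('m, 'e) fvec set \<Rightarrow>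
   (('m, 'e) fvec \<Rightarrow> ('m, 'e) fvec \<Rightarrow> real) \<Rightarrow> (('m, 'e) fvec \<Rightarrow> ('m, 'e) fvec \<Rightarrow> real) \<Rightarrow>
   (('m, 'e) fvec \<Rightarrow> ('m, 'e) fvec \<Rightarrow> ('m, 'e) fvec \<Rightarrow> real) \<Rightarrow>
   (('m, 'e) fvec \<Rightarrow> ('m, 'e) fvec \<Rightarrow> ('m, 'e) fvec \<Rightarrow> real) \<Rightarrow>
   (('m, 'e) fvec \<Rightarrow> ('m, 'e) fvec \<Rightarrow> ('m, 'e) fvec \<Rightarrow> real) \<Rightarrow> bool" where
  "gyroscopic_tensor M \<Gamma> W \<rho> \<rho>' A B Z \<longleftrightarrow>
     (let T = cotangent_bundle M; W' = What M W \<rho>'; Y = Upsilon M \<Gamma> \<rho> \<rho>' in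
      tensor3 M W W W' A \<and>
      (\<forall>\<gamma>1\<in>W. \<forall>\<gamma>2\<in>W. \<forall>\<sigma>\<in>W'. fst \<gamma>1 = fst \<gamma>2 \<longrightarrow> fst \<gamma>1 = fst \<sigma> \<longrightarrow>
         A \<gamma>1 \<gamma>2 \<sigma> = - A \<gamma>2 \<gamma>1 \<sigma>) \<and>
      tensor3 M W W W B \<and>
      (\<forall>\<gamma>1\<in>W. \<forall>\<gamma>2\<in>W. \<forall>\<gamma>3\<in>W. fst \<gamma>1 = fst \<gamma>2 \<longrightarrow> fst \<gamma>1 = fst \<gamma>3 \<longrightarrow>
         B \<gamma>1 \<gamma>2 \<gamma>3 = B \<gamma>2 \<gamma>1 \<gamma>3) \<and>
      (\<forall>\<gamma>\<in>W. B \<gamma> \<gamma> \<gamma> = 0) \<and>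
      tensor3 M T T T Z \<and>
      (\<forall>\<alpha>1\<in>T. \<forall>\<alpha>2\<in>T. \<forall>\<sigma>\<in>W'. fst \<alpha>1 = fst \<alpha>2 \<longrightarrow> fst \<alpha>1 = fst \<sigma> \<longrightarrow>
         Z \<alpha>1 \<alpha>2 \<sigma> = Y \<alpha>1 \<alpha>2 \<sigma>) \<and>
      (\<forall>\<sigma>1\<in>W'. \<forall>\<sigma>2\<in>W'. \<forall>\<gamma>\<in>W. fst \<sigma>1 = fst \<sigma>2 \<longrightarrow> fst \<sigma>1 = fst \<gamma> \<longrightarrow>
         Z \<sigma>1 \<sigma>2 \<gamma> = - Y \<gamma> \<sigma>2 \<sigma>1 - Y \<gamma> \<sigma>1 \<sigma>2) \<and>
      (\<forall>\<gamma>1\<in>W. \<forall>\<sigma>\<in>W'. \<forall>\<gamma>2\<in>W. fst \<gamma>1 = fst \<sigma> \<longrightarrow> fst \<gamma>1 = fst \<gamma>2 \<longrightarrow>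
         Z \<gamma>1 \<sigma> \<gamma>2 = - 1/2 * (Y \<gamma>1 \<gamma>2 \<sigma> + A \<gamma>1 \<gamma>2 \<sigma>) \<and>
         Z \<sigma> \<gamma>1 \<gamma>2 = - 1/2 * (Y \<gamma>1 \<gamma>2 \<sigma> + A \<gamma>1 \<gamma>2 \<sigma>)) \<and>
      (\<forall>\<gamma>1\<in>W. \<forall>\<gamma>2\<in>W. \<forall>\<gamma>3\<in>W. fst \<gamma>1 = fst \<gamma>2 \<longrightarrow> fst \<gamma>1 = fst \<gamma>3 \<longrightarrow>
         Z \<gamma>1 \<gamma>2 \<gamma>3 = B \<gamma>1 \<gamma>2 \<gamma>3))"

definition gyroscopic_force ::
  "('m, 'e::euclidean_space) chart set \<Rightarrow> (('m, 'e) fvec \<Rightarrow> real) \<Rightarrow>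
   (('m, 'e) fvec \<Rightarrow> ('m, 'e) fvec \<Rightarrow> ('m, 'e) fvec \<Rightarrow> real) \<Rightarrow> ('m, 'e) fvec \<Rightarrow> ('m, 'e) fvec" where
  "gyroscopic_force M H' Z \<alpha> = (THE \<beta>. \<beta> \<in> cotangent_bundle M \<and> fst \<beta> = fst \<alpha> \<and>
     (\<forall>v\<in>tangent_bundle M. fst v = fst \<alpha> \<longrightarrow> pairing M \<beta> v = Z \<alpha> \<alpha> (fiber_deriv_inv M H' v)))"

definition CH_dissipative ::
  "('m, 'e::euclidean_space) chart set \<Rightarrow> ('m, 'e) fvec set \<Rightarrow> ('m, 'e) fvec \<Rightarrow>
   (('m, 'e) fvec \<Rightarrow> real) \<Rightarrow> (('m, 'e) fvec \<Rightarrow> ('m, 'e) fvec \<Rightarrow> real) \<Rightarrow>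
   (('m, 'e) fvec \<Rightarrow> ('m, 'e) fvec) \<Rightarrow> bool" where
  "CH_dissipative M W \<alpha>0 H' \<rho>' zd \<longleftrightarrow>
     (let W' = What M W \<rho>'; P = projW M W \<rho>'; g = ghat M H' in
      \<exists>\<mu> x. smooth_fun (cotangent_atlas M) \<mu> \<and>
        (\<forall>\<alpha>\<in>cotangent_bundle M. \<mu> \<alpha> \<ge> 0) \<and> (\<forall>\<sigma>\<in>W'. \<mu> \<sigma> = 0) \<and>
        fiber_preserving M x \<and> x ` cotangent_bundle M \<subseteq> W \<and>
        extends_and_vanishes M W' \<alpha>0
          (\<lambda>\<alpha>. vsub (x \<alpha>) (vscale ((g (x \<alpha>) (P \<alpha>) + \<mu> \<alpha>) / g (P \<alpha>) (P \<alpha>)) (P \<alpha>))) zd)"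

definition CH_laws ::
  "('m, 'e::euclidean_space) chart set \<Rightarrow> ('m, 'e) christoffel \<Rightarrow>
   (('m, 'e) fvec \<Rightarrow> real) \<times> (('m, 'e) fvec, 'e \<times> 'e) fvec set \<times> ('m, 'e) fvec \<Rightarrow>
   (('m, 'e) fvec \<Rightarrow> (('m, 'e) fvec, 'e \<times> 'e) fvec) set" where
  "CH_laws M \<Gamma> = (\<lambda>(H, VW, \<alpha>0). {Y \<in> vector_fields (cotangent_atlas M).
     \<exists>k W \<rho> h H' \<rho>' h' A B Z zd.
       k \<ge> 1 \<and> linear_subbundle M k W \<and> VW = vertical_subbundle M W \<and>
       simple_with M H \<rho> h \<and>
       simple_with M H' \<rho>' h' \<and> positive_definite_wrt M H' \<alpha>0 \<and>
       CH_equations M \<Gamma> W \<rho> h \<rho>' h' \<and>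
       gyroscopic_tensor M \<Gamma> W \<rho> \<rho>' A B Z \<and>
       CH_dissipative M W \<alpha>0 H' \<rho>' zd \<and>
       Y = vertical_lift_field M
         (\<lambda>\<alpha>. vsub (vadd (zd \<alpha>) (gyroscopic_force M H' Z \<alpha>)) (matching_term M \<Gamma> H H' \<alpha>))})"

subsection \<open>The simple LCB method\<close>

definition LCB_equation ::
  "('m, 'e::euclidean_space) chart set \<Rightarrow> ('m, 'e) fvec set \<Rightarrow>
   (('m, 'e) fvec \<Rightarrow> real) \<Rightarrow> (('m, 'e) fvec \<Rightarrow> real) \<Rightarrow>
   (('m, 'e) fvec \<Rightarrow> ('m, 'e) fvec \<Rightarrow> real) \<Rightarrow> bool" where
  "LCB_equation M W H H' \<rho>' \<longleftrightarrow> (\<forall>\<sigma>\<in>What M W \<rho>'. poisson_bracket M H' H \<sigma> = 0)"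

definition z_perp ::
  "('m, 'e::euclidean_space) chart set \<Rightarrow> ('m, 'e) christoffel \<Rightarrow> ('m, 'e) fvec set \<Rightarrow>
   (('m, 'e) fvec \<Rightarrow> ('m, 'e) fvec \<Rightarrow> real) \<Rightarrow> (('m, 'e) fvec \<Rightarrow> real) \<Rightarrow>
   (('m, 'e) fvec \<Rightarrow> ('m, 'e) fvec \<Rightarrow> real) \<Rightarrow> ('m, 'e) fvec \<Rightarrow> ('m, 'e) fvec" where
  "z_perp M \<Gamma> W \<rho> H' \<rho>' \<alpha> = (THE \<zeta>. \<zeta> \<in> What M W \<rho>' \<and> fst \<zeta> = fst \<alpha> \<and>
     (\<forall>\<sigma>\<in>W. fst \<sigma> = fst \<alpha> \<longrightarrow> ghat M H' \<zeta> \<sigma> = 0) \<and>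
     (\<forall>\<sigma>\<in>What M W \<rho>'. fst \<sigma> = fst \<alpha> \<longrightarrow> ghat M H' \<zeta> \<sigma> = - Upsilon M \<Gamma> \<rho> \<rho>' \<alpha> \<alpha> \<sigma>))"

definition LCB_parallel ::
  "('m, 'e::euclidean_space) chart set \<Rightarrow> ('m, 'e) christoffel \<Rightarrow> ('m, 'e) fvec set \<Rightarrow>
   ('m, 'e) fvec \<Rightarrow> (('m, 'e) fvec \<Rightarrow> ('m, 'e) fvec \<Rightarrow> real) \<Rightarrow>
   (('m, 'e) fvec \<Rightarrow> real) \<Rightarrow> (('m, 'e) fvec \<Rightarrow> ('m, 'e) fvec \<Rightarrow> real) \<Rightarrow>
   (('m, 'e) fvec \<Rightarrow> ('m, 'e) fvec) \<Rightarrow> bool" where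
  "LCB_parallel M \<Gamma> W \<alpha>0 \<rho> H' \<rho>' zp \<longleftrightarrow>
     (let P = projW M W \<rho>'; g = ghat M H'; zo = z_perp M \<Gamma> W \<rho> H' \<rho>' in
      \<exists>\<mu> x. smooth_fun (cotangent_atlas M) \<mu> \<and> (\<forall>\<alpha>\<in>cotangent_bundle M. \<mu> \<alpha> \<ge> 0) \<and>
        fiber_preserving M x \<and> x ` cotangent_bundle M \<subseteq> W \<and>
        extends_and_vanishes M (What M W \<rho>') \<alpha>0
          (\<lambda>\<alpha>. vsub (x \<alpha>)
             (vscale ((g (x \<alpha>) (P \<alpha>) + \<mu> \<alpha> - g (zo \<alpha>) \<alpha>) / g (P \<alpha>) (P \<alpha>)) (P \<alpha>))) zp)"

definition LCB_laws ::
  "('m, 'e::euclidean_space) chart set \<Rightarrow> ('m, 'e) christoffel \<Rightarrow>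
   (('m, 'e) fvec \<Rightarrow> real) \<times> (('m, 'e) fvec, 'e \<times> 'e) fvec set \<times> ('m, 'e) fvec \<Rightarrow>
   (('m, 'e) fvec \<Rightarrow> (('m, 'e) fvec, 'e \<times> 'e) fvec) set" where
  "LCB_laws M \<Gamma> = (\<lambda>(H, VW, \<alpha>0). {Y \<in> vector_fields (cotangent_atlas M).
     \<exists>k W \<rho> h H' \<rho>' h' zp.
       k \<ge> 1 \<and> linear_subbundle M k W \<and> VW = vertical_subbundle M W \<and>
       simple_with M H \<rho> h \<and>
       simple_with M H' \<rho>' h' \<and> positive_definite_wrt M H' \<alpha>0 \<and>
       LCB_equation M W H H' \<rho>' \<and>
       LCB_parallel M \<Gamma> W \<alpha>0 \<rho> H' \<rho>' zp \<and>
       Y = vertical_lift_field M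
         (\<lambda>\<alpha>. vsub (vsub (zp \<alpha>) (z_perp M \<Gamma> W \<rho> H' \<rho>' \<alpha>)) (matching_term M \<Gamma> H H' \<alpha>))})"

subsection \<open>The admissible triples\<close>

definition simple_underactuated_systems ::
  "('m, 'e::euclidean_space) chart set \<Rightarrow>
   ((('m, 'e) fvec \<Rightarrow> real) \<times> (('m, 'e) fvec, 'e \<times> 'e) fvec set \<times> ('m, 'e) fvec) set" where
  "simple_underactuated_systems M = {(H, VW, \<alpha>0).
     simple M H \<and>
     (\<exists>k W. k \<ge> 1 \<and> linear_subbundle M k W \<and> VW = vertical_subbundle M W) \<and>
     \<alpha>0 \<in> cotangent_bundle M \<and>
     hamiltonian_vector_field M H \<alpha>0 = vzero \<alpha>0}"

end

theory Submission
  imports Defs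
begin

text \<open>
  Write \<open>P\<close> for the orthogonal projection onto \<open>W\<close>. In coordinates the bracket of \<open>H'\<close> and \<open>H\<close>
  restricted to a fiber is \<open>Upsilon \<sigma> \<sigma> \<sigma>\<close> plus a linear form (here torsion-freeness enters), so
  homogeneity identifies the equations of the two methods. They imply \<open>Z \<alpha> \<alpha> \<alpha> = 0\<close> for every
  gyroscopic tensor \<open>Z\<close>, i.e. the gyroscopic force \<open>G\<close> does no work, and by construction
  \<open>G \<alpha> - P (G \<alpha>) = - z_perp \<alpha>\<close>. Hence the two laws agree for \<open>zp \<alpha> = zd \<alpha> + P (G \<alpha>)\<close>, and this
  correspondence exchanges the conditions on \<open>zd\<close> and \<open>zp\<close>, with the same \<open>\<mu>\<close>; from the LCB to
  the CH side one takes \<open>A = B = 0\<close>. That \<open>\<mu>\<close> vanishes on the complement of \<open>W\<close> and that the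
  limits at \<open>\<alpha>0\<close> agree follows by approaching along lines in the fiber in a direction of \<open>W\<close>;
  positive definiteness forces \<open>\<alpha>0\<close> to be a zero covector, where \<open>P (G \<alpha>0) = 0\<close>.
  Uniqueness of the base derivatives needs horizontal curves in every direction, which are
  solutions of a linear differential equation.
\<close>

section \<open>Calculus of smooth maps\<close>

lemma linear_basis_sum:
  assumes "linear L"
  shows "L p = (\<Sum>b\<in>Basis. (p \<bullet> b) *\<^sub>R L b)"
proof -
  have "L p = L (\<Sum>b\<in>Basis. (p \<bullet> b) *\<^sub>R b)" by (simp add: euclidean_representation)
  then show ?thesis by (simp add: linear_sum[OF assms] linear_cmul[OF assms])
qed

text \<open>The sum is the Riesz representative of \<open>L\<close> for the Euclidean inner product.
  Vectors known only through their products, such as \<open>grad\<close>, \<open>flat_coord\<close>,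
  \<open>bcov\<close> and \<open>rvec\<close>, are all written this way.\<close>

lemma linear_inner_representation:
  assumes "linear L"
  shows "(\<Sum>b\<in>Basis. L b *\<^sub>R b) \<bullet> v = L v"
  unfolding inner_sum_left
  by (subst (2) linear_basis_sum[OF assms]) (simp add: inner_commute[of v] mult.commute)

section \<open>Differentiability of finite order\<close>

lemma has_derivative_cong_open:
  assumes "open S" "x \<in> S" "\<And>y. y \<in> S \<Longrightarrow> f y = g y"
  shows "(f has_derivative D) (at x) \<longleftrightarrow> (g has_derivative D) (at x)"
  using assms has_derivative_transform_within_open by metis

lemma frechet_derivative_cong_open:
  assumes "open S" "x \<in> S" "\<And>y. y \<in> S \<Longrightarrow> f y = g y"
  shows "frechet_derivative f (at x) = frechet_derivative g (at x)"
  unfolding frechet_derivative_def using has_derivative_cong_open[OF assms] by simp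

text \<open>Derivatives at a point of an open set see only the values on that set, so the induction
  can pass from \<open>f\<close> and \<open>g\<close> to their derivatives. Coordinate expressions
  agree only on chart domains, hence the need.\<close>

lemma Ck_on_cong:
  assumes "open S" "\<And>x. x \<in> S \<Longrightarrow> f x = g x"
  shows "Ck_on k f S \<longleftrightarrow> Ck_on k g S"
  using assms(2)
proof (induction k arbitrary: f g)
  case 0
  then show ?case using continuous_on_cong by (metis Ck_on.simps(1))
next
  case (Suc k)
  have "f differentiable (at x) \<longleftrightarrow> g differentiable (at x)" if "x \<in> S" for x
    unfolding differentiable_def using has_derivative_cong_open[OF assms(1) that Suc.prems] by simp
  moreover have "Ck_on k (\<lambda>x. frechet_derivative f (at x) v) S \<longleftrightarrow>
      Ck_on k (\<lambda>x. frechet_derivative g (at x) v) S" for v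
    by (rule Suc.IH) (simp add: frechet_derivative_cong_open[OF assms(1) _ Suc.prems])
  ultimately show ?case by auto
qed

text \<open>Uniqueness of the derivative lets an explicit formula stand in for
  \<open>frechet_derivative\<close>. The product, chain and quotient rules enter the inductions
  below in this way.\<close>

lemma Ck_on_SucI:
  assumes "open S" "\<And>x. x \<in> S \<Longrightarrow> (f has_derivative f' x) (at x)"
    and "\<And>v. Ck_on k (\<lambda>x. f' x v) S"
  shows "Ck_on (Suc k) f S"
proof -
  have "frechet_derivative f (at x) = f' x" if "x \<in> S" for x
    using assms(2)[OF that] frechet_derivative_at by metis
  then have "Ck_on k (\<lambda>x. frechet_derivative f (at x) v) S" for v
    by (subst Ck_on_cong[OF assms(1), where g = "\<lambda>x. f' x v"]) (simp_all add: assms(3))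
  then show ?thesis
    using assms(2) by (auto simp: differentiable_def)
qed

lemma Ck_on_SucD:
  assumes "Ck_on (Suc k) f S"
  shows "x \<in> S \<Longrightarrow> (f has_derivative frechet_derivative f (at x)) (at x)"
    and "Ck_on k (\<lambda>x. frechet_derivative f (at x) v) S"
  using assms by (auto simp: frechet_derivative_works)

lemma Ck_on_Suc: "Ck_on (Suc k) f S \<Longrightarrow> Ck_on k f S"
proof (induction k arbitrary: f)
  case 0
  then show ?case
    by (auto intro!: continuous_at_imp_continuous_on differentiable_imp_continuous_within)
next
  case (Suc k)
  then show ?case by (metis Ck_on.simps(2))
qed

lemma Ck_on_subset: "Ck_on k f S \<Longrightarrow> T \<subseteq> S \<Longrightarrow> Ck_on k f T"
  by (induction k arbitrary: f) (auto intro: continuous_on_subset)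

text \<open>Frames of subbundles and extensions of tensors exist only locally; smoothness of what is
  built from them is assembled with this.\<close>

lemma Ck_on_locally:
  "(\<And>x. x \<in> S \<Longrightarrow> \<exists>V. open V \<and> x \<in> V \<and> Ck_on k f V) \<Longrightarrow> Ck_on k f S"
proof (induction k arbitrary: f)
  case 0
  show ?case
    unfolding Ck_on.simps
  proof (rule continuous_at_imp_continuous_on, rule ballI)
    fix x assume "x \<in> S"
    then obtain V where "open V" "x \<in> V" "continuous_on V f"
      using 0 by (metis Ck_on.simps(1))
    then show "isCont f x" by (simp add: continuous_on_eq_continuous_at)
  qed
next
  case (Suc k)
  have "Ck_on k (\<lambda>x. frechet_derivative f (at x) v) S" for v
  proof (rule Suc.IH)
    fix x assume "x \<in> S"
    then obtain V where V: "open V" "x \<in> V" "Ck_on (Suc k) f V" using Suc.prems by blast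
    show "\<exists>V. open V \<and> x \<in> V \<and> Ck_on k (\<lambda>x. frechet_derivative f (at x) v) V"
      by (rule exI[of _ V]) (use V in auto)
  qed
  moreover have "f differentiable (at x)" if x: "x \<in> S" for x
  proof -
    obtain V where V: "open V" "x \<in> V" "Ck_on (Suc k) f V" using Suc.prems x by blast
    then show ?thesis by simp
  qed
  ultimately show ?case by simp
qed

lemma Ck_on_const: "Ck_on k (\<lambda>x. a) S"
  by (induction k arbitrary: a) (auto simp: frechet_derivative_const)

lemma Ck_on_linear:
  assumes "open S" "bounded_linear L" "Ck_on k f S"
  shows "Ck_on k (\<lambda>x. L (f x)) S"
  using assms(3)
proof (induction k arbitrary: f)
  case 0
  then show ?case
    using bounded_linear.continuous_on[OF assms(2)] by auto
next
  case (Suc k)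
  note D = Ck_on_SucD[OF Suc.prems]
  show ?case
    by (rule Ck_on_SucI[OF assms(1), where f' = "\<lambda>x v. L (frechet_derivative f (at x) v)"])
      (auto intro!: bounded_linear.has_derivative[OF assms(2)] D Suc.IH)
qed

lemma Ck_on_id: "open S \<Longrightarrow> Ck_on k (\<lambda>x. x) S"
  by (cases k) (auto simp: frechet_derivative_ident intro: Ck_on_const)

lemma Ck_on_add:
  assumes "open S" "Ck_on k f S" "Ck_on k g S"
  shows "Ck_on k (\<lambda>x. f x + g x) S"
  using assms(2,3)
proof (induction k arbitrary: f g)
  case 0
  then show ?case by (auto intro: continuous_intros)
next
  case (Suc k)
  note D = Ck_on_SucD[OF Suc.prems(1)] Ck_on_SucD[OF Suc.prems(2)]
  show ?case
    by (rule Ck_on_SucI[OF assms(1), where f' = "\<lambda>x v. frechet_derivative f (at x) v + frechet_derivative g (at x) v"])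
      (auto intro!: has_derivative_add D Suc.IH)
qed

lemma Ck_on_bilinear:
  assumes "open S" "bounded_bilinear B" "Ck_on k f S" "Ck_on k g S"
  shows "Ck_on k (\<lambda>x. B (f x) (g x)) S"
  using assms(3,4)
proof (induction k arbitrary: f g)
  case 0
  then show ?case using bounded_bilinear.continuous_on[OF assms(2)] by auto
next
  case (Suc k)
  note D = Ck_on_SucD[OF Suc.prems(1)] Ck_on_SucD[OF Suc.prems(2)]
  note C = Suc.prems[THEN Ck_on_Suc]
  show ?case
    by (rule Ck_on_SucI[OF assms(1), where f' = "\<lambda>x v. B (f x) (frechet_derivative g (at x) v) + B (frechet_derivative f (at x) v) (g x)"])
      (auto intro!: bounded_bilinear.FDERIV[OF assms(2)] Ck_on_add[OF assms(1)] D C Suc.IH)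
qed

text \<open>The derivative contains \<open>inverse (f x)\<close> itself and one derivative of
  \<open>f\<close>, so the induction hypothesis covers all its factors.\<close>

lemma Ck_on_inverse:
  fixes f :: "'a::euclidean_space \<Rightarrow> real"
  assumes "open S" "Ck_on k f S" "\<And>x. x \<in> S \<Longrightarrow> f x \<noteq> 0"
  shows "Ck_on k (\<lambda>x. inverse (f x)) S"
  using assms(2)
proof (induction k)
  case 0
  then show ?case using assms(3) by (auto intro!: continuous_intros)
next
  case (Suc k)
  note D = Ck_on_SucD[OF Suc.prems]
  have m: "Ck_on k (\<lambda>x. p x * q x) S" if "Ck_on k p S" "Ck_on k q S" for p q :: "'a \<Rightarrow> real"
    using Ck_on_bilinear[OF assms(1) bounded_bilinear_mult that] .
  have IH: "Ck_on k (\<lambda>x. inverse (f x)) S" using Suc.IH Ck_on_Suc[OF Suc.prems] by blast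
  show ?case
  proof (rule Ck_on_SucI[OF assms(1), where f' = "\<lambda>x v. - (inverse (f x) * frechet_derivative f (at x) v * inverse (f x))"])
    show "((\<lambda>x. inverse (f x)) has_derivative
        (\<lambda>v. - (inverse (f x) * frechet_derivative f (at x) v * inverse (f x)))) (at x)"
      if "x \<in> S" for x
      by (rule Deriv.has_derivative_inverse) (use that assms(3) D in auto)
    show "Ck_on k (\<lambda>x. - (inverse (f x) * frechet_derivative f (at x) v * inverse (f x))) S" for v
      by (rule Ck_on_linear[OF assms(1)]) (auto intro!: m IH D bounded_linear_minus bounded_linear_ident)
  qed
qed

lemma Ck_on_sum:
  assumes "open S" "finite I" "\<And>i. i \<in> I \<Longrightarrow> Ck_on k (f i) S"
  shows "Ck_on k (\<lambda>x. \<Sum>i\<in>I. f i x) S"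
  using assms(2,3)
proof (induction I rule: finite_induct)
  case empty
  show ?case by (simp add: Ck_on_const)
next
  case (insert i I)
  have "Ck_on k (\<lambda>x. f i x + (\<Sum>i\<in>I. f i x)) S"
    by (rule Ck_on_add[OF assms(1)]) (use insert in auto)
  then show ?case using insert.hyps by simp
qed

text \<open>In the chain rule the derivative of \<open>g\<close> is taken in a direction that moves
  with \<open>x\<close>, whereas \<open>Ck_on\<close> speaks of fixed directions. Expanding that
  direction in \<open>Basis\<close> leaves products of functions, and the induction hypothesis is
  applied to the derivatives of \<open>g\<close>, which is why \<open>g\<close> is kept
  general.\<close>

lemma Ck_on_compose:
  assumes "open S" "open T" "Ck_on k f S" "Ck_on k g T" "\<And>x. x \<in> S \<Longrightarrow> f x \<in> T"
  shows "Ck_on k (\<lambda>x. g (f x)) S"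
  using assms(3,4)
proof (induction k arbitrary: g)
  case 0
  then have "continuous_on T g" "continuous_on S f" by simp_all
  then show ?case using continuous_on_compose2[of T g S f] assms(5) by auto
next
  case (Suc k)
  note Df = Ck_on_SucD[OF Suc.prems(1)] and Dg = Ck_on_SucD[OF Suc.prems(2)]
  let ?f' = "\<lambda>x. frechet_derivative f (at x)" and ?g' = "\<lambda>x. frechet_derivative g (at x)"
  show ?case
  proof (rule Ck_on_SucI[OF assms(1), where f' = "\<lambda>x v. \<Sum>b\<in>Basis. (?f' x v \<bullet> b) *\<^sub>R ?g' (f x) b"])
    fix x assume x: "x \<in> S"
    have "((\<lambda>x. g (f x)) has_derivative (\<lambda>v. ?g' (f x) (?f' x v))) (at x)"
      using has_derivative_compose[OF Df(1)[OF x] Dg(1)[OF assms(5)[OF x]]] .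
    moreover have "?g' (f x) (?f' x v) = (\<Sum>b\<in>Basis. (?f' x v \<bullet> b) *\<^sub>R ?g' (f x) b)" for v
      by (rule linear_basis_sum[OF has_derivative_linear[OF Dg(1)[OF assms(5)[OF x]]]])
    ultimately show "((\<lambda>x. g (f x)) has_derivative (\<lambda>v. \<Sum>b\<in>Basis. (?f' x v \<bullet> b) *\<^sub>R ?g' (f x) b)) (at x)"
      by simp
  next
    fix v
    show "Ck_on k (\<lambda>x. \<Sum>b\<in>Basis. (?f' x v \<bullet> b) *\<^sub>R ?g' (f x) b) S"
      by (intro Ck_on_sum[OF assms(1) finite_Basis] Ck_on_bilinear[OF assms(1) bounded_bilinear_scaleR]
          Ck_on_linear[OF assms(1) bounded_linear_inner_left] Df Suc.IH Dg Ck_on_Suc[OF Suc.prems(1)])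
  qed
qed

section \<open>Closure properties of smooth maps\<close>

lemma smooth_on_cong:
  assumes "open S" "\<And>x. x \<in> S \<Longrightarrow> f x = g x"
  shows "smooth_on S f \<longleftrightarrow> smooth_on S g"
  using Ck_on_cong[OF assms] by (simp add: smooth_on_def)

lemma smooth_on_subset: "smooth_on S f \<Longrightarrow> T \<subseteq> S \<Longrightarrow> smooth_on T f"
  by (auto simp: smooth_on_def intro: Ck_on_subset)

lemma smooth_on_locally:
  "(\<And>x. x \<in> S \<Longrightarrow> \<exists>V. open V \<and> x \<in> V \<and> smooth_on V f) \<Longrightarrow> smooth_on S f"
  unfolding smooth_on_def by (meson Ck_on_locally)

lemma smooth_on_const: "smooth_on S (\<lambda>x. a)"
  by (simp add: smooth_on_def Ck_on_const)

lemma smooth_on_id: "open S \<Longrightarrow> smooth_on S (\<lambda>x. x)"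
  by (simp add: smooth_on_def Ck_on_id)

lemma smooth_on_linear:
  "open S \<Longrightarrow> bounded_linear L \<Longrightarrow> smooth_on S f \<Longrightarrow> smooth_on S (\<lambda>x. L (f x))"
  by (simp add: smooth_on_def Ck_on_linear)

lemma smooth_on_bilinear:
  "open S \<Longrightarrow> bounded_bilinear B \<Longrightarrow> smooth_on S f \<Longrightarrow> smooth_on S g \<Longrightarrow> smooth_on S (\<lambda>x. B (f x) (g x))"
  by (simp add: smooth_on_def Ck_on_bilinear)

lemma smooth_on_add:
  "open S \<Longrightarrow> smooth_on S f \<Longrightarrow> smooth_on S g \<Longrightarrow> smooth_on S (\<lambda>x. f x + g x)"
  by (simp add: smooth_on_def Ck_on_add)

lemma smooth_on_minus: "open S \<Longrightarrow> smooth_on S f \<Longrightarrow> smooth_on S (\<lambda>x. - f x)"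
  using smooth_on_linear[OF _ bounded_linear_minus[OF bounded_linear_ident]] by blast

lemma smooth_on_diff:
  "open S \<Longrightarrow> smooth_on S f \<Longrightarrow> smooth_on S g \<Longrightarrow> smooth_on S (\<lambda>x. f x - g x)"
  using smooth_on_add[of S f "\<lambda>x. - g x"] smooth_on_minus[of S g] by simp

lemma smooth_on_sum:
  "open S \<Longrightarrow> finite I \<Longrightarrow> (\<And>i. i \<in> I \<Longrightarrow> smooth_on S (f i)) \<Longrightarrow> smooth_on S (\<lambda>x. \<Sum>i\<in>I. f i x)"
  by (simp add: smooth_on_def Ck_on_sum)

lemmas smooth_on_scaleR = smooth_on_bilinear[OF _ bounded_bilinear_scaleR]
lemmas smooth_on_mult = smooth_on_bilinear[OF _ bounded_bilinear_mult[where 'a = real]]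
lemmas smooth_on_inner = smooth_on_bilinear[OF _ bounded_bilinear_inner]

lemma smooth_on_divide:
  fixes f g :: "'a::euclidean_space \<Rightarrow> real"
  assumes "open S" "smooth_on S f" "smooth_on S g" "\<And>x. x \<in> S \<Longrightarrow> g x \<noteq> 0"
  shows "smooth_on S (\<lambda>x. f x / g x)"
proof -
  have "smooth_on S (\<lambda>x. inverse (g x))"
    using assms by (auto simp: smooth_on_def intro: Ck_on_inverse)
  from smooth_on_mult[OF assms(1,2) this] show ?thesis by (simp add: field_simps)
qed

lemma smooth_on_compose:
  assumes "open S" "open T" "smooth_on S f" "smooth_on T g" "\<And>x. x \<in> S \<Longrightarrow> f x \<in> T"
  shows "smooth_on S (\<lambda>x. g (f x))"
  using assms by (auto simp: smooth_on_def intro: Ck_on_compose)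

lemma smooth_on_fst: "open S \<Longrightarrow> smooth_on S f \<Longrightarrow> smooth_on S (\<lambda>x. fst (f x))"
  by (rule smooth_on_linear[OF _ bounded_linear_fst])

lemma smooth_on_snd: "open S \<Longrightarrow> smooth_on S f \<Longrightarrow> smooth_on S (\<lambda>x. snd (f x))"
  by (rule smooth_on_linear[OF _ bounded_linear_snd])

lemma smooth_on_Pair:
  assumes "open S" "smooth_on S f" "smooth_on S g"
  shows "smooth_on S (\<lambda>x. (f x, g x))"
proof -
  have "bounded_linear (\<lambda>x. (x, 0))" "bounded_linear (\<lambda>x. (0, x))"
    by (auto intro: bounded_linear_Pair bounded_linear_ident bounded_linear_zero)
  then have "smooth_on S (\<lambda>x. (f x, 0))" "smooth_on S (\<lambda>x. (0, g x))"
    using assms by (auto intro: smooth_on_linear)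
  from smooth_on_add[OF assms(1) this] show ?thesis by simp
qed

lemma smooth_on_components:
  assumes "open S" "\<And>b. b \<in> Basis \<Longrightarrow> smooth_on S (\<lambda>x. f x \<bullet> b)"
  shows "smooth_on S f"
proof -
  have "smooth_on S (\<lambda>x. \<Sum>b\<in>Basis. (f x \<bullet> b) *\<^sub>R b)"
    by (intro smooth_on_sum smooth_on_scaleR smooth_on_const assms finite_Basis)
  then show ?thesis by (simp add: euclidean_representation)
qed

text \<open>A matrix with smooth columns is applied to a smooth vector. Used for one slot after the
  other it handles bilinear families such as metrics and Christoffel symbols.\<close>

lemma smooth_on_linear_family:
  assumes "open S" "\<And>x. x \<in> S \<Longrightarrow> linear (L x)" "\<And>b. b \<in> Basis \<Longrightarrow> smooth_on S (\<lambda>x. L x b)"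
    and "smooth_on S f"
  shows "smooth_on S (\<lambda>x. L x (f x))"
proof -
  have "L x (f x) = (\<Sum>b\<in>Basis. (f x \<bullet> b) *\<^sub>R L x b)" if "x \<in> S" for x
    by (rule linear_basis_sum[OF assms(2)[OF that]])
  moreover have "smooth_on S (\<lambda>x. \<Sum>b\<in>Basis. (f x \<bullet> b) *\<^sub>R L x b)"
    by (intro smooth_on_sum smooth_on_scaleR smooth_on_inner smooth_on_const assms finite_Basis)
  ultimately show ?thesis
    by (subst smooth_on_cong[OF assms(1), where g = "\<lambda>x. \<Sum>b\<in>Basis. (f x \<bullet> b) *\<^sub>R L x b"]) simp_all
qed

lemma smooth_on_frechet:
  "smooth_on S f \<Longrightarrow> smooth_on S (\<lambda>x. frechet_derivative f (at x) v)"
  unfolding smooth_on_def by (metis Ck_on.simps(2))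

lemma smooth_on_has_derivative:
  assumes "smooth_on S f" "x \<in> S"
  shows "(f has_derivative frechet_derivative f (at x)) (at x)"
  using assms Ck_on_SucD(1) by (metis smooth_on_def)

lemma smooth_on_continuous: "smooth_on S f \<Longrightarrow> continuous_on S f"
  unfolding smooth_on_def by (metis Ck_on.simps(1))

lemma smooth_on_open_vimage:
  assumes "smooth_on S f" "open S" "open T"
  shows "open {x \<in> S. f x \<in> T}"
  using continuous_open_preimage[OF smooth_on_continuous[OF assms(1)] assms(2,3)]
  by (simp add: vimage_def Int_def)

section \<open>Smooth orthogonal frames and linear differential equations\<close>

definition inner_form :: "('e::euclidean_space \<Rightarrow> 'e \<Rightarrow> real) \<Rightarrow> bool" where
  "inner_form B \<longleftrightarrow> (\<forall>v. linear (B v)) \<and> (\<forall>v w. B v w = B w v) \<and> (\<forall>v. v \<noteq> 0 \<longrightarrow> B v v > 0)"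

lemma inner_formD:
  assumes "inner_form B"
  shows "linear (B v)" "linear (\<lambda>w. B w v)" "B v w = B w v" "v \<noteq> 0 \<Longrightarrow> B v v > 0"
proof -
  show s: "B v w = B w v" for v w using assms unfolding inner_form_def by auto
  show l: "linear (B v)" using assms unfolding inner_form_def by auto
  show "linear (\<lambda>w. B w v)" using l by (simp add: s[of _ v])
qed (use assms in \<open>auto simp: inner_form_def\<close>)

definition form_proj :: "('e::euclidean_space \<Rightarrow> 'e \<Rightarrow> real) \<Rightarrow> nat \<Rightarrow> (nat \<Rightarrow> 'e) \<Rightarrow> 'e \<Rightarrow> 'e" where
  "form_proj B k u p = (\<Sum>i<k. (B p (u i) / B (u i) (u i)) *\<^sub>R u i)"

text \<open>Orthogonal but not normalised: since \<open>form_proj\<close> divides by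
  \<open>B (u i) (u i)\<close>, no square root has to be shown smooth.\<close>

definition form_orthogonal :: "('e::euclidean_space \<Rightarrow> 'e \<Rightarrow> real) \<Rightarrow> nat \<Rightarrow> (nat \<Rightarrow> 'e) \<Rightarrow> bool" where
  "form_orthogonal B k u \<longleftrightarrow>
     (\<forall>i<k. u i \<noteq> 0) \<and> (\<forall>i<k. \<forall>j<k. i \<noteq> j \<longrightarrow> B (u i) (u j) = 0)"

lemma form_proj_in_span: "form_proj B k u p \<in> span (u ` {..<k})"
  unfolding form_proj_def by (intro span_sum span_scale span_base) auto

lemma form_orthogonal_sum:
  assumes "inner_form B" "form_orthogonal B k u" "j < k"
  shows "B (\<Sum>i<k. a i *\<^sub>R u i) (u j) = a j * B (u j) (u j)"
proof -
  have "B (\<Sum>i<k. a i *\<^sub>R u i) (u j) = (\<Sum>i<k. a i * B (u i) (u j))"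
    by (simp add: linear_sum[OF inner_formD(2)[OF assms(1)]] linear_cmul[OF inner_formD(2)[OF assms(1)]])
  also have "\<dots> = (\<Sum>i<k. if i = j then a j * B (u j) (u j) else 0)"
    using assms(2,3) by (intro sum.cong) (auto simp: form_orthogonal_def)
  finally show ?thesis using assms(3) by simp
qed

lemma form_proj_orthogonal:
  assumes "inner_form B" "form_orthogonal B k u" "w \<in> span (u ` {..<k})"
  shows "B (p - form_proj B k u p) w = 0"
  using assms(3)
proof (induction rule: span_induct)
  case base
  show ?case
    using inner_formD(1)[OF assms(1)]
    by (auto simp: subspace_def linear_add linear_cmul linear_0)
next
  case (step w)
  then obtain j where j: "j < k" "w = u j" by auto
  have "B (u j) (u j) \<noteq> 0"
    using assms(1,2) j(1) inner_formD(4)[OF assms(1)] by (force simp: form_orthogonal_def)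
  then show ?case
    using form_orthogonal_sum[OF assms(1,2) j(1)]  \<open>B (u j) (u j) \<noteq> 0\<close>
    by (simp add: linear_diff[OF inner_formD(2)[OF assms(1)]] form_proj_def j)
qed

text \<open>
  Orthogonal frames express both the sharp map of a metric and the orthogonal projection onto a
  subbundle by quotients of smooth functions, so that no inverse matrix has to be differentiated.
\<close>

lemma smooth_gram_schmidt:
  fixes b :: "nat \<Rightarrow> 'a::euclidean_space \<Rightarrow> 'e::euclidean_space"
  assumes V: "open V"
    and B: "\<And>x. x \<in> V \<Longrightarrow> inner_form (B x)"
    and sB: "\<And>v w. v \<in> Basis \<Longrightarrow> w \<in> Basis \<Longrightarrow> smooth_on V (\<lambda>x. B x v w)"
    and b: "\<And>i. i < k \<Longrightarrow> smooth_on V (b i)"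
    and ind: "\<And>x. x \<in> V \<Longrightarrow> inj_on (\<lambda>i. b i x) {..<k} \<and> independent ((\<lambda>i. b i x) ` {..<k})"
  shows "\<exists>u. (\<forall>i<k. smooth_on V (u i)) \<and>
    (\<forall>x\<in>V. form_orthogonal (B x) k (\<lambda>i. u i x) \<and> span ((\<lambda>i. u i x) ` {..<k}) = span ((\<lambda>i. b i x) ` {..<k}))"
  using b ind
proof (induction k)
  case 0
  show ?case by (auto simp: form_orthogonal_def)
next
  case (Suc k)
  have pre: "\<And>i. i < k \<Longrightarrow> smooth_on V (b i)"
    "\<And>x. x \<in> V \<Longrightarrow> inj_on (\<lambda>i. b i x) {..<k} \<and> independent ((\<lambda>i. b i x) ` {..<k})"
    using Suc.prems by (auto simp: lessThan_Suc independent_insert split: if_splits)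
  obtain u where u: "\<And>i. i < k \<Longrightarrow> smooth_on V (u i)"
    "\<And>x. x \<in> V \<Longrightarrow> form_orthogonal (B x) k (\<lambda>i. u i x)"
    "\<And>x. x \<in> V \<Longrightarrow> span ((\<lambda>i. u i x) ` {..<k}) = span ((\<lambda>i. b i x) ` {..<k})"
    using Suc.IH[OF pre] by blast
  define r where "r x = b k x - form_proj (B x) k (\<lambda>i. u i x) (b k x)" for x
  define u' where "u' = u(k := r)"
  have sBf: "smooth_on V (\<lambda>x. B x (f x) (g x))" if "smooth_on V f" "smooth_on V g" for f g
  proof (rule smooth_on_linear_family[where L = "\<lambda>x. B x (f x)", OF V _ _ that(2)])
    show "smooth_on V (\<lambda>x. B x (f x) c)" if "c \<in> Basis" for c
      by (rule smooth_on_linear_family[where L = "\<lambda>x v. B x v c", OF V _ _ \<open>smooth_on V f\<close>])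
        (simp_all add: inner_formD(2)[OF B] sB that)
  qed (simp add: inner_formD(1)[OF B])
  have pos: "B x (u i x) (u i x) \<noteq> 0" if "x \<in> V" "i < k" for x i
    using inner_formD(4)[OF B[OF that(1)]] u(2)[OF that(1)] that(2) by (force simp: form_orthogonal_def)
  have "smooth_on V r"
    unfolding r_def form_proj_def
    by (intro smooth_on_diff smooth_on_sum smooth_on_scaleR smooth_on_divide sBf V u Suc.prems(1) pos) simp_all
  then have "\<forall>i<Suc k. smooth_on V (u' i)"
    using u(1) by (auto simp: u'_def less_Suc_eq)
  moreover have "form_orthogonal (B x) (Suc k) (\<lambda>i. u' i x) \<and>
      span ((\<lambda>i. u' i x) ` {..<Suc k}) = span ((\<lambda>i. b i x) ` {..<Suc k})" if x: "x \<in> V" for x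
  proof -
    have nm: "b k x \<notin> (\<lambda>i. b i x) ` {..<k}"
      using Suc.prems(2)[OF x] by (auto simp: lessThan_Suc)
    have ns: "b k x \<notin> span ((\<lambda>i. b i x) ` {..<k})"
      using Suc.prems(2)[OF x] nm by (auto simp: lessThan_Suc independent_insert split: if_splits)
    have f: "form_proj (B x) k (\<lambda>i. u i x) (b k x) \<in> span ((\<lambda>i. u i x) ` {..<k})"
      using form_proj_in_span[of "B x" k "\<lambda>i. u i x"] by blast
    \<comment> \<open>A vanishing residual would make \<open>b k x\<close> equal to its projection,
      which lies in the span of the earlier vectors.\<close>
    have r0: "r x \<noteq> 0" using ns f u(3)[OF x] unfolding r_def by force
    have o: "B x (r x) (u i x) = 0" if "i < k" for i
      unfolding r_def by (rule form_proj_orthogonal[OF B[OF x] u(2)[OF x]]) (use that in \<open>auto intro: span_base\<close>)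
    have o': "B x (u i x) (r x) = 0" if "i < k" for i
      using o[OF that] inner_formD(3)[OF B[OF x]] by metis
    have im: "(\<lambda>i. u' i x) ` {..<Suc k} = insert (r x) ((\<lambda>i. u i x) ` {..<k})"
      by (auto simp: u'_def lessThan_Suc)
    have "form_orthogonal (B x) (Suc k) (\<lambda>i. u' i x)"
      using r0 o o' u(2)[OF x] by (auto simp: form_orthogonal_def u'_def less_Suc_eq)
    \<comment> \<open>The residual and \<open>b k x\<close> differ by an element of the span of the
      \<open>u i x\<close>, so exchanging them leaves the enlarged span unchanged.\<close>
    moreover have "span (insert (r x) ((\<lambda>i. u i x) ` {..<k})) = span (insert (b k x) ((\<lambda>i. u i x) ` {..<k}))"
      by (rule eq_span_insert_eq) (use f in \<open>simp add: r_def span_neg\<close>)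
    moreover have "\<dots> = span (insert (b k x) ((\<lambda>i. b i x) ` {..<k}))"
      using u(3)[OF x] by (simp add: span_insert)
    ultimately show ?thesis unfolding im by (simp add: lessThan_Suc)
  qed
  ultimately show ?case by (intro exI[of _ u']) auto
qed

text \<open>Banach's fixed point theorem for the integral equation, in the space of bounded
  continuous functions on the whole line. The bound \<open>4 * \<epsilon> * K \<le> 1\<close> gives
  the operator the Lipschitz constant \<open>\<epsilon> * K \<le> 1/4\<close>, which is within the
  factor \<open>1/2\<close> used.\<close>

lemma picard_linear_ode:
  fixes A :: "real \<Rightarrow> 'e::euclidean_space \<Rightarrow> 'e"
  assumes e: "0 < \<epsilon>" and K: "0 \<le> K" "4 * \<epsilon> * K \<le> 1"
    and lin: "\<And>s. s \<in> {-\<epsilon>..\<epsilon>} \<Longrightarrow> linear (A s)"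
    and bound: "\<And>s p. s \<in> {-\<epsilon>..\<epsilon>} \<Longrightarrow> norm (A s p) \<le> K * norm p"
    and cont: "\<And>p. continuous_on {-\<epsilon>..\<epsilon>} p \<Longrightarrow> continuous_on {-\<epsilon>..\<epsilon>} (\<lambda>s. A s (p s))"
  shows "\<exists>p. p 0 = p0 \<and> (\<forall>s\<in>{-\<epsilon><..<\<epsilon>}. (p has_vector_derivative A s (p s)) (at s))"
proof -
  \<comment> \<open>The signed integral from \<open>0\<close> to \<open>s\<close>, written with a
    lower end below both points so that the sign of \<open>s\<close> need not be
    distinguished.\<close>
  define F where "F f s = p0 + integral {-\<epsilon>..s} (\<lambda>t. A t (f t)) - integral {-\<epsilon>..0} (\<lambda>t. A t (f t))"
    for f :: "real \<Rightarrow> 'e" and s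
  have cA: "continuous_on {-\<epsilon>..\<epsilon>} (\<lambda>t. A t (f t))" for f :: "real \<Rightarrow>\<^sub>C 'e"
    by (intro cont) auto
  have iA: "(\<lambda>t. A t (apply_bcontfun f t)) integrable_on {-\<epsilon>..s}" if "s \<in> {-\<epsilon>..\<epsilon>}" for f s
    by (rule integrable_continuous_real, rule continuous_on_subset[OF cA]) (use that in auto)
  \<comment> \<open>Only the values on the compact interval matter; \<open>clamp\<close> continues
    them by constants to a bounded continuous function on the line.\<close>
  have "\<exists>g :: real \<Rightarrow>\<^sub>C 'e. \<forall>s. g s = F f (clamp (-\<epsilon>) \<epsilon> s)" for f :: "real \<Rightarrow>\<^sub>C 'e"
  proof -
    have "continuous_on (cbox (-\<epsilon>) \<epsilon>) (F f)"
      unfolding F_def cbox_interval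
      by (intro continuous_intros indefinite_integral_continuous_1 iA) (use e in auto)
    from continuous_on_cbox_bcontfunE[OF this] show ?thesis by metis
  qed
  then obtain G :: "(real \<Rightarrow>\<^sub>C 'e) \<Rightarrow> (real \<Rightarrow>\<^sub>C 'e)"
    where G: "\<And>f s. G f s = F f (clamp (-\<epsilon>) \<epsilon> s)" by metis
  have "dist (G f) (G g) \<le> 1 / 2 * dist f g" for f g
  proof (rule dist_bound)
    fix s
    define c where "c = clamp (-\<epsilon>) \<epsilon> s"
    have c: "c \<in> {-\<epsilon>..\<epsilon>}"
      using clamp_in_interval[of "-\<epsilon>" \<epsilon> s] e by (simp add: c_def cbox_interval)
    define D where "D t = A t (f t) - A t (g t)" for t
    have D: "continuous_on {-\<epsilon>..\<epsilon>} D" unfolding D_def by (intro continuous_intros cA)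
    have Db: "norm (D t) \<le> K * dist f g" if "t \<in> {-\<epsilon>..\<epsilon>}" for t
    proof -
      have "norm (D t) \<le> K * norm (f t - g t)"
        unfolding D_def using linear_diff[OF lin[OF that]] bound[OF that] by metis
      also have "\<dots> \<le> K * dist f g"
        using dist_bounded[of f t g] K(1) by (intro mult_left_mono) (simp_all add: dist_norm)
      finally show ?thesis .
    qed
    have "G f s - G g s = (integral {-\<epsilon>..c} (\<lambda>t. A t (f t)) - integral {-\<epsilon>..c} (\<lambda>t. A t (g t))) -
        (integral {-\<epsilon>..0} (\<lambda>t. A t (f t)) - integral {-\<epsilon>..0} (\<lambda>t. A t (g t)))"
      by (simp add: G F_def c_def)
    also have "\<dots> = integral {-\<epsilon>..c} D - integral {-\<epsilon>..0} D"
      unfolding D_def using c e by (simp add: integral_diff[OF iA iA])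
    \<comment> \<open>After cancellation only the integral between \<open>0\<close> and
      \<open>c\<close> is left, whatever their order.\<close>
    also have "norm \<dots> = norm (integral {min c 0..max c 0} D)"
    proof -
      have "integral {-\<epsilon>..min c 0} D + integral {min c 0..max c 0} D = integral {-\<epsilon>..max c 0} D"
        by (rule Henstock_Kurzweil_Integration.integral_combine)
          (use c e in \<open>auto intro!: integrable_continuous_real continuous_on_subset[OF D]\<close>)
      then have "integral {min c 0..max c 0} D = integral {-\<epsilon>..max c 0} D - integral {-\<epsilon>..min c 0} D"
        by (simp add: algebra_simps)
      then show ?thesis
        by (cases "c \<le> 0") (simp_all add: max_def min_def norm_minus_commute)
    qed
    also have "\<dots> \<le> K * dist f g * (max c 0 - min c 0)"
    proof (rule integral_bound)
      have sub: "{min c 0..max c 0} \<subseteq> {-\<epsilon>..\<epsilon>}" using c e by auto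
      show "continuous_on {min c 0..max c 0} D" by (rule continuous_on_subset[OF D sub])
      show "norm (D t) \<le> K * dist f g" if "t \<in> {min c 0..max c 0}" for t
        using Db that sub by blast
    qed simp
    also have "\<dots> \<le> K * dist f g * \<epsilon>"
      using c K(1) by (intro mult_left_mono) (auto simp: max_def min_def)
    also have "\<dots> \<le> 1 / 2 * dist f g"
    proof -
      have "4 * (K * dist f g * \<epsilon>) \<le> dist f g"
        using mult_right_mono[OF K(2), of "dist f g"] by (simp add: mult_ac)
      then show ?thesis using zero_le_dist[of f g] by linarith
    qed
    finally show "dist (G f s) (G g s) \<le> 1 / 2 * dist f g" by (simp add: dist_norm)
  qed
  then obtain f where f: "G f = f"
    using banach_fix_type[of "1 / 2" G] by auto
  have fF: "f s = F f s" if "s \<in> {-\<epsilon>..\<epsilon>}" for s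
    using G[of f s] f that by (simp add: cbox_interval)
  have "f 0 = p0" using fF[of 0] e by (simp add: F_def)
  moreover have "(f has_vector_derivative A s (f s)) (at s)" if s: "s \<in> {-\<epsilon><..<\<epsilon>}" for s
  proof -
    have "((\<lambda>u. integral {-\<epsilon>..u} (\<lambda>t. A t (f t))) has_vector_derivative A s (f s)) (at s within {-\<epsilon>..\<epsilon>})"
      by (rule integral_has_vector_derivative[OF cA]) (use s in auto)
    then have "(F f has_vector_derivative A s (f s)) (at s within {-\<epsilon>..\<epsilon>})"
      unfolding F_def by (auto intro!: derivative_eq_intros)
    then have "(F f has_vector_derivative A s (f s)) (at s within {-\<epsilon><..<\<epsilon>})"
      by (rule has_vector_derivative_within_subset) auto
    then have "(f has_vector_derivative A s (f s)) (at s within {-\<epsilon><..<\<epsilon>})"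
      by (rule has_vector_derivative_transform[OF s, rotated]) (simp add: fF)
    then show ?thesis using s by (simp add: at_within_open[OF s])
  qed
  ultimately show ?thesis by blast
qed

text \<open>Linearity makes the length of the interval independent of the initial value
  \<open>p0\<close>. This uniformity later allows two covectors to be transported along the same
  curve over one common interval.\<close>

lemma linear_ode:
  fixes A :: "real \<Rightarrow> 'e::euclidean_space \<Rightarrow> 'e"
  assumes r: "0 < r" and lin: "\<And>s. s \<in> {-r..r} \<Longrightarrow> linear (A s)"
    and cont: "\<And>b. b \<in> Basis \<Longrightarrow> continuous_on {-r..r} (\<lambda>s. A s b)"
  shows "\<exists>\<epsilon>>0. \<epsilon> \<le> r \<and>
    (\<forall>p0. \<exists>p. p 0 = p0 \<and> (\<forall>s\<in>{-\<epsilon><..<\<epsilon>}. (p has_vector_derivative A s (p s)) (at s)))"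
proof -
  have rep: "A s p = (\<Sum>b\<in>Basis. (p \<bullet> b) *\<^sub>R A s b)" if "s \<in> {-r..r}" for s p
    by (rule linear_basis_sum[OF lin[OF that]])
  have "\<exists>k. \<forall>s\<in>{-r..r}. norm (A s b) \<le> k" if "b \<in> Basis" for b
    using compact_imp_bounded[OF compact_continuous_image[OF cont[OF that] compact_Icc]]
    by (auto simp: bounded_iff)
  then obtain k where k: "\<And>b s. b \<in> Basis \<Longrightarrow> s \<in> {-r..r} \<Longrightarrow> norm (A s b) \<le> k b" by metis
  define K where "K = (\<Sum>b\<in>Basis. \<bar>k b\<bar>)"
  have K0: "0 \<le> K" by (simp add: K_def sum_nonneg)
  have bound: "norm (A s p) \<le> K * norm p" if s: "s \<in> {-r..r}" for s p
  proof -
    have "norm (A s p) \<le> (\<Sum>b\<in>Basis. \<bar>p \<bullet> b\<bar> * norm (A s b))"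
      by (subst rep[OF s], rule order_trans[OF norm_sum]) simp
    also have "\<dots> \<le> (\<Sum>b\<in>Basis. norm p * \<bar>k b\<bar>)"
      by (intro sum_mono mult_mono Basis_le_norm order_trans[OF k[OF _ s] abs_ge_self]) simp_all
    finally show ?thesis by (simp add: K_def sum_distrib_left mult.commute)
  qed
  \<comment> \<open>With \<open>K + 1\<close> in place of \<open>K\<close> the case
    \<open>K = 0\<close> is covered, and \<open>4 * \<epsilon> * K \<le> K / (K + 1) \<le> 1\<close>
    still holds.\<close>
  define \<epsilon> where "\<epsilon> = min r (1 / (4 * (K + 1)))"
  have e: "0 < \<epsilon>" "\<epsilon> \<le> r" using r K0 by (auto simp: \<epsilon>_def)
  have "4 * \<epsilon> * K \<le> 4 * (1 / (4 * (K + 1))) * K"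
    using K0 by (intro mult_right_mono mult_left_mono) (auto simp: \<epsilon>_def)
  also have "\<dots> \<le> 1" using K0 by (simp add: field_simps)
  finally have eK: "4 * \<epsilon> * K \<le> 1" .
  have c: "continuous_on {-\<epsilon>..\<epsilon>} (\<lambda>s. A s (p s))" if "continuous_on {-\<epsilon>..\<epsilon>} p" for p
  proof -
    have "continuous_on {-\<epsilon>..\<epsilon>} (\<lambda>s. A s b)" if "b \<in> Basis" for b
      using cont[OF that] by (rule continuous_on_subset) (use e in auto)
    then have "continuous_on {-\<epsilon>..\<epsilon>} (\<lambda>s. \<Sum>b\<in>Basis. (p s \<bullet> b) *\<^sub>R A s b)"
      using that by (intro continuous_intros)
    moreover have "(\<Sum>b\<in>Basis. (p s \<bullet> b) *\<^sub>R A s b) = A s (p s)" if "s \<in> {-\<epsilon>..\<epsilon>}" for s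
    proof -
      have "s \<in> {-r..r}" using that e by auto
      from rep[OF this, of "p s"] show ?thesis by (rule sym)
    qed
    ultimately show ?thesis
      by (subst continuous_on_cong[OF refl, where g = "\<lambda>s. \<Sum>b\<in>Basis. (p s \<bullet> b) *\<^sub>R A s b"]) simp_all
  qed
  have "\<exists>p. p 0 = p0 \<and> (\<forall>s\<in>{-\<epsilon><..<\<epsilon>}. (p has_vector_derivative A s (p s)) (at s))" for p0
    by (rule picard_linear_ode[OF e(1) K0 eK _ _ c]) (use e lin bound in auto)
  then show ?thesis using e by blast
qed

text \<open>Bootstrapping: if \<open>p\<close> is of class \<open>k\<close>, then so is
  \<open>A s (p s)\<close>, which is the derivative of \<open>p\<close>.\<close>

lemma linear_ode_smooth:
  fixes A :: "real \<Rightarrow> 'e::euclidean_space \<Rightarrow> 'e"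
  assumes "open S" "\<And>s. s \<in> S \<Longrightarrow> linear (A s)" "\<And>b. b \<in> Basis \<Longrightarrow> smooth_on S (\<lambda>s. A s b)"
    and p: "\<And>s. s \<in> S \<Longrightarrow> (p has_vector_derivative A s (p s)) (at s)"
  shows "smooth_on S p"
proof -
  have "Ck_on k p S" for k
  proof (induction k)
    case 0
    have "isCont p s" if "s \<in> S" for s
      using p[OF that] has_vector_derivative_continuous by blast
    then show ?case by (simp add: continuous_at_imp_continuous_on)
  next
    case (Suc k)
    have rep: "A s (p s) = (\<Sum>b\<in>Basis. (p s \<bullet> b) *\<^sub>R A s b)" if "s \<in> S" for s
      by (rule linear_basis_sum[OF assms(2)[OF that]])
    show ?case
    proof (rule Ck_on_SucI[OF assms(1), where f' = "\<lambda>s v. v *\<^sub>R (\<Sum>b\<in>Basis. (p s \<bullet> b) *\<^sub>R A s b)"])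
      show "(p has_derivative (\<lambda>v. v *\<^sub>R (\<Sum>b\<in>Basis. (p s \<bullet> b) *\<^sub>R A s b))) (at s)" if "s \<in> S" for s
        using p[OF that] rep[OF that] by (simp add: has_vector_derivative_def)
      have "Ck_on k (\<lambda>s. A s b) S" if "b \<in> Basis" for b
        using assms(3)[OF that] by (simp add: smooth_on_def)
      then show "Ck_on k (\<lambda>s. v *\<^sub>R (\<Sum>b\<in>Basis. (p s \<bullet> b) *\<^sub>R A s b)) S" for v
        by (intro Ck_on_linear[OF assms(1) bounded_linear_scaleR_right] Ck_on_sum[OF assms(1) finite_Basis]
            Ck_on_bilinear[OF assms(1) bounded_bilinear_scaleR]
            Ck_on_linear[OF assms(1) bounded_linear_inner_left] Suc.IH)
    qed
  qed
  then show ?thesis by (simp add: smooth_on_def)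
qed

section \<open>Charts of the tangent and cotangent bundle\<close>

lemma smooth_on_eq:
  "open S \<Longrightarrow> smooth_on S g \<Longrightarrow> (\<And>x. x \<in> S \<Longrightarrow> f x = g x) \<Longrightarrow> smooth_on S f"
  using smooth_on_cong by metis

abbreviation img :: "('m, 'e) chart \<Rightarrow> 'e set" where
  "img c \<equiv> snd c ` fst c"

locale atlas =
  fixes M :: "('m, 'e::euclidean_space) chart set"
  assumes atlas: "smooth_atlas M"
begin

section \<open>Jacobians, and fiber elements given by one component\<close>

definition jac :: "('m, 'e) chart \<Rightarrow> ('m, 'e) chart \<Rightarrow> 'm \<Rightarrow> 'e \<Rightarrow> 'e" where
  "jac c d q = frechet_derivative (transition c d) (at (snd c q))"

text \<open>One component in one chart around \<open>q\<close> determines all the others, so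
  \<open>tvec c q\<close> and \<open>cvec c q\<close> parametrise the fibers over \<open>q\<close>
  by the model space. All later computations take place in these parametrisations.\<close>

definition tvec :: "('m, 'e) chart \<Rightarrow> 'm \<Rightarrow> 'e \<Rightarrow> ('m, 'e) fvec" where
  "tvec c q v = (q, \<lambda>d. if d \<in> charts_at M q then jac c d q v else 0)"

text \<open>Covectors transform contragrediently: the component in \<open>d\<close> uses the
  transposed Jacobian from \<open>d\<close> back to \<open>c\<close>.\<close>

definition cvec :: "('m, 'e) chart \<Rightarrow> 'm \<Rightarrow> 'e \<Rightarrow> ('m, 'e) fvec" where
  "cvec c q p = (q, \<lambda>d. if d \<in> charts_at M q then adjoint (jac d c q) p else 0)"

abbreviation tvec_at :: "('m, 'e) chart \<Rightarrow> 'e \<Rightarrow> 'e \<Rightarrow> ('m, 'e) fvec" where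
  "tvec_at c x \<equiv> tvec c (chart_inv c x)"

abbreviation cvec_at :: "('m, 'e) chart \<Rightarrow> 'e \<Rightarrow> 'e \<Rightarrow> ('m, 'e) fvec" where
  "cvec_at c x \<equiv> cvec c (chart_inv c x)"

lemma charts_atD: "c \<in> charts_at M q \<Longrightarrow> c \<in> M" "c \<in> charts_at M q \<Longrightarrow> q \<in> fst c"
  by (auto simp: charts_at_def)

lemma charts_at_points: "c \<in> charts_at M q \<Longrightarrow> q \<in> points M"
  by (auto simp: charts_at_def points_def)

lemma chart_at: "q \<in> points M \<Longrightarrow> chart_at M q \<in> charts_at M q"
  unfolding chart_at_def by (rule someI_ex) (auto simp: charts_at_def points_def)

lemma chart_inv_chart: "c \<in> M \<Longrightarrow> q \<in> fst c \<Longrightarrow> chart_inv c (snd c q) = q"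
  using atlas by (auto simp: chart_inv_def smooth_atlas_def)

lemma chart_chart_inv: "x \<in> img c \<Longrightarrow> snd c (chart_inv c x) = x"
  by (simp add: chart_inv_def f_inv_into_f)

lemma chart_inv_in: "x \<in> img c \<Longrightarrow> chart_inv c x \<in> fst c"
  by (simp add: chart_inv_def inv_into_into)

lemma chart_inv_charts_at: "c \<in> M \<Longrightarrow> x \<in> img c \<Longrightarrow> c \<in> charts_at M (chart_inv c x)"
  by (simp add: charts_at_def chart_inv_in)

lemma open_img: "c \<in> M \<Longrightarrow> open (img c)"
  using atlas by (auto simp: smooth_atlas_def)

lemma open_overlap: "c \<in> M \<Longrightarrow> d \<in> M \<Longrightarrow> open (snd c ` (fst c \<inter> fst d))"
  using atlas by (auto simp: smooth_atlas_def)

lemma smooth_transition: "c \<in> M \<Longrightarrow> d \<in> M \<Longrightarrow> smooth_on (snd c ` (fst c \<inter> fst d)) (transition c d)"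
  using atlas by (auto simp: smooth_atlas_def)

lemma transition_apply: "c \<in> M \<Longrightarrow> q \<in> fst c \<Longrightarrow> transition c d (snd c q) = snd d q"
  by (simp add: transition_def chart_inv_chart)

lemma transition_overlap:
  "c \<in> M \<Longrightarrow> x \<in> snd c ` (fst c \<inter> fst d) \<Longrightarrow> transition c d x \<in> snd d ` (fst c \<inter> fst d)"
  by (auto simp: transition_apply)

lemma chart_inv_transition:
  "c \<in> M \<Longrightarrow> d \<in> M \<Longrightarrow> x \<in> snd c ` (fst c \<inter> fst d) \<Longrightarrow> chart_inv d (transition c d x) = chart_inv c x"
  by (auto simp: transition_apply chart_inv_chart)

lemma overlap_iff:
  "c \<in> M \<Longrightarrow> x \<in> snd c ` (fst c \<inter> fst d) \<longleftrightarrow> x \<in> img c \<and> chart_inv c x \<in> fst d"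
  by (auto simp: chart_inv_chart image_iff)

lemma overlap_charts:
  assumes "c \<in> M" "d \<in> M" "x \<in> snd c ` (fst c \<inter> fst d)"
  shows "c \<in> charts_at M (chart_inv c x)" "d \<in> charts_at M (chart_inv c x)"
  using assms overlap_iff[OF assms(1), of x d] chart_inv_in[of x c] by (simp_all add: charts_at_def)

lemma transition_has_derivative:
  assumes "c \<in> charts_at M q" "d \<in> charts_at M q"
  shows "(transition c d has_derivative jac c d q) (at (snd c q))"
  unfolding jac_def
  by (rule smooth_on_has_derivative[OF smooth_transition]) (use assms in \<open>auto simp: charts_at_def\<close>)

lemma jac_linear:
  assumes "c \<in> charts_at M q" "d \<in> charts_at M q"
  shows "linear (jac c d q)"
  using transition_has_derivative[OF assms] has_derivative_linear by blast

lemma jac_self: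
  assumes "c \<in> charts_at M q"
  shows "jac c c q v = v"
proof -
  have "frechet_derivative (transition c c) (at (snd c q)) = frechet_derivative (\<lambda>x. x) (at (snd c q))"
    by (rule frechet_derivative_cong_open[OF open_img])
      (use assms in \<open>auto simp: charts_at_def transition_apply\<close>)
  then show ?thesis by (simp add: jac_def frechet_derivative_ident)
qed

lemma jac_comp:
  assumes "c \<in> charts_at M q" "d \<in> charts_at M q" "e \<in> charts_at M q"
  shows "jac d e q (jac c d q v) = jac c e q v"
proof -
  have M: "c \<in> M" "d \<in> M" "e \<in> M" "q \<in> fst c" "q \<in> fst d" "q \<in> fst e"
    using assms by (auto simp: charts_at_def)
  \<comment> \<open>The composed transition agrees with the direct one only on the triple overlap,
    an open neighbourhood of \<open>snd c q\<close>.\<close>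
  let ?S = "snd c ` (fst c \<inter> fst d) \<inter> snd c ` (fst c \<inter> fst e)"
  have "((\<lambda>x. transition d e (transition c d x)) has_derivative (\<lambda>v. jac d e q (jac c d q v))) (at (snd c q))"
    by (rule has_derivative_compose[OF transition_has_derivative[OF assms(1,2)]])
      (use transition_has_derivative[OF assms(2,3)] M in \<open>simp add: transition_apply\<close>)
  then have "(transition c e has_derivative (\<lambda>v. jac d e q (jac c d q v))) (at (snd c q))"
  proof (rule has_derivative_transform_within_open)
    show "open ?S" using M by (intro open_Int open_overlap)
    show "snd c q \<in> ?S" using M by auto
    show "transition d e (transition c d x) = transition c e x" if x: "x \<in> ?S" for x
    proof -
      obtain y where y: "y \<in> fst c" "y \<in> fst d" "x = snd c y" using x by blast
      then have "y \<in> fst e"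
        using overlap_iff[OF M(1), of x e] x M by (simp add: chart_inv_chart)
      then show ?thesis using M y by (simp add: transition_apply)
    qed
  qed
  then show ?thesis
    using has_derivative_unique[OF _ transition_has_derivative[OF assms(1,3)]] by metis
qed

lemma jac_inverse:
  "c \<in> charts_at M q \<Longrightarrow> d \<in> charts_at M q \<Longrightarrow> jac d c q (jac c d q v) = v"
  by (simp add: jac_comp jac_self)

lemma smooth_jac:
  assumes "c \<in> M" "d \<in> M"
  shows "smooth_on (snd c ` (fst c \<inter> fst d)) (\<lambda>x. jac c d (chart_inv c x) v)"
proof -
  have "jac c d (chart_inv c x) v = frechet_derivative (transition c d) (at x) v"
    if "x \<in> snd c ` (fst c \<inter> fst d)" for x
    using that assms by (auto simp: jac_def chart_inv_chart)
  then show ?thesis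
    by (rule smooth_on_eq[OF open_overlap[OF assms] smooth_on_frechet[OF smooth_transition[OF assms]]])
qed

lemma fst_tvec [simp]: "fst (tvec c q v) = q" and fst_cvec [simp]: "fst (cvec c q p) = q"
  by (simp_all add: tvec_def cvec_def)

lemma snd_tvec: "d \<in> charts_at M q \<Longrightarrow> snd (tvec c q v) d = jac c d q v"
  by (simp add: tvec_def)

lemma snd_cvec_inner:
  "c \<in> charts_at M q \<Longrightarrow> d \<in> charts_at M q \<Longrightarrow> snd (cvec c q p) d \<bullet> e = p \<bullet> jac d c q e"
  using adjoint_works[OF jac_linear, of d q c e p] by (simp add: cvec_def inner_commute)

lemma snd_tvec_self [simp]: "c \<in> charts_at M q \<Longrightarrow> snd (tvec c q v) c = v"
  by (simp add: snd_tvec jac_self)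

lemma snd_cvec_self [simp]: "c \<in> charts_at M q \<Longrightarrow> snd (cvec c q p) c = p"
  by (rule vector_eq_rdot[THEN iffD1]) (simp add: snd_cvec_inner jac_self)

lemma tvec_in [simp]:
  assumes "c \<in> charts_at M q"
  shows "tvec c q v \<in> tangent_bundle M"
  using assms charts_at_points[OF assms]
  by (auto simp: tangent_bundle_def tvec_def jac_def[symmetric] jac_comp)

lemma cvec_in [simp]:
  assumes c: "c \<in> charts_at M q"
  shows "cvec c q p \<in> cotangent_bundle M"
proof -
  have 1: "snd (cvec c q p) d \<bullet> e = snd (cvec c q p) d' \<bullet> jac d d' q e"
    if "d \<in> charts_at M q" "d' \<in> charts_at M q" for d d' e
    using that c by (simp add: snd_cvec_inner jac_comp)
  have 2: "snd (cvec c q p) d = 0" if "d \<notin> charts_at M q" for d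
    using that by (simp add: cvec_def)
  show ?thesis
    unfolding cotangent_bundle_def mem_Collect_eq case_prod_beta fst_cvec
    by (intro conjI allI ballI impI charts_at_points[OF c] 2 1[unfolded jac_def])
qed

lemma tangent_points: "v \<in> tangent_bundle M \<Longrightarrow> fst v \<in> points M"
  and cotangent_points: "a \<in> cotangent_bundle M \<Longrightarrow> fst a \<in> points M"
  by (auto simp: tangent_bundle_def cotangent_bundle_def)

lemma tangentD:
  assumes "v \<in> tangent_bundle M" "c \<in> charts_at M (fst v)" "d \<in> charts_at M (fst v)"
  shows "snd v d = jac c d (fst v) (snd v c)"
  using assms unfolding tangent_bundle_def jac_def mem_Collect_eq case_prod_beta by blast

lemma cotangentD:
  assumes "a \<in> cotangent_bundle M" "c \<in> charts_at M (fst a)" "d \<in> charts_at M (fst a)"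
  shows "snd a c \<bullet> e = snd a d \<bullet> jac c d (fst a) e"
  using assms unfolding cotangent_bundle_def jac_def mem_Collect_eq case_prod_beta by blast

lemma tangent_outside: "v \<in> tangent_bundle M \<Longrightarrow> d \<notin> charts_at M (fst v) \<Longrightarrow> snd v d = 0"
  unfolding tangent_bundle_def mem_Collect_eq case_prod_beta by blast

lemma cotangent_outside: "v \<in> cotangent_bundle M \<Longrightarrow> d \<notin> charts_at M (fst v) \<Longrightarrow> snd v d = 0"
  unfolding cotangent_bundle_def mem_Collect_eq case_prod_beta by blast

lemma tvec_eq:
  assumes "v \<in> tangent_bundle M" "c \<in> charts_at M (fst v)"
  shows "tvec c (fst v) (snd v c) = v"
proof (rule prod_eqI)
  show "snd (tvec c (fst v) (snd v c)) = snd v"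
  proof
    fix d
    show "snd (tvec c (fst v) (snd v c)) d = snd v d"
      using tangentD[OF assms, of d] tangent_outside[OF assms(1), of d]
      by (cases "d \<in> charts_at M (fst v)") (simp_all add: tvec_def)
  qed
qed simp

lemma cvec_eq:
  assumes "a \<in> cotangent_bundle M" "c \<in> charts_at M (fst a)"
  shows "cvec c (fst a) (snd a c) = a"
proof -
  have "snd (cvec c (fst a) (snd a c)) d = snd a d" for d
  proof (cases "d \<in> charts_at M (fst a)")
    case True
    then show ?thesis
      by (intro vector_eq_rdot[THEN iffD1])
        (simp add: snd_cvec_inner[OF assms(2)] cotangentD[OF assms(1) _ assms(2)])
  next
    case False
    then show ?thesis using cotangent_outside[OF assms(1)] by (simp add: cvec_def)
  qed
  then show ?thesis by (simp add: prod_eq_iff fun_eq_iff)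
qed

lemma cotangent_eqI:
  assumes "a \<in> cotangent_bundle M" "b \<in> cotangent_bundle M" "fst a = fst b"
    and "c \<in> charts_at M (fst a)" "snd a c = snd b c"
  shows "a = b"
  using assms cvec_eq by metis

lemma cvec_eq_iff: "c \<in> charts_at M q \<Longrightarrow> cvec c q p = cvec c q r \<longleftrightarrow> p = r"
  using snd_cvec_self by metis

text \<open>The Jacobian on the vector and the transposed Jacobian on the covector cancel, so the
  arbitrary chart inside \<open>pairing\<close> may be exchanged for any chart around the base
  point.\<close>

lemma pairing_chart:
  assumes "a \<in> cotangent_bundle M" "v \<in> tangent_bundle M" "fst v = fst a" "c \<in> charts_at M (fst a)"
  shows "pairing M a v = snd a c \<bullet> snd v c"
proof -
  let ?d = "chart_at M (fst a)"
  have d: "?d \<in> charts_at M (fst a)" using chart_at cotangent_points assms(1) by blast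
  have "snd v ?d = jac c ?d (fst a) (snd v c)" using tangentD[OF assms(2), of c ?d] assms d by simp
  then show ?thesis unfolding pairing_def using cotangentD[OF assms(1,4) d] by simp
qed

lemma pairing_coords [simp]: "c \<in> charts_at M q \<Longrightarrow> pairing M (cvec c q p) (tvec c q v) = p \<bullet> v"
  by (subst pairing_chart[where c = c]) simp_all

lemma vadd_cvec: "c \<in> charts_at M q \<Longrightarrow> vadd (cvec c q p) (cvec c q r) = cvec c q (p + r)"
  and vscale_cvec: "c \<in> charts_at M q \<Longrightarrow> vscale s (cvec c q p) = cvec c q (s *\<^sub>R p)"
  and vzero_cvec: "c \<in> charts_at M q \<Longrightarrow> vzero q = cvec c q 0"
  by (auto simp: vadd_def vscale_def vzero_def cvec_def fun_eq_iff adjoint_linear jac_linear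
      linear_add linear_cmul linear_0)

lemma vsub_cvec: "c \<in> charts_at M q \<Longrightarrow> vsub (cvec c q p) (cvec c q r) = cvec c q (p - r)"
  by (simp add: vsub_def vadd_cvec vscale_cvec)

lemma vadd_tvec: "c \<in> charts_at M q \<Longrightarrow> vadd (tvec c q p) (tvec c q r) = tvec c q (p + r)"
  and vscale_tvec: "c \<in> charts_at M q \<Longrightarrow> vscale s (tvec c q p) = tvec c q (s *\<^sub>R p)"
  and vzero_tvec: "c \<in> charts_at M q \<Longrightarrow> vzero q = tvec c q 0"
  by (auto simp: vadd_def vscale_def vzero_def tvec_def fun_eq_iff jac_linear
      linear_add linear_cmul linear_0)

lemma tvec_eq_iff: "c \<in> charts_at M q \<Longrightarrow> tvec c q p = tvec c q r \<longleftrightarrow> p = r"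
  using snd_tvec_self by metis

lemma cotangent_cases:
  assumes "a \<in> cotangent_bundle M" "c \<in> charts_at M (fst a)"
  obtains p where "a = cvec c (fst a) p"
  using cvec_eq[OF assms] by metis

lemma tangent_cases:
  assumes "v \<in> tangent_bundle M" "c \<in> charts_at M (fst v)"
  obtains w where "v = tvec c (fst v) w"
  using tvec_eq[OF assms] by metis

lemma cvec_change:
  "c \<in> charts_at M q \<Longrightarrow> d \<in> charts_at M q \<Longrightarrow> cvec d q (adjoint (jac d c q) p) = cvec c q p"
  using cvec_eq[OF cvec_in, of c q d p] by (simp add: cvec_def[of c q p])

text \<open>The fiber part of a change of canonical coordinates. Tested against a basis vector, the
  transpose becomes an inner product with a column of \<open>jac d c\<close>; that column is smooth
  in the coordinates of \<open>d\<close>, so the point is first moved there by the transition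
  map.\<close>

lemma smooth_adjoint_jac:
  assumes "c \<in> M" "d \<in> M" "open S" "smooth_on S y" "smooth_on S p"
    and y: "\<And>x. x \<in> S \<Longrightarrow> y x \<in> snd c ` (fst c \<inter> fst d)"
  shows "smooth_on S (\<lambda>x. adjoint (jac d c (chart_inv c (y x))) (p x))"
proof (rule smooth_on_components[OF assms(3)])
  fix b :: 'e
  have ty: "transition c d (y x) \<in> snd d ` (fst d \<inter> fst c)" if "x \<in> S" for x
    using transition_overlap[OF assms(1) y[OF that]] by (simp add: Int_commute)
  have "smooth_on S (\<lambda>x. transition c d (y x))"
    by (rule smooth_on_compose[OF assms(3) open_overlap[OF assms(1,2)] assms(4) smooth_transition[OF assms(1,2)] y])
  then have "smooth_on S (\<lambda>x. jac d c (chart_inv d (transition c d (y x))) b)"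
    by (rule smooth_on_compose[OF assms(3) open_overlap[OF assms(2,1)] _ smooth_jac[OF assms(2,1)] ty])
  then have "smooth_on S (\<lambda>x. p x \<bullet> jac d c (chart_inv d (transition c d (y x))) b)"
    by (rule smooth_on_inner[OF assms(3,5)])
  moreover have "adjoint (jac d c (chart_inv c (y x))) (p x) \<bullet> b =
      p x \<bullet> jac d c (chart_inv d (transition c d (y x))) b" if "x \<in> S" for x
  proof -
    have "linear (jac d c (chart_inv c (y x)))"
      by (intro jac_linear overlap_charts[OF assms(1,2) y[OF that]])
    then show ?thesis
      using chart_inv_transition[OF assms(1,2) y[OF that]] adjoint_works[of "jac d c (chart_inv c (y x))" b "p x"]
      by (simp add: inner_commute)
  qed
  ultimately show "smooth_on S (\<lambda>x. adjoint (jac d c (chart_inv c (y x))) (p x) \<bullet> b)"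
    by (rule smooth_on_eq[OF assms(3)])
qed

end

section \<open>Smoothness and topology on the cotangent bundle\<close>

context atlas
begin

abbreviation CT where "CT \<equiv> cotangent_bundle M"

abbreviation coords where "coords c \<equiv> (img c) \<times> (UNIV :: _ set)"

lemma open_coords: "c \<in> M \<Longrightarrow> open ((img c) \<times> (UNIV :: 'a::euclidean_space set))"
  by (intro open_Times open_img open_UNIV)

lemma snd_cvec: "d \<in> charts_at M q \<Longrightarrow> snd (cvec c q p) d = adjoint (jac d c q) p"
  by (simp add: cvec_def)

lemma cvec_in_CT: "c \<in> M \<Longrightarrow> x \<in> img c \<Longrightarrow> cvec_at c x p \<in> CT"
  by (intro cvec_in chart_inv_charts_at)

lemma CT_chart_cases:
  assumes "a \<in> CT" "c \<in> M" "fst a \<in> fst c"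
  obtains x p where "x \<in> img c" "a = cvec_at c x p" "x = snd c (fst a)" "p = snd a c"
proof
  show "a = cvec c (chart_inv c (snd c (fst a))) (snd a c)"
    using assms cvec_eq[of a c] by (simp add: charts_at_def chart_inv_chart)
  show "snd c (fst a) \<in> img c" by (rule imageI[OF assms(3)])
qed (rule refl)+

lemma fst_bundle_chart: "fst (bundle_chart E c) = {a \<in> E. fst a \<in> fst c}"
  and snd_bundle_chart: "snd (bundle_chart E c) a = (snd c (fst a), snd a c)"
  by (simp_all add: bundle_chart_def)

lemma bundle_chart_image:
  assumes "c \<in> M"
  shows "snd (bundle_chart CT c) ` {a \<in> CT. fst a \<in> fst c \<and> Q a} =
    {y. fst y \<in> img c \<and> Q (cvec_at c (fst y) (snd y))}" (is "?A = ?B")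
proof
  show "?A \<subseteq> ?B"
  proof
    fix y assume "y \<in> ?A"
    then obtain a where a: "a \<in> CT" "fst a \<in> fst c" "Q a" "y = (snd c (fst a), snd a c)"
      by (auto simp: snd_bundle_chart)
    from CT_chart_cases[OF a(1) assms a(2)] show "y \<in> ?B" using a by (metis (mono_tags, lifting) fst_conv mem_Collect_eq snd_conv)
  qed
  show "?B \<subseteq> ?A"
  proof
    fix y assume y: "y \<in> ?B"
    then have c: "c \<in> charts_at M (chart_inv c (fst y))"
      using assms chart_inv_charts_at by blast
    let ?a = "cvec_at c (fst y) (snd y)"
    have "?a \<in> {a \<in> CT. fst a \<in> fst c \<and> Q a}" using y c by (simp add: chart_inv_in)
    moreover have "y = snd (bundle_chart CT c) ?a"
      using y c by (simp add: snd_bundle_chart chart_chart_inv)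
    ultimately show "y \<in> ?A" by blast
  qed
qed

text \<open>Identifies \<open>cvec_at\<close> with the inverse of the canonical chart. Injectivity
  holds because \<open>c\<close> separates base points and a single component determines a
  covector.\<close>

lemma bundle_chart_inv:
  assumes "c \<in> M" "x \<in> img c"
  shows "chart_inv (bundle_chart CT c) (x, p) = cvec_at c x p"
proof -
  have c: "c \<in> charts_at M (chart_inv c x)" by (rule chart_inv_charts_at[OF assms])
  have i: "inj_on (snd (bundle_chart CT c)) (fst (bundle_chart CT c))"
  proof (rule inj_onI)
    fix a b assume ab: "a \<in> fst (bundle_chart CT c)" "b \<in> fst (bundle_chart CT c)"
      "snd (bundle_chart CT c) a = snd (bundle_chart CT c) b"
    then have "fst a = fst b"
      using assms(1) chart_inv_chart by (auto simp: fst_bundle_chart snd_bundle_chart) (metis chart_inv_chart)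
    then show "a = b" using ab assms(1)
      by (intro cotangent_eqI[of a b c]) (auto simp: fst_bundle_chart snd_bundle_chart charts_at_def)
  qed
  have 1: "(x, p) = snd (bundle_chart CT c) (cvec_at c x p)"
    using c assms by (simp add: snd_bundle_chart chart_chart_inv)
  have "cvec_at c x p \<in> fst (bundle_chart CT c)"
    using c assms by (simp add: fst_bundle_chart chart_inv_in)
  then show ?thesis
    unfolding chart_inv_def[of "bundle_chart CT c"] 1 by (rule inv_into_f_f[OF i])
qed

lemma points_cotangent_atlas: "points (cotangent_atlas M) = CT"
  using cotangent_points by (auto simp: points_def cotangent_atlas_def fst_bundle_chart)

lemma smooth_fun_cotangentD:
  assumes F: "smooth_fun (cotangent_atlas M) F" and c: "c \<in> M"
  shows "smooth_on (coords c) (\<lambda>(x, p). F (cvec_at c x p))"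
proof -
  let ?C = "bundle_chart CT c"
  have img: "snd ?C ` {m \<in> fst ?C. F m \<in> UNIV} = coords c"
    using bundle_chart_image[OF c, of "\<lambda>_. True"] by (auto simp: fst_bundle_chart)
  have "smooth_on (coords c) (F \<circ> chart_inv ?C)"
    using F c unfolding smooth_map_def by (auto simp: euclidean_atlas_def cotangent_atlas_def img[simplified] o_def)
  then show ?thesis
    by (rule smooth_on_eq[OF open_coords[OF c]]) (auto simp: bundle_chart_inv[OF c])
qed

lemma smooth_fun_baseD:
  assumes F: "smooth_fun M h" and c: "c \<in> M"
  shows "smooth_on (img c) (\<lambda>x. h (chart_inv c x))"
  using F c unfolding smooth_map_def by (auto simp: euclidean_atlas_def o_def)

lemma cvec_overlap:
  assumes "c \<in> M" "d \<in> M" "x \<in> snd c ` (fst c \<inter> fst d)"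
  shows "cvec_at d (transition c d x) (adjoint (jac d c (chart_inv c x)) p) = cvec_at c x p"
  by (simp add: chart_inv_transition[OF assms] cvec_change[OF overlap_charts[OF assms]])

text \<open>Smoothness is demanded between all pairs of canonical charts. Since base points are
  kept, the expression within one chart suffices: any other target chart is reached by a transition
  map and a transposed Jacobian.\<close>

lemma fiber_preservingI:
  assumes z: "\<And>a. a \<in> CT \<Longrightarrow> z a \<in> CT \<and> fst (z a) = fst a"
    and s: "\<And>c. c \<in> M \<Longrightarrow> smooth_on (coords c) (\<lambda>(x, p). snd (z (cvec_at c x p)) c)"
  shows "fiber_preserving M z"
  unfolding fiber_preserving_def smooth_map_def points_cotangent_atlas
proof (intro conjI ballI)
  show "z ` CT \<subseteq> CT" "\<And>\<alpha>. \<alpha> \<in> CT \<Longrightarrow> fst (z \<alpha>) = fst \<alpha>" using z by auto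
  fix C D assume "C \<in> cotangent_atlas M" "D \<in> cotangent_atlas M"
  then obtain c d where cd: "c \<in> M" "d \<in> M" "C = bundle_chart CT c" "D = bundle_chart CT d"
    by (auto simp: cotangent_atlas_def)
  let ?S = "snd c ` (fst c \<inter> fst d) \<times> (UNIV :: 'e set)"
  have oS: "open ?S" using cd by (intro open_Times open_overlap open_UNIV)
  have "{m \<in> fst C. z m \<in> fst D} = {a \<in> CT. fst a \<in> fst c \<and> fst a \<in> fst d}"
    using z by (auto simp: cd fst_bundle_chart)
  then have "snd C ` {m \<in> fst C. z m \<in> fst D} =
      {y. fst y \<in> img c \<and> chart_inv c (fst y) \<in> fst d}"
    using bundle_chart_image[OF cd(1), of "\<lambda>a. fst a \<in> fst d"] by (simp add: cd(3))
  also have "\<dots> = ?S"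
    using overlap_iff[OF cd(1), of _ d] by (auto simp: mem_Times_iff chart_inv_chart[OF cd(1)])
  finally have img: "snd C ` {m \<in> fst C. z m \<in> fst D} = ?S" .
  show "open (snd C ` {m \<in> fst C. z m \<in> fst D})" unfolding img by (rule oS)
  have sub: "?S \<subseteq> coords c" by auto
  have 1: "smooth_on ?S (\<lambda>y. snd (z (cvec_at c (fst y) (snd y))) c)"
    using smooth_on_subset[OF s[OF cd(1)] sub] by (simp add: case_prod_unfold)
  have f: "smooth_on ?S fst" using smooth_on_fst[OF oS smooth_on_id[OF oS]] .
  have "smooth_on ?S (\<lambda>y. (transition c d (fst y),
      adjoint (jac d c (chart_inv c (fst y))) (snd (z (cvec_at c (fst y) (snd y))) c)))"
    by (intro smooth_on_Pair oS smooth_adjoint_jac cd 1 f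
        smooth_on_compose[OF oS open_overlap[OF cd(1,2)] f smooth_transition[OF cd(1,2)]]) auto
  moreover have "(snd D \<circ> z \<circ> chart_inv C) y = (transition c d (fst y),
      adjoint (jac d c (chart_inv c (fst y))) (snd (z (cvec_at c (fst y) (snd y))) c))"
    if y: "y \<in> ?S" for y
  proof -
    have x: "fst y \<in> snd c ` (fst c \<inter> fst d)" using y by auto
    note ch = overlap_charts[OF cd(1,2) x]
    let ?a = "cvec_at c (fst y) (snd y)"
    have "chart_inv C y = ?a"
      using bundle_chart_inv[OF cd(1), of "fst y" "snd y"] x by (auto simp: cd(3))
    moreover have "z ?a = cvec_at c (fst y) (snd (z ?a) c)"
      using cvec_eq[of "z ?a" c] z[OF cvec_in[OF ch(1)]] ch(1) by simp
    from arg_cong[OF this, of "\<lambda>b. snd b d"]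
    have "snd (z ?a) d = adjoint (jac d c (chart_inv c (fst y))) (snd (z ?a) c)"
      unfolding snd_cvec[OF ch(2)] .
    moreover have "fst (z ?a) = chart_inv c (fst y)" using z[OF cvec_in[OF ch(1)]] by simp
    ultimately show ?thesis by (simp add: cd(4) snd_bundle_chart transition_def)
  qed
  ultimately show "smooth_on (snd C ` {m \<in> fst C. z m \<in> fst D}) (snd D \<circ> z \<circ> chart_inv C)"
    unfolding img by (rule smooth_on_eq[OF oS])
qed

lemma fiber_preservingD:
  assumes "fiber_preserving M z"
  shows "a \<in> CT \<Longrightarrow> z a \<in> CT" "a \<in> CT \<Longrightarrow> fst (z a) = fst a"
    and "c \<in> M \<Longrightarrow> smooth_on (coords c) (\<lambda>(x, p). snd (z (cvec_at c x p)) c)"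
proof -
  show z: "z a \<in> CT" "fst (z a) = fst a" if "a \<in> CT" for a
    using assms that unfolding fiber_preserving_def smooth_map_def points_cotangent_atlas by auto
  assume c: "c \<in> M"
  let ?C = "bundle_chart CT c"
  have "{m \<in> fst ?C. z m \<in> fst ?C} = {a \<in> CT. fst a \<in> fst c \<and> True}"
    using z by (auto simp: fst_bundle_chart)
  then have img: "snd ?C ` {m \<in> fst ?C. z m \<in> fst ?C} = coords c"
    using bundle_chart_image[OF c, of "\<lambda>_. True"] by auto
  have "smooth_on (coords c) (snd ?C \<circ> z \<circ> chart_inv ?C)"
  proof -
    have "\<forall>C\<in>cotangent_atlas M. \<forall>D\<in>cotangent_atlas M.
        smooth_on (snd C ` {m \<in> fst C. z m \<in> fst D}) (snd D \<circ> z \<circ> chart_inv C)"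
      using assms unfolding fiber_preserving_def smooth_map_def by blast
    moreover have "?C \<in> cotangent_atlas M" using c by (simp add: cotangent_atlas_def)
    ultimately have "smooth_on (snd ?C ` {m \<in> fst ?C. z m \<in> fst ?C}) (snd ?C \<circ> z \<circ> chart_inv ?C)"
      by blast
    then show ?thesis unfolding img .
  qed
  from smooth_on_snd[OF open_coords[OF c] this]
  show "smooth_on (coords c) (\<lambda>(x, p). snd (z (cvec_at c x p)) c)"
    by (rule smooth_on_eq[OF open_coords[OF c]]) (auto simp: bundle_chart_inv[OF c] snd_bundle_chart)
qed

section \<open>Open sets of the cotangent bundle, and limits along lines in a fiber\<close>

definition coord_set :: "('m, 'e) chart \<Rightarrow> ('m, 'e) fvec set \<Rightarrow> ('e \<times> 'e) set" where
  "coord_set c U = {y. fst y \<in> img c \<and> cvec_at c (fst y) (snd y) \<in> U}"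

abbreviation CTtop where "CTtop \<equiv> manifold_topology (cotangent_atlas M)"

text \<open>\<open>topology\<close> returns the intended open sets only for a family closed under
  finite intersections and unions; this is checked first, for the description in
  coordinates.\<close>

lemma openin_CTtop: "openin CTtop U \<longleftrightarrow> U \<subseteq> CT \<and> (\<forall>c\<in>M. open (coord_set c U))"
proof -
  have "istopology (\<lambda>U. U \<subseteq> CT \<and> (\<forall>c\<in>M. open (coord_set c U)))"
    unfolding istopology_def
  proof (intro conjI allI impI ballI)
    show "open (coord_set c (S \<inter> T))"
      if "S \<subseteq> CT \<and> (\<forall>c\<in>M. open (coord_set c S))" "T \<subseteq> CT \<and> (\<forall>c\<in>M. open (coord_set c T))" "c \<in> M"
      for c S T
    proof -
      have "coord_set c (S \<inter> T) = coord_set c S \<inter> coord_set c T" by (auto simp: coord_set_def)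
      then show ?thesis using that by auto
    qed
    show "open (coord_set c (\<Union>K))"
      if "\<forall>S\<in>K. S \<subseteq> CT \<and> (\<forall>c\<in>M. open (coord_set c S))" "c \<in> M" for c K
    proof -
      have "coord_set c (\<Union>K) = (\<Union>S\<in>K. coord_set c S)" by (auto simp: coord_set_def)
      then show ?thesis using that by auto
    qed
  qed auto
  moreover have "snd (bundle_chart CT c) ` (U \<inter> fst (bundle_chart CT c)) = coord_set c U"
    if "c \<in> M" "U \<subseteq> CT" for c U
  proof -
    have "U \<inter> fst (bundle_chart CT c) = {a \<in> CT. fst a \<in> fst c \<and> a \<in> U}"
      using that by (auto simp: fst_bundle_chart)
    then show ?thesis using bundle_chart_image[OF that(1), of "\<lambda>a. a \<in> U"] that by (simp add: coord_set_def)
  qed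
  then have "(\<lambda>U. U \<subseteq> points (cotangent_atlas M) \<and> (\<forall>c\<in>cotangent_atlas M. open (snd c ` (U \<inter> fst c)))) =
      (\<lambda>U. U \<subseteq> CT \<and> (\<forall>c\<in>M. open (coord_set c U)))"
    unfolding points_cotangent_atlas unfolding cotangent_atlas_def ball_simps fun_eq_iff
    by (intro allI conj_cong ball_cong refl) simp_all
  ultimately show ?thesis
    unfolding manifold_topology_def by (simp add: topology_inverse')
qed

lemma topspace_CTtop: "topspace CTtop = CT"
proof -
  have "openin CTtop CT"
    unfolding openin_CTtop
  proof (intro conjI ballI subset_refl)
    fix c assume c: "c \<in> M"
    have "coord_set c CT = coords c" using cvec_in_CT[OF c] by (auto simp: coord_set_def)
    then show "open (coord_set c CT)" using open_coords[OF c] by simp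
  qed
  then show ?thesis
    by (metis openin_CTtop openin_subset openin_topspace subset_antisym)
qed

text \<open>Openness is tested in every chart \<open>d\<close>, so a set described in
  \<open>c\<close> is pulled back along the continuous change of coordinates from \<open>d\<close>
  to \<open>c\<close>.\<close>

lemma openin_chart_preimage:
  assumes c: "c \<in> M" and V: "open V"
  shows "openin CTtop {a \<in> CT. fst a \<in> fst c \<and> (snd c (fst a), snd a c) \<in> V}" (is "openin _ ?U")
  unfolding openin_CTtop
proof (intro conjI ballI)
  fix d assume d: "d \<in> M"
  let ?S = "snd d ` (fst d \<inter> fst c) \<times> (UNIV :: 'e set)"
  let ?f = "\<lambda>y. (transition d c (fst y), adjoint (jac c d (chart_inv d (fst y))) (snd y))"
  have oS: "open ?S" using c d by (intro open_Times open_overlap open_UNIV)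
  have f: "smooth_on ?S fst" "smooth_on ?S snd"
    using smooth_on_fst[OF oS smooth_on_id[OF oS]] smooth_on_snd[OF oS smooth_on_id[OF oS]] .
  have "smooth_on ?S ?f"
    by (intro smooth_on_Pair oS smooth_adjoint_jac c d f
        smooth_on_compose[OF oS open_overlap[OF d c] f(1) smooth_transition[OF d c]]) auto
  then have "open {y \<in> ?S. ?f y \<in> V}" by (rule smooth_on_open_vimage[OF _ oS V])
  moreover have "coord_set d ?U = {y \<in> ?S. ?f y \<in> V}"
  proof (rule set_eqI)
    fix y
    show "y \<in> coord_set d ?U \<longleftrightarrow> y \<in> {y \<in> ?S. ?f y \<in> V}"
    proof (cases "fst y \<in> snd d ` (fst d \<inter> fst c)")
      case True
      note ch = overlap_charts[OF d c True]
      have "snd (cvec_at d (fst y) (snd y)) c = adjoint (jac c d (chart_inv d (fst y))) (snd y)"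
        using ch by (simp add: cvec_def)
      then show ?thesis
        using True ch overlap_iff[OF d, of "fst y" c]
        by (simp add: coord_set_def mem_Times_iff transition_def)
    next
      case False
      then show ?thesis
        using overlap_iff[OF d, of "fst y" c] by (auto simp: coord_set_def mem_Times_iff)
    qed
  qed
  ultimately show "open (coord_set d ?U)" by simp
qed auto

lemma openin_fiber_preserving_preimage:
  assumes z: "fiber_preserving M z" and U: "openin CTtop U"
  shows "openin CTtop {a \<in> CT. z a \<in> U}"
  unfolding openin_CTtop
proof (intro conjI ballI)
  fix c assume c: "c \<in> M"
  let ?f = "\<lambda>y. (fst y, snd (z (cvec_at c (fst y) (snd y))) c)"
  have "smooth_on (coords c) ?f"
    using fiber_preservingD(3)[OF z c]
    by (intro smooth_on_Pair open_coords c smooth_on_fst smooth_on_id) (simp add: case_prod_unfold)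
  then have "open {y \<in> coords c. ?f y \<in> coord_set c U}"
    by (rule smooth_on_open_vimage) (use U c open_coords[OF c] in \<open>simp_all add: openin_CTtop\<close>)
  moreover have "coord_set c {a \<in> CT. z a \<in> U} = {y \<in> coords c. ?f y \<in> coord_set c U}"
  proof (rule set_eqI)
    fix y
    show "y \<in> coord_set c {a \<in> CT. z a \<in> U} \<longleftrightarrow> y \<in> {y \<in> coords c. ?f y \<in> coord_set c U}"
    proof (cases "fst y \<in> img c")
      case True
      let ?a = "cvec_at c (fst y) (snd y)"
      have ch: "c \<in> charts_at M (chart_inv c (fst y))" using chart_inv_charts_at[OF c True] .
      have a: "?a \<in> CT" using ch by simp
      have "cvec_at c (fst y) (snd (z ?a) c) = z ?a"
        using cvec_eq[of "z ?a" c] fiber_preservingD[OF z] a ch by simp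
      then show ?thesis using True a by (simp add: coord_set_def mem_Times_iff)
    qed (simp add: coord_set_def mem_Times_iff)
  qed
  ultimately show "open (coord_set c {a \<in> CT. z a \<in> U})" by simp
qed auto

text \<open>Restriction to a straight line in a fiber reduces limits in the bundle to limits of
  functions of one real variable.\<close>

lemma smooth_on_fiber_line:
  assumes "c \<in> M" "x \<in> img c" "smooth_on (coords c) (\<lambda>(x, p). G x p)"
  shows "((\<lambda>t. G x (p + t *\<^sub>R r)) \<longlongrightarrow> G x p) (at 0)"
proof -
  have "isCont (\<lambda>(x, p). G x p) (x, p)"
    using continuous_on_eq_continuous_at[OF open_coords[OF assms(1)]] smooth_on_continuous[OF assms(3)] assms(2)
    by blast
  moreover have "((\<lambda>t. (x, p + t *\<^sub>R r)) \<longlongrightarrow> (x, p)) (at (0::real))"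
    by (auto intro!: tendsto_eq_intros)
  ultimately show ?thesis
    using isCont_tendsto_compose by fastforce
qed

text \<open>A smooth extension is continuous, so its value at \<open>a\<close> is the limit of
  \<open>f\<close> there.\<close>

lemma limit_zeroI:
  assumes z: "fiber_preserving M z" and a: "a \<in> CT" "z a = vzero (fst a)"
    and f: "\<And>b. b \<in> CT - S \<Longrightarrow> z b = f b"
  shows "limitin CTtop f (vzero (fst a)) (atin_within CTtop a (CT - S))"
  unfolding limitin_def
proof (intro conjI allI impI)
  show "vzero (fst a) \<in> topspace CTtop"
    using fiber_preservingD(1)[OF z a(1)] a(2) by (simp add: topspace_CTtop)
  fix U assume U: "openin CTtop U \<and> vzero (fst a) \<in> U"
  then have "openin CTtop {b \<in> CT. z b \<in> U}" "a \<in> {b \<in> CT. z b \<in> U}"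
    using openin_fiber_preserving_preimage[OF z] a by auto
  then show "\<forall>\<^sub>F b in atin_within CTtop a (CT - S). f b \<in> U"
    unfolding eventually_atin_within using f by (metis (mono_tags, lifting) mem_Collect_eq)
qed

text \<open>A limit within the complement of \<open>S\<close> could be vacuous. The direction
  \<open>r\<close> excludes this, as the line through \<open>p\<close> leaves \<open>S\<close> at
  once. Along it \<open>z\<close> tends to its value by continuity and to \<open>0\<close> by the
  assumed limit.\<close>

lemma limit_zeroD:
  assumes z: "fiber_preserving M z" and c: "c \<in> charts_at M q"
    and f: "\<And>b. b \<in> CT - S \<Longrightarrow> z b = f b"
    and l: "limitin CTtop f (vzero q) (atin_within CTtop (cvec c q p) (CT - S))"
    and r: "\<And>t. t \<noteq> 0 \<Longrightarrow> cvec c q (p + t *\<^sub>R r) \<notin> S" "r \<noteq> 0"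
  shows "z (cvec c q p) = vzero q"
proof -
  note cM = charts_atD[OF c]
  let ?g = "\<lambda>t. snd (z (cvec c q (p + t *\<^sub>R r))) c"
  have x: "snd c q \<in> img c" "chart_inv c (snd c q) = q"
    using cM chart_inv_chart by auto
  have 1: "(?g \<longlongrightarrow> snd (z (cvec c q p)) c) (at 0)"
    using smooth_on_fiber_line[OF cM(1) x(1) fiber_preservingD(3)[OF z cM(1)]] by (simp add: x(2))
  have 2: "(?g \<longlongrightarrow> 0) (at 0)"
  proof (rule tendstoI)
    fix e :: real assume e: "e > 0"
    \<comment> \<open>A tube around the zero section over the domain of \<open>c\<close>: membership
      bounds the fiber coordinate.\<close>
    let ?U = "{a \<in> CT. fst a \<in> fst c \<and> (snd c (fst a), snd a c) \<in> UNIV \<times> ball 0 e}"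
    have "openin CTtop ?U"
      by (rule openin_chart_preimage[OF cM(1)]) (intro open_Times open_UNIV open_ball)
    moreover have "vzero q \<in> ?U" using c cM e by (simp add: vzero_cvec[OF c])
    ultimately have "\<forall>\<^sub>F b in atin_within CTtop (cvec c q p) (CT - S). f b \<in> ?U"
      using l unfolding limitin_def by blast
    moreover have "cvec c q p \<in> topspace CTtop" using c by (simp add: topspace_CTtop)
    ultimately obtain T where T: "openin CTtop T" "cvec c q p \<in> T"
      "\<And>b. b \<in> T \<Longrightarrow> b \<in> CT - S \<Longrightarrow> b \<noteq> cvec c q p \<Longrightarrow> f b \<in> ?U"
      unfolding eventually_atin_within by blast
    have "open (coord_set c T)" using T(1) cM by (simp add: openin_CTtop)
    moreover have "(snd c q, p) \<in> coord_set c T" using T(2) x by (simp add: coord_set_def)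
    moreover have "((\<lambda>t. (snd c q, p + t *\<^sub>R r)) \<longlongrightarrow> (snd c q, p)) (at (0::real))"
      by (auto intro!: tendsto_eq_intros)
    ultimately have "\<forall>\<^sub>F t in at 0. (snd c q, p + t *\<^sub>R r) \<in> coord_set c T"
      using topological_tendstoD by blast
    moreover have "\<forall>\<^sub>F t in at 0. t \<noteq> (0::real)" by (simp add: eventually_at_filter)
    ultimately show "\<forall>\<^sub>F t in at 0. dist (?g t) 0 < e"
    proof eventually_elim
      case (elim t)
      let ?b = "cvec c q (p + t *\<^sub>R r)"
      have "?b \<in> T" using elim(1) x by (simp add: coord_set_def)
      moreover have b: "?b \<in> CT - S" using r(1)[OF elim(2)] c by simp
      moreover have "?b \<noteq> cvec c q p" using elim(2) r(2) cvec_eq_iff[OF c] by simp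
      ultimately have "f ?b \<in> ?U" by (intro T(3))
      then have "z ?b \<in> ?U" using f[OF b] by simp
      then show ?case by (simp add: dist_norm)
    qed
  qed
  have "snd (z (cvec c q p)) c = 0" using tendsto_unique[OF _ 1 2] by simp
  moreover have "z (cvec c q p) \<in> CT" "fst (z (cvec c q p)) = q"
    using fiber_preservingD[OF z] c by auto
  ultimately show ?thesis
    using cvec_eq[of "z (cvec c q p)" c] c by (simp add: vzero_cvec[OF c])
qed

end

section \<open>Tensors and metrics in coordinates\<close>

text \<open>In an orthogonal frame \<open>u\<close> the vector representing \<open>p\<close> has the
  explicit coefficients \<open>p \<bullet> u i x / B x (u i x) (u i x)\<close>. The frame arises
  from the constant standard basis by orthogonalisation.\<close>

lemma smooth_riesz:
  fixes B :: "'a::euclidean_space \<Rightarrow> 'e::euclidean_space \<Rightarrow> 'e \<Rightarrow> real"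
  assumes V: "open V"
    and B: "\<And>x. x \<in> V \<Longrightarrow> inner_form (B x)"
    and sB: "\<And>v w. v \<in> Basis \<Longrightarrow> w \<in> Basis \<Longrightarrow> smooth_on V (\<lambda>x. B x v w)"
  shows "\<exists>S. (\<forall>x\<in>V. \<forall>p w. B x (S x p) w = p \<bullet> w) \<and> (\<forall>p. smooth_on V (\<lambda>x. S x p))"
proof -
  obtain b :: "nat \<Rightarrow> 'e" where b: "bij_betw b {0..<DIM('e)} Basis"
    using ex_bij_betw_nat_finite[OF finite_Basis] by blast
  let ?k = "DIM('e)"
  have b': "b ` {..<?k} = Basis" "inj_on b {..<?k}"
    using b by (auto simp: bij_betw_def atLeast0LessThan)
  have "\<exists>u. (\<forall>i<?k. smooth_on V (u i)) \<and>
    (\<forall>x\<in>V. form_orthogonal (B x) ?k (\<lambda>i. u i x) \<and> span ((\<lambda>i. u i x) ` {..<?k}) = span ((\<lambda>i. b i) ` {..<?k}))"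
    by (rule smooth_gram_schmidt[OF V B sB, of _ "\<lambda>i x. b i"])
      (use b' in \<open>simp_all add: smooth_on_const independent_Basis\<close>)
  then obtain u where u: "\<And>i. i < ?k \<Longrightarrow> smooth_on V (u i)"
    "\<And>x. x \<in> V \<Longrightarrow> form_orthogonal (B x) ?k (\<lambda>i. u i x)"
    "\<And>x. x \<in> V \<Longrightarrow> span ((\<lambda>i. u i x) ` {..<?k}) = UNIV"
    by (auto simp: b' span_Basis)
  have pos: "B x (u i x) (u i x) \<noteq> 0" if "x \<in> V" "i < ?k" for x i
    using inner_formD(4)[OF B[OF that(1)]] u(2)[OF that(1)] that(2) by (force simp: form_orthogonal_def)
  define S where "S x p = (\<Sum>i<?k. (p \<bullet> u i x / B x (u i x) (u i x)) *\<^sub>R u i x)" for x p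
  have sBf: "smooth_on V (\<lambda>x. B x (f x) (g x))" if "smooth_on V f" "smooth_on V g" for f g
  proof (rule smooth_on_linear_family[where L = "\<lambda>x. B x (f x)", OF V _ _ that(2)])
    show "smooth_on V (\<lambda>x. B x (f x) c)" if "c \<in> Basis" for c
      by (rule smooth_on_linear_family[where L = "\<lambda>x v. B x v c", OF V _ _ \<open>smooth_on V f\<close>])
        (simp_all add: inner_formD(2)[OF B] sB that)
  qed (simp add: inner_formD(1)[OF B])
  have "B x (S x p) w = p \<bullet> w" if x: "x \<in> V" for x p w
  proof -
    have "w \<in> span ((\<lambda>i. u i x) ` {..<?k})" using u(3)[OF x] by simp
    then show ?thesis
    proof (induction rule: span_induct)
      case base
      show ?case
        using inner_formD(1)[OF B[OF x]]
        by (auto simp: subspace_def linear_add linear_cmul linear_0 inner_add_right)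
    next
      case (step w)
      then obtain j where j: "j < ?k" "w = u j x" by auto
      show ?case
        using form_orthogonal_sum[OF B[OF x] u(2)[OF x] j(1)] pos[OF x j(1)]
        by (simp add: S_def j)
    qed
  qed
  moreover have "smooth_on V (\<lambda>x. S x p)" for p
    unfolding S_def
    by (intro smooth_on_sum smooth_on_scaleR smooth_on_divide smooth_on_inner smooth_on_const sBf V u pos) simp_all
  ultimately show ?thesis by blast
qed

context atlas
begin

lemma chart_eqI: "c \<in> M \<Longrightarrow> q \<in> fst c \<Longrightarrow> r \<in> fst c \<Longrightarrow> snd c q = snd c r \<Longrightarrow> q = r"
  by (metis chart_inv_chart)

lemma tangent_eqI:
  assumes "a \<in> tangent_bundle M" "b \<in> tangent_bundle M" "fst a = fst b"
    and "c \<in> charts_at M (fst a)" "snd a c = snd b c"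
  shows "a = b"
  using assms tvec_eq by metis

section \<open>Tensors on Whitney sums in coordinates\<close>

lemma whitney2_chart_inv:
  assumes "c \<in> M" "x \<in> img c"
  shows "chart_inv (whitney2_chart (tangent_bundle M) c) (x, v, w) =
    (tvec_at c x v, tvec_at c x w)"
    and "(x, v, w) \<in> snd (whitney2_chart (tangent_bundle M) c) ` fst (whitney2_chart (tangent_bundle M) c)"
proof -
  let ?C = "whitney2_chart (tangent_bundle M) c"
  let ?m = "(tvec_at c x v, tvec_at c x w)"
  have ch: "c \<in> charts_at M (chart_inv c x)" by (rule chart_inv_charts_at[OF assms])
  have i: "inj_on (snd ?C) (fst ?C)"
  proof (rule inj_onI)
    fix m m' assume m: "m \<in> fst ?C" "m' \<in> fst ?C" "snd ?C m = snd ?C m'"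
    obtain a b a' b' where e: "m = (a, b)" "m' = (a', b')" by (metis surj_pair)
    have in': "a \<in> tangent_bundle M" "b \<in> tangent_bundle M" "fst a = fst b" "fst a \<in> fst c"
      "a' \<in> tangent_bundle M" "b' \<in> tangent_bundle M" "fst a' = fst b'" "fst a' \<in> fst c"
      "snd c (fst a) = snd c (fst a')" "snd a c = snd a' c" "snd b c = snd b' c"
      using m unfolding e whitney2_chart_def fst_conv snd_conv mem_Collect_eq prod.case prod.inject by blast+
    have f: "fst a = fst a'" by (rule chart_eqI[OF assms(1) in'(4,8,9)])
    have ch: "c \<in> charts_at M (fst a)" using in'(4) assms(1) by (simp add: charts_at_def)
    have "a = a'" by (rule tangent_eqI[OF in'(1,5) f ch in'(10)])
    moreover have "b = b'"
      by (rule tangent_eqI[OF in'(2,6) _ _ in'(11)]) (use f ch in'(3,7) in metis)+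
    ultimately show "m = m'" by (simp add: e)
  qed
  have m: "?m \<in> fst ?C" using ch by (simp add: whitney2_chart_def charts_at_def)
  have y: "(x, v, w) = snd ?C ?m" using ch assms by (simp add: whitney2_chart_def chart_chart_inv)
  show "chart_inv ?C (x, v, w) = ?m" unfolding chart_inv_def[of ?C] y by (rule inv_into_f_f[OF i m])
  show "(x, v, w) \<in> img ?C" unfolding y by (rule imageI[OF m])
qed

lemma tangent_tensor2_smooth:
  assumes "tangent_tensor2 M T" and c: "c \<in> M"
  shows "smooth_on (img c) (\<lambda>x. T (tvec_at c x v) (tvec_at c x w))"
proof -
  let ?C = "whitney2_chart (tangent_bundle M) c"
  have "smooth_on (img ?C) ((\<lambda>(v, w). T v w) \<circ> chart_inv ?C)"
    using assms unfolding tangent_tensor2_def smooth_map_def by (auto simp: euclidean_atlas_def o_def)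
  moreover have "coords c \<subseteq> img ?C" using whitney2_chart_inv(2)[OF c] by auto
  ultimately have "smooth_on (coords c) ((\<lambda>(v, w). T v w) \<circ> chart_inv ?C)" by (rule smooth_on_subset)
  then have "smooth_on (img c) (\<lambda>x. ((\<lambda>(v, w). T v w) \<circ> chart_inv ?C) (x, v, w))"
    by (rule smooth_on_compose[OF open_img[OF c] open_coords[OF c], rotated])
      (auto intro!: smooth_on_Pair smooth_on_id smooth_on_const open_img[OF c])
  then show ?thesis
    by (rule smooth_on_eq[OF open_img[OF c]]) (simp add: whitney2_chart_inv(1)[OF c])
qed

lemma whitney3_chart_inv:
  assumes "c \<in> M" "x \<in> img c"
  shows "chart_inv (whitney3_chart CT c) (x, p1, p2, p3) =
    (cvec_at c x p1, cvec_at c x p2, cvec_at c x p3)"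
    and "(x, p1, p2, p3) \<in> snd (whitney3_chart CT c) ` fst (whitney3_chart CT c)"
proof -
  let ?C = "whitney3_chart CT c"
  let ?m = "(cvec_at c x p1, cvec_at c x p2, cvec_at c x p3)"
  have ch: "c \<in> charts_at M (chart_inv c x)" by (rule chart_inv_charts_at[OF assms])
  have i: "inj_on (snd ?C) (fst ?C)"
  proof (rule inj_onI)
    fix m m' assume m: "m \<in> fst ?C" "m' \<in> fst ?C" "snd ?C m = snd ?C m'"
    obtain a1 a2 a3 b1 b2 b3 where e: "m = (a1, a2, a3)" "m' = (b1, b2, b3)" by (metis surj_pair)
    have in': "a1 \<in> CT" "a2 \<in> CT" "a3 \<in> CT" "fst a1 = fst a2" "fst a1 = fst a3" "fst a1 \<in> fst c"
      "b1 \<in> CT" "b2 \<in> CT" "b3 \<in> CT" "fst b1 = fst b2" "fst b1 = fst b3" "fst b1 \<in> fst c"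
      "snd c (fst a1) = snd c (fst b1)" "snd a1 c = snd b1 c" "snd a2 c = snd b2 c" "snd a3 c = snd b3 c"
      using m unfolding e whitney3_chart_def fst_conv snd_conv mem_Collect_eq prod.case prod.inject by blast+
    have f: "fst a1 = fst b1" by (rule chart_eqI[OF assms(1) in'(6,12,13)])
    have ch: "c \<in> charts_at M (fst a1)" using in'(6) assms(1) by (simp add: charts_at_def)
    have "a1 = b1" by (rule cotangent_eqI[OF in'(1,7) f ch in'(14)])
    moreover have "a2 = b2"
      by (rule cotangent_eqI[OF in'(2,8) _ _ in'(15)]) (use f ch in'(4,10) in metis)+
    moreover have "a3 = b3"
      by (rule cotangent_eqI[OF in'(3,9) _ _ in'(16)]) (use f ch in'(5,11) in metis)+
    ultimately show "m = m'" by (simp add: e)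
  qed
  have m: "?m \<in> fst ?C" using ch by (simp add: whitney3_chart_def charts_at_def)
  have y: "(x, p1, p2, p3) = snd ?C ?m" using ch assms by (simp add: whitney3_chart_def chart_chart_inv)
  show "chart_inv ?C (x, p1, p2, p3) = ?m" unfolding chart_inv_def[of ?C] y by (rule inv_into_f_f[OF i m])
  show "(x, p1, p2, p3) \<in> img ?C" unfolding y by (rule imageI[OF m])
qed

abbreviation CT3 where "CT3 \<equiv> {(a1, a2, a3). a1 \<in> CT \<and> a2 \<in> CT \<and> a3 \<in> CT \<and> fst a1 = fst a2 \<and> fst a1 = fst a3}"

lemma smooth_whitney3I:
  assumes s: "\<And>c. c \<in> M \<Longrightarrow> smooth_on (coords c)
    (\<lambda>(x, p1, p2, p3). T (cvec_at c x p1) (cvec_at c x p2) (cvec_at c x p3))"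
  shows "smooth_fun_on_subset (whitney3_chart CT ` M) CT3 (\<lambda>(a1, a2, a3). T a1 a2 a3)"
  unfolding smooth_fun_on_subset_def
proof
  fix m assume "m \<in> CT3"
  then obtain a1 a2 a3 where m: "m = (a1, a2, a3)" "a1 \<in> CT" "a2 \<in> CT" "a3 \<in> CT"
    "fst a1 = fst a2" "fst a1 = fst a3" by auto
  obtain c where c: "c \<in> charts_at M (fst a1)" using chart_at cotangent_points m(2) by blast
  note cM = charts_atD[OF c]
  let ?C = "whitney3_chart CT c"
  show "\<exists>C\<in>charts_at (whitney3_chart CT ` M) m. \<exists>V G. open V \<and> snd C m \<in> V \<and> V \<subseteq> img C \<and>
      smooth_on V G \<and> (\<forall>x\<in>V. chart_inv C x \<in> CT3 \<longrightarrow> G x = (\<lambda>(a1, a2, a3). T a1 a2 a3) (chart_inv C x))"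
  proof (intro bexI[of _ ?C] exI conjI ballI impI)
    show "?C \<in> charts_at (whitney3_chart CT ` M) m"
      using m cM by (simp add: charts_at_def whitney3_chart_def)
    show "open (coords c :: ('e \<times> 'e \<times> 'e \<times> 'e) set)" by (rule open_coords[OF cM(1)])
    show "snd ?C m \<in> coords c" using m cM by (simp add: whitney3_chart_def)
    show "coords c \<subseteq> img ?C" using whitney3_chart_inv(2)[OF cM(1)] by auto
    show "smooth_on (coords c) (\<lambda>(x, p1, p2, p3).
        T (cvec_at c x p1) (cvec_at c x p2) (cvec_at c x p3))"
      by (rule s[OF cM(1)])
    fix y :: "'e \<times> 'e \<times> 'e \<times> 'e" assume y: "y \<in> coords c"
    obtain x p1 p2 p3 where e: "y = (x, p1, p2, p3)" by (metis surj_pair)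
    show "(\<lambda>(x, p1, p2, p3).
        T (cvec_at c x p1) (cvec_at c x p2) (cvec_at c x p3)) y =
        (\<lambda>(a1, a2, a3). T a1 a2 a3) (chart_inv ?C y)"
      using y by (simp add: e whitney3_chart_inv(1)[OF cM(1)])
  qed
qed

text \<open>The definition supplies local extensions in charts of its own choice. On the full
  Whitney sum such an extension is forced to be the coordinate expression of \<open>T\<close>, and
  composition with the change of coordinates carries its smoothness to the prescribed chart
  \<open>c\<close>.\<close>

lemma smooth_whitney3D:
  assumes T: "smooth_fun_on_subset (whitney3_chart CT ` M) CT3 (\<lambda>(a1, a2, a3). T a1 a2 a3)"
    and c: "c \<in> M"
  shows "smooth_on (coords c)
    (\<lambda>(x, p1, p2, p3). T (cvec_at c x p1) (cvec_at c x p2) (cvec_at c x p3))"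
    (is "smooth_on _ ?F")
proof (rule smooth_on_locally)
  fix y :: "'e \<times> 'e \<times> 'e \<times> 'e" assume y: "y \<in> coords c"
  obtain x p1 p2 p3 where e: "y = (x, p1, p2, p3)" by (metis surj_pair)
  let ?q = "chart_inv c x"
  have x: "x \<in> img c" using y e by simp
  have ch: "c \<in> charts_at M ?q" by (rule chart_inv_charts_at[OF c x])
  let ?m = "(cvec c ?q p1, cvec c ?q p2, cvec c ?q p3)"
  have m3: "?m \<in> CT3" using ch by simp
  from bspec[OF T[unfolded smooth_fun_on_subset_def] m3] obtain D V G where D: "D \<in> charts_at (whitney3_chart CT ` M) ?m" "open V" "snd D ?m \<in> V"
    "V \<subseteq> img D" "smooth_on V G"
    "\<forall>x\<in>V. chart_inv D x \<in> CT3 \<longrightarrow> G x = (\<lambda>(a1, a2, a3). T a1 a2 a3) (chart_inv D x)"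
    by (elim bexE exE conjE) (rule that; assumption)
  then obtain d where d: "d \<in> M" "D = whitney3_chart CT d" "?q \<in> fst d"
    by (auto simp: charts_at_def whitney3_chart_def)
  let ?S = "snd c ` (fst c \<inter> fst d) \<times> (UNIV :: ('e \<times> 'e \<times> 'e) set)"
  let ?A = "\<lambda>y. adjoint (jac d c (chart_inv c (fst y)))"
  let ?f = "\<lambda>y. (transition c d (fst y), ?A y (fst (snd y)), ?A y (fst (snd (snd y))), ?A y (snd (snd (snd y))))"
  have oS: "open ?S" using c d by (intro open_Times open_overlap open_UNIV)
  note sid = smooth_on_id[OF oS]
  have f: "smooth_on ?S ?f"
    by (intro smooth_on_Pair oS smooth_adjoint_jac c d smooth_on_fst smooth_on_snd sid
        smooth_on_compose[OF oS open_overlap[OF c d(1)] smooth_on_fst[OF oS sid] smooth_transition[OF c d(1)]]) auto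
  have eq: "?F y = G (?f y)" if y: "y \<in> ?S" "?f y \<in> V" for y
  proof -
    obtain x p1 p2 p3 where e: "y = (x, p1, p2, p3)" by (metis surj_pair)
    have x: "x \<in> snd c ` (fst c \<inter> fst d)" using y e by simp
    have tx: "transition c d x \<in> img d" using transition_overlap[OF c x] by auto
    have "chart_inv D (?f y) = (cvec_at c x p1, cvec_at c x p2, cvec_at c x p3)"
      by (simp add: e d(2) whitney3_chart_inv(1)[OF d(1) tx] cvec_overlap[OF c d(1) x])
    moreover have "\<dots> \<in> CT3" using overlap_charts(1)[OF c d(1) x] by simp
    ultimately show ?thesis using D(6)[THEN bspec, OF y(2)] by (simp add: e)
  qed
  show "\<exists>V. open V \<and> y \<in> V \<and> smooth_on V ?F"
  proof (intro exI conjI)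
    let ?V = "{y \<in> ?S. ?f y \<in> V}"
    show oV: "open ?V" by (rule smooth_on_open_vimage[OF f oS D(2)])
    have xo: "x \<in> snd c ` (fst c \<inter> fst d)" using overlap_iff[OF c] x d(3) by blast
    have "snd D ?m = ?f y"
      using overlap_charts[OF c d(1) xo]
      by (simp add: e d(2) whitney3_chart_def snd_cvec transition_def)
    then show "y \<in> ?V" using D(3) xo by (simp add: e)
    have "smooth_on ?V (\<lambda>y. G (?f y))"
      by (rule smooth_on_compose[OF oV D(2) smooth_on_subset[OF f] D(5)]) auto
    then show "smooth_on ?V ?F" by (rule smooth_on_eq[OF oV]) (use eq in blast)
  qed
qed

section \<open>Metrics, musical isomorphisms and fiber derivatives in a chart\<close>

definition metric_coord :: "(('m, 'e) fvec \<Rightarrow> ('m, 'e) fvec \<Rightarrow> real) \<Rightarrow> ('m, 'e) chart \<Rightarrow> 'e \<Rightarrow> 'e \<Rightarrow> 'e \<Rightarrow> real"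
  where "metric_coord \<rho> c x v w = \<rho> (tvec_at c x v) (tvec_at c x w)"

definition sharp_coord :: "(('m, 'e) fvec \<Rightarrow> ('m, 'e) fvec \<Rightarrow> real) \<Rightarrow> ('m, 'e) chart \<Rightarrow> 'e \<Rightarrow> 'e \<Rightarrow> 'e"
  where "sharp_coord \<rho> c x p = snd (sharp M \<rho> (cvec_at c x p)) c"

lemma inner_form_metric_coord:
  assumes \<rho>: "riemannian_metric M \<rho>" and c: "c \<in> M" and x: "x \<in> img c"
  shows "inner_form (metric_coord \<rho> c x)"
proof -
  have ch: "c \<in> charts_at M (chart_inv c x)" by (rule chart_inv_charts_at[OF c x])
  have lin: "fiber_linear (tangent_bundle M) (chart_inv c x) (\<lambda>w. \<rho> (tvec_at c x v) w)" for v
    using \<rho> tvec_in[OF ch, of v] fst_tvec unfolding riemannian_metric_def tangent_tensor2_def by metis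
  have "linear (metric_coord \<rho> c x v)" for v
    using lin[of v] ch unfolding fiber_linear_def metric_coord_def
    by (intro linearI) (simp_all add: vadd_tvec[symmetric] vscale_tvec[symmetric])
  moreover have "metric_coord \<rho> c x v w = metric_coord \<rho> c x w v" for v w
    using \<rho> ch unfolding riemannian_metric_def metric_coord_def by simp
  moreover have "metric_coord \<rho> c x v v > 0" if "v \<noteq> 0" for v
  proof -
    have "tvec_at c x v \<noteq> vzero (chart_inv c x)"
      using that tvec_eq_iff[OF ch] by (simp add: vzero_tvec[OF ch])
    then show ?thesis using \<rho> ch unfolding riemannian_metric_def metric_coord_def by simp
  qed
  ultimately show ?thesis by (simp add: inner_form_def)
qed

text \<open>\<open>smooth_riesz\<close> produces a solution of the defining equation of
  \<open>sharp\<close>, and definiteness of the metric makes it the only one.\<close>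

lemma sharp_coord:
  assumes \<rho>: "riemannian_metric M \<rho>" and c: "c \<in> M"
  shows "x \<in> img c \<Longrightarrow> sharp M \<rho> (cvec_at c x p) = tvec_at c x (sharp_coord \<rho> c x p)"
    and "x \<in> img c \<Longrightarrow> metric_coord \<rho> c x (sharp_coord \<rho> c x p) w = p \<bullet> w"
    and "smooth_on (img c) (\<lambda>x. sharp_coord \<rho> c x p)"
proof -
  have "\<exists>S. (\<forall>x\<in>img c. \<forall>p w. metric_coord \<rho> c x (S x p) w = p \<bullet> w) \<and>
      (\<forall>p. smooth_on (img c) (\<lambda>x. S x p))"
  proof (rule smooth_riesz[OF open_img[OF c] inner_form_metric_coord[OF \<rho> c]])
    show "smooth_on (img c) (\<lambda>x. metric_coord \<rho> c x v w)" for v w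
      unfolding metric_coord_def using \<rho> c by (intro tangent_tensor2_smooth) (simp_all add: riemannian_metric_def)
  qed
  then obtain S where S: "\<And>x p w. x \<in> img c \<Longrightarrow> metric_coord \<rho> c x (S x p) w = p \<bullet> w"
    "\<And>p. smooth_on (img c) (\<lambda>x. S x p)" by blast
  have sh: "sharp M \<rho> (cvec_at c x p) = tvec_at c x (S x p)"
    if x: "x \<in> img c" for x p
  proof -
    have ch: "c \<in> charts_at M (chart_inv c x)" by (rule chart_inv_charts_at[OF c x])
    note B = inner_form_metric_coord[OF \<rho> c x]
    show ?thesis
      unfolding sharp_def
    proof (rule the_equality)
      have "\<rho> (tvec_at c x (S x p)) w = pairing M (cvec_at c x p) w"
        if w: "w \<in> tangent_bundle M" "fst w = chart_inv c x" for w
      proof -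
        obtain w' where "w = tvec_at c x w'" using tangent_cases[of w c] w ch by metis
        then show ?thesis using S(1)[OF x, of p w'] ch by (simp add: metric_coord_def)
      qed
      then show "tvec_at c x (S x p) \<in> tangent_bundle M \<and>
        fst (tvec_at c x (S x p)) = fst (cvec_at c x p) \<and>
        (\<forall>w\<in>tangent_bundle M. fst w = fst (cvec_at c x p) \<longrightarrow>
          \<rho> (tvec_at c x (S x p)) w = pairing M (cvec_at c x p) w)"
        using ch by simp
    next
      fix v assume v: "v \<in> tangent_bundle M \<and> fst v = fst (cvec_at c x p) \<and>
        (\<forall>w\<in>tangent_bundle M. fst w = fst (cvec_at c x p) \<longrightarrow>
          \<rho> v w = pairing M (cvec_at c x p) w)"
      then obtain v' where v': "v = tvec_at c x v'" using tangent_cases[of v c] ch by (metis fst_cvec)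
      have "metric_coord \<rho> c x v' w = metric_coord \<rho> c x (S x p) w" for w
        using v ch S(1)[OF x, of p w] by (simp add: metric_coord_def v')
      then have "metric_coord \<rho> c x (v' - S x p) (v' - S x p) = 0"
        by (simp add: linear_diff[OF inner_formD(2)[OF B]])
      then have "v' = S x p" using inner_formD(4)[OF B, of "v' - S x p"] by fastforce
      then show "v = tvec_at c x (S x p)" by (simp add: v')
    qed
  qed
  have eq: "sharp_coord \<rho> c x p = S x p" if "x \<in> img c" for x p
    using sh[OF that] chart_inv_charts_at[OF c that] by (simp add: sharp_coord_def)
  show "x \<in> img c \<Longrightarrow> sharp M \<rho> (cvec_at c x p) = tvec_at c x (sharp_coord \<rho> c x p)"
    using sh eq by simp
  show "x \<in> img c \<Longrightarrow> metric_coord \<rho> c x (sharp_coord \<rho> c x p) w = p \<bullet> w"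
    using S(1) eq by simp
  show "smooth_on (img c) (\<lambda>x. sharp_coord \<rho> c x p)"
    by (rule smooth_on_eq[OF open_img[OF c] S(2)]) (rule eq)
qed

definition flat_coord :: "(('m, 'e) fvec \<Rightarrow> ('m, 'e) fvec \<Rightarrow> real) \<Rightarrow> ('m, 'e) chart \<Rightarrow> 'e \<Rightarrow> 'e \<Rightarrow> 'e"
  where "flat_coord \<rho> c x v = (\<Sum>b\<in>Basis. metric_coord \<rho> c x v b *\<^sub>R b)"

context
  fixes \<rho> c x
  assumes \<rho>: "riemannian_metric M \<rho>" and c: "c \<in> M" and x: "x \<in> img c"
begin

lemma metric_coord_eqI:
  assumes "\<And>w. metric_coord \<rho> c x v w = metric_coord \<rho> c x v' w"
  shows "v = v'"
proof -
  note B = inner_form_metric_coord[OF \<rho> c x]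
  have "metric_coord \<rho> c x (v - v') (v - v') = 0"
    by (simp add: linear_diff[OF inner_formD(2)[OF B]] assms)
  then show ?thesis using inner_formD(4)[OF B, of "v - v'"] by fastforce
qed

lemma flat_coord_inner: "flat_coord \<rho> c x v \<bullet> w = metric_coord \<rho> c x v w"
  unfolding flat_coord_def
  by (rule linear_inner_representation[OF inner_formD(1)[OF inner_form_metric_coord[OF \<rho> c x]]])

lemma sharp_flat: "sharp_coord \<rho> c x (flat_coord \<rho> c x v) = v"
  by (rule metric_coord_eqI) (simp add: sharp_coord(2)[OF \<rho> c x] flat_coord_inner)

lemma flat_sharp: "flat_coord \<rho> c x (sharp_coord \<rho> c x p) = p"
  by (rule vector_eq_rdot[THEN iffD1]) (simp add: flat_coord_inner sharp_coord(2)[OF \<rho> c x])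

lemma linear_flat_coord: "linear (flat_coord \<rho> c x)"
  by (rule linearI; rule vector_eq_rdot[THEN iffD1])
    (simp_all add: flat_coord_inner inner_add_left
      linear_add[OF inner_formD(2)[OF inner_form_metric_coord[OF \<rho> c x]]]
      linear_cmul[OF inner_formD(2)[OF inner_form_metric_coord[OF \<rho> c x]]])

lemma linear_sharp_coord: "linear (sharp_coord \<rho> c x)"
  by (rule linearI; rule metric_coord_eqI)
    (simp_all add: sharp_coord(2)[OF \<rho> c x] inner_add_left
      linear_add[OF inner_formD(2)[OF inner_form_metric_coord[OF \<rho> c x]]]
      linear_cmul[OF inner_formD(2)[OF inner_form_metric_coord[OF \<rho> c x]]])

lemma sharp_coord_sym: "p \<bullet> sharp_coord \<rho> c x r = r \<bullet> sharp_coord \<rho> c x p"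
  using sharp_coord(2)[OF \<rho> c x, of p "sharp_coord \<rho> c x r"] sharp_coord(2)[OF \<rho> c x, of r "sharp_coord \<rho> c x p"]
    inner_formD(3)[OF inner_form_metric_coord[OF \<rho> c x]] by metis

text \<open>This is the dual metric on covectors. For \<open>\<rho>'\<close> it is the form
  \<open>ghat\<close> of the methods, by \<open>ghat_coord\<close>.\<close>

lemma inner_form_sharp_coord: "inner_form (\<lambda>p r. p \<bullet> sharp_coord \<rho> c x r)"
  unfolding inner_form_def
proof (intro conjI allI impI)
  show "linear (\<lambda>r. v \<bullet> sharp_coord \<rho> c x r)" for v
    using linear_sharp_coord by (auto simp: linear_iff inner_add_right)
  show "v \<bullet> sharp_coord \<rho> c x w = w \<bullet> sharp_coord \<rho> c x v" for v w by (rule sharp_coord_sym)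
  fix v :: 'e assume "v \<noteq> 0"
  then have "sharp_coord \<rho> c x v \<noteq> 0"
    using flat_sharp[of v] linear_0[OF linear_flat_coord] by metis
  then show "0 < v \<bullet> sharp_coord \<rho> c x v"
    using inner_formD(4)[OF inner_form_metric_coord[OF \<rho> c x]] sharp_coord(2)[OF \<rho> c x, of v] by metis
qed

lemma half_form_coord:
  "half_form M \<rho> (cvec_at c x p) (cvec_at c x r) = 1/2 * (p \<bullet> sharp_coord \<rho> c x r)"
  unfolding half_form_def
  by (simp add: sharp_coord(1)[OF \<rho> c x] chart_inv_charts_at[OF c x])

lemma kinetic_coord:
  "kinetic M \<rho> (cvec_at c x p) = 1/2 * (p \<bullet> sharp_coord \<rho> c x p)"
  unfolding kinetic_def
  by (simp add: sharp_coord(1)[OF \<rho> c x] chart_inv_charts_at[OF c x])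

context
  fixes F h
  assumes F: "\<And>a. a \<in> CT \<Longrightarrow> F a = kinetic M \<rho> a + h (fst a)"
begin

text \<open>Along a line in the fiber \<open>F\<close> is a quadratic polynomial in \<open>s\<close>
  with linear coefficient \<open>r \<bullet> sharp_coord \<rho> c x p\<close>. The potential is
  constant there, so the formula serves a simple function and its kinetic part alike.\<close>

lemma fiber_deriv_coord:
  "fiber_deriv M F (cvec_at c x p) = tvec_at c x (sharp_coord \<rho> c x p)"
proof -
  let ?q = "chart_inv c x" and ?S = "sharp_coord \<rho> c x"
  have ch: "c \<in> charts_at M ?q" by (rule chart_inv_charts_at[OF c x])
  have D: "((\<lambda>s. F (vadd (cvec c ?q p) (vscale s (cvec c ?q r)))) has_real_derivative r \<bullet> ?S p) (at 0)" for r
  proof -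
    have "F (vadd (cvec c ?q p) (vscale s (cvec c ?q r))) =
        1/2 * (p \<bullet> ?S p) + s * (r \<bullet> ?S p) + s^2 * (1/2 * (r \<bullet> ?S r)) + h ?q" for s
      using ch sharp_coord_sym[of p r]
      by (simp add: vscale_cvec vadd_cvec F kinetic_coord inner_add_left inner_add_right power2_eq_square
          linear_add[OF linear_sharp_coord] linear_cmul[OF linear_sharp_coord] algebra_simps)
    moreover have "((\<lambda>s. 1/2 * (p \<bullet> ?S p) + s * (r \<bullet> ?S p) + s^2 * (1/2 * (r \<bullet> ?S r)) + h ?q)
        has_real_derivative r \<bullet> ?S p) (at 0)"
      by (auto intro!: derivative_eq_intros)
    ultimately show ?thesis by simp
  qed
  show ?thesis
    unfolding fiber_deriv_def
  proof (rule the_equality)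
    have "((\<lambda>s. F (vadd (cvec c ?q p) (vscale s \<sigma>))) has_real_derivative pairing M \<sigma> (tvec c ?q (?S p))) (at 0)"
      if \<sigma>: "\<sigma> \<in> CT" "fst \<sigma> = ?q" for \<sigma>
    proof -
      obtain r where "\<sigma> = cvec c ?q r" using cotangent_cases[of \<sigma> c] \<sigma> ch by metis
      then show ?thesis using D[of r] ch by simp
    qed
    then show "tvec c ?q (?S p) \<in> tangent_bundle M \<and> fst (tvec c ?q (?S p)) = fst (cvec c ?q p) \<and>
      (\<forall>\<sigma>\<in>CT. fst \<sigma> = fst (cvec c ?q p) \<longrightarrow>
        ((\<lambda>s. F (vadd (cvec c ?q p) (vscale s \<sigma>))) has_real_derivative pairing M \<sigma> (tvec c ?q (?S p))) (at 0))"
      using ch by simp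
  next
    fix v assume v: "v \<in> tangent_bundle M \<and> fst v = fst (cvec c ?q p) \<and>
      (\<forall>\<sigma>\<in>CT. fst \<sigma> = fst (cvec c ?q p) \<longrightarrow>
        ((\<lambda>s. F (vadd (cvec c ?q p) (vscale s \<sigma>))) has_real_derivative pairing M \<sigma> v) (at 0))"
    then obtain v' where v': "v = tvec c ?q v'" using tangent_cases[of v c] ch by (metis fst_cvec)
    have "r \<bullet> v' = r \<bullet> ?S p" for r
    proof -
      have "((\<lambda>s. F (vadd (cvec c ?q p) (vscale s (cvec c ?q r)))) has_real_derivative
          pairing M (cvec c ?q r) v) (at 0)"
        using v cvec_in[OF ch] by simp
      then show ?thesis using DERIV_unique[OF D[of r]] ch by (simp add: v')
    qed
    then have "v' = ?S p" using vector_eq_ldot by blast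
    then show "v = tvec c ?q (?S p)" by (simp add: v')
  qed
qed

lemma ghat_coord:
  "ghat M F (cvec_at c x p) (cvec_at c x r) = p \<bullet> sharp_coord \<rho> c x r"
  unfolding ghat_def by (simp add: fiber_deriv_coord chart_inv_charts_at[OF c x])

end

end

text \<open>\<open>inv_into\<close> inverts over the whole cotangent bundle, so injectivity has to
  separate different fibers as well; it does, because the fiber derivative keeps the base
  point.\<close>

lemma fiber_deriv_inv_coord:
  assumes \<rho>: "riemannian_metric M \<rho>" and F: "\<And>a. a \<in> CT \<Longrightarrow> F a = kinetic M \<rho> a + h (fst a)"
    and c: "c \<in> M" and x: "x \<in> img c"
  shows "fiber_deriv_inv M F (tvec_at c x v) = cvec_at c x (flat_coord \<rho> c x v)"
proof -
  have i: "inj_on (fiber_deriv M F) CT"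
  proof (rule inj_onI)
    fix a b assume ab: "a \<in> CT" "b \<in> CT" "fiber_deriv M F a = fiber_deriv M F b"
    obtain d where d: "d \<in> charts_at M (fst a)" using chart_at cotangent_points ab(1) by blast
    obtain e where e: "e \<in> charts_at M (fst b)" using chart_at cotangent_points ab(2) by blast
    note dM = charts_atD[OF d] note eM = charts_atD[OF e]
    obtain y p where y: "y \<in> img d" "a = cvec_at d y p"
      by (rule CT_chart_cases[OF ab(1) dM]) (rule that; assumption)
    obtain y' p' where y': "y' \<in> img e" "b = cvec e (chart_inv e y') p'"
      by (rule CT_chart_cases[OF ab(2) eM]) (rule that; assumption)
    have "fst a = fst b"
      using arg_cong[OF ab(3), of fst] fiber_deriv_coord[OF \<rho> dM(1) y(1) F, of p]
        fiber_deriv_coord[OF \<rho> eM(1) y'(1) F, of p'] by (simp add: y(2) y'(2))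
    then obtain p2 where p2: "b = cvec_at d y p2"
      using cotangent_cases[OF ab(2), of d] d y(2) by (metis fst_cvec)
    have ch: "d \<in> charts_at M (chart_inv d y)" by (rule chart_inv_charts_at[OF dM(1) y(1)])
    have "sharp_coord \<rho> d y p = sharp_coord \<rho> d y p2"
      using ab(3) tvec_eq_iff[OF ch]
        fiber_deriv_coord[OF \<rho> dM(1) y(1) F, of p] fiber_deriv_coord[OF \<rho> dM(1) y(1) F, of p2]
      by (simp add: y(2) p2)
    then have "p = p2" using flat_sharp[OF \<rho> dM(1) y(1)] by metis
    then show "a = b" by (simp add: y(2) p2)
  qed
  have "tvec_at c x v = fiber_deriv M F (cvec_at c x (flat_coord \<rho> c x v))"
    by (simp add: fiber_deriv_coord[OF \<rho> c x F] sharp_flat[OF \<rho> c x])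
  then show ?thesis
    unfolding fiber_deriv_inv_def using inv_into_f_f[OF i] cvec_in_CT[OF c x] by metis
qed

end

section \<open>Horizontal curves\<close>

locale connected_atlas = atlas M for M :: "('m, 'e::euclidean_space) chart set" +
  fixes \<Gamma> :: "('m, 'e) christoffel"
  assumes conn: "connection M \<Gamma>" and torsion: "torsion_free M \<Gamma>"
begin

lemma christoffel_linear:
  assumes "c \<in> M" "x \<in> img c"
  shows "linear (\<Gamma> c x v)" "linear (\<lambda>v. \<Gamma> c x v w)"
  using conn assms unfolding connection_def bilinear_def by blast+

lemma christoffel_sym: "c \<in> M \<Longrightarrow> x \<in> img c \<Longrightarrow> \<Gamma> c x v w = \<Gamma> c x w v"
  using torsion unfolding torsion_free_def by blast

lemma christoffel_smooth:
  assumes "c \<in> M" "open S" "smooth_on S y" "\<And>s. s \<in> S \<Longrightarrow> y s \<in> img c"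
    and "smooth_on S f" "smooth_on S g"
  shows "smooth_on S (\<lambda>s. \<Gamma> c (y s) (f s) (g s))"
proof (rule smooth_on_linear_family[where L = "\<lambda>s. \<Gamma> c (y s) (f s)", OF assms(2) _ _ assms(6)])
  show "linear (\<Gamma> c (y s) (f s))" if "s \<in> S" for s
    by (rule christoffel_linear[OF assms(1) assms(4)[OF that]])
  show "smooth_on S (\<lambda>s. \<Gamma> c (y s) (f s) b)" for b
  proof (rule smooth_on_linear_family[where L = "\<lambda>s v. \<Gamma> c (y s) v b", OF assms(2) _ _ assms(5)])
    show "linear (\<lambda>v. \<Gamma> c (y s) v b)" if "s \<in> S" for s
      by (rule christoffel_linear[OF assms(1) assms(4)[OF that]])
    have "smooth_on (img c) (\<lambda>x. \<Gamma> c x b' b)" for b'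
      using conn assms(1) unfolding connection_def by blast
    then show "smooth_on S (\<lambda>s. \<Gamma> c (y s) b' b)" for b'
      by (rule smooth_on_compose[OF assms(2) open_img[OF assms(1)] assms(3) _ assms(4)])
  qed
qed

lemma christoffel_change:
  assumes "c \<in> M" "d \<in> M" "x \<in> snd c ` (fst c \<inter> fst d)"
  shows "\<Gamma> d (transition c d x) (jac c d (chart_inv c x) v) (jac c d (chart_inv c x) w) =
    jac c d (chart_inv c x) (\<Gamma> c x v w) -
    frechet_derivative (\<lambda>z. jac c d (chart_inv c z) w) (at x) v"
proof -
  have j: "frechet_derivative (transition c d) (at z) = jac c d (chart_inv c z)"
    if "z \<in> snd c ` (fst c \<inter> fst d)" for z
    unfolding jac_def using that assms(1) by (auto simp: chart_inv_chart)
  have "frechet_derivative (\<lambda>z. frechet_derivative (transition c d) (at z) w) (at x) =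
      frechet_derivative (\<lambda>z. jac c d (chart_inv c z) w) (at x)"
    by (rule frechet_derivative_cong_open[OF open_overlap[OF assms(1,2)] assms(3)]) (simp add: j)
  moreover have "\<Gamma> d (transition c d x) (frechet_derivative (transition c d) (at x) v)
        (frechet_derivative (transition c d) (at x) w) =
      frechet_derivative (transition c d) (at x) (\<Gamma> c x v w) -
      frechet_derivative (\<lambda>z. frechet_derivative (transition c d) (at z) w) (at x) v"
    using conn assms unfolding connection_def Let_def by blast
  ultimately show ?thesis by (simp add: j[OF assms(3)])
qed

lemma smooth_map_curveI:
  assumes S: "open S" and c: "c \<in> M" and X: "smooth_on S X" "\<And>s. s \<in> S \<Longrightarrow> X s \<in> img c"
    and p: "smooth_on S p"
  shows "smooth_map (euclidean_atlas S) (cotangent_atlas M) (\<lambda>s. cvec_at c (X s) (p s))"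
    (is "smooth_map _ _ ?u")
  unfolding smooth_map_def points_cotangent_atlas
proof (intro conjI ballI)
  have CT: "?u s \<in> CT" if "s \<in> S" for s by (rule cvec_in_CT[OF c X(2)[OF that]])
  then show "?u ` points (euclidean_atlas S) \<subseteq> CT" by (auto simp: points_def euclidean_atlas_def)
  fix C D assume "C \<in> euclidean_atlas S" "D \<in> cotangent_atlas M"
  then obtain d where d: "d \<in> M" "D = bundle_chart CT d" and C: "C = (S, \<lambda>x. x)"
    by (auto simp: cotangent_atlas_def euclidean_atlas_def)
  let ?N = "{s \<in> S. X s \<in> snd c ` (fst c \<inter> fst d)}"
  have oN: "open ?N" by (rule smooth_on_open_vimage[OF X(1) S open_overlap[OF c d(1)]])
  have N: "snd C ` {m \<in> fst C. ?u m \<in> fst D} = ?N"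
    using CT X(2) overlap_iff[OF c, of _ d] by (auto simp: C d(2) fst_bundle_chart chart_inv_chart[OF c])
  show "open (snd C ` {m \<in> fst C. ?u m \<in> fst D})" unfolding N by (rule oN)
  have sX: "smooth_on ?N X" and sp: "smooth_on ?N p"
    using smooth_on_subset[OF X(1)] smooth_on_subset[OF p] by auto
  have "smooth_on ?N (\<lambda>s. (transition c d (X s), adjoint (jac d c (chart_inv c (X s))) (p s)))"
    by (intro smooth_on_Pair oN smooth_adjoint_jac c d sX sp
        smooth_on_compose[OF oN open_overlap[OF c d(1)] sX smooth_transition[OF c d(1)]]) auto
  moreover have "(snd D \<circ> ?u \<circ> chart_inv C) s = (transition c d (X s), adjoint (jac d c (chart_inv c (X s))) (p s))"
    if s: "s \<in> ?N" for s
  proof -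
    have "chart_inv C s = s"
      unfolding chart_inv_def C using s by (simp add: inv_into_f_f[where f = "\<lambda>x. x", simplified inj_on_def])
    then show ?thesis
      using overlap_charts[OF c d(1)] s by (simp add: d(2) snd_bundle_chart snd_cvec transition_def)
  qed
  ultimately show "smooth_on (snd C ` {m \<in> fst C. ?u m \<in> fst D}) (snd D \<circ> ?u \<circ> chart_inv C)"
    unfolding N by (rule smooth_on_eq[OF oN])
qed

lemma curve_in_chart:
  assumes u: "smooth_map (euclidean_atlas S) (cotangent_atlas M) u" and s: "s \<in> S" "open S"
    and c: "c \<in> charts_at M (fst (u s))"
  shows "\<exists>N. open N \<and> s \<in> N \<and> N \<subseteq> S \<and> (\<forall>t\<in>N. u t \<in> CT \<and> fst (u t) \<in> fst c) \<and>
    smooth_on N (\<lambda>t. snd c (fst (u t))) \<and> smooth_on N (\<lambda>t. snd (u t) c)"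
proof -
  let ?C = "(S, \<lambda>x. x)" and ?D = "bundle_chart CT c"
  let ?N = "{t \<in> S. u t \<in> fst ?D}"
  have M: "?C \<in> euclidean_atlas S" "?D \<in> cotangent_atlas M"
    using charts_atD[OF c] by (auto simp: euclidean_atlas_def cotangent_atlas_def)
  have us: "u s \<in> CT"
    using u s unfolding smooth_map_def points_cotangent_atlas by (auto simp: points_def euclidean_atlas_def)
  have "\<forall>C\<in>euclidean_atlas S. \<forall>D\<in>cotangent_atlas M. open (snd C ` {m \<in> fst C. u m \<in> fst D}) \<and>
      smooth_on (snd C ` {m \<in> fst C. u m \<in> fst D}) (snd D \<circ> u \<circ> chart_inv C)"
    using u unfolding smooth_map_def by blast
  from this[THEN bspec, OF M(1), THEN bspec, OF M(2)]
  have oN: "open ?N" and sm: "smooth_on ?N (snd ?D \<circ> u \<circ> chart_inv ?C)" by simp_all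
  have inv: "chart_inv ?C t = t" if "t \<in> S" for t
    unfolding chart_inv_def using that by (simp add: inv_into_f_f[where f = "\<lambda>x. x", simplified inj_on_def])
  have sN: "smooth_on ?N (\<lambda>t. (snd c (fst (u t)), snd (u t) c))"
    by (rule smooth_on_eq[OF oN sm]) (simp add: inv snd_bundle_chart)
  show ?thesis
  proof (intro exI[of _ ?N] conjI)
    show "s \<in> ?N" using s us charts_atD[OF c] by (simp add: fst_bundle_chart)
    show "smooth_on ?N (\<lambda>t. snd c (fst (u t)))" using smooth_on_fst[OF oN sN] by simp
    show "smooth_on ?N (\<lambda>t. snd (u t) c)" using smooth_on_snd[OF oN sN] by simp
  qed (use oN in \<open>auto simp: fst_bundle_chart\<close>)
qed

text \<open>
  A horizontal curve satisfies its equation in every chart, so a solution constructed in one chart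
  has to be transported to the others; this is what the transformation rule of the Christoffel
  symbols is for.
\<close>

lemma parallel_change_chart:
  assumes c: "c \<in> M" and d: "d \<in> M" and S: "open S" "s \<in> S"
    and X: "\<And>t. t \<in> S \<Longrightarrow> X t \<in> img c" "smooth_on S X" "(X has_vector_derivative v) (at s)"
    and p: "smooth_on S p" "(p has_vector_derivative p') (at s)"
    and par: "\<And>w. p' \<bullet> w = p s \<bullet> \<Gamma> c (X s) v w"
    and Xs: "X s \<in> snd c ` (fst c \<inter> fst d)"
  shows "((\<lambda>t. snd d (chart_inv c (X t))) has_vector_derivative jac c d (chart_inv c (X s)) v) (at s)"
    and "vector_derivative (\<lambda>t. snd (cvec_at c (X t) (p t)) d) (at s) \<bullet> w =
      snd (cvec_at c (X s) (p s)) d \<bullet>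
        \<Gamma> d (snd d (chart_inv c (X s))) (jac c d (chart_inv c (X s)) v) w"
proof -
  let ?q = "chart_inv c (X s)" and ?P = "\<lambda>t. snd (cvec_at c (X t) (p t)) d"
  let ?J = "jac c d (chart_inv c (X s))"
  let ?N = "{t \<in> S. X t \<in> snd c ` (fst c \<inter> fst d)}"
  have oN: "open ?N" by (rule smooth_on_open_vimage[OF X(2) S(1) open_overlap[OF c d]])
  have sN: "s \<in> ?N" using S Xs by simp
  have Xq: "X s = snd c ?q" using Xs chart_chart_inv[of "X s" c] by auto
  note ch = overlap_charts[OF c d Xs]
  have Xd: "(X has_derivative (\<lambda>h. h *\<^sub>R v)) (at s)"
    using X(3) by (simp add: has_vector_derivative_def)
  have "((\<lambda>t. transition c d (X t)) has_derivative (\<lambda>h. ?J (h *\<^sub>R v))) (at s)"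
    by (rule has_derivative_compose[OF Xd]) (use transition_has_derivative[OF ch] Xq in simp)
  then show "((\<lambda>t. snd d (chart_inv c (X t))) has_vector_derivative ?J v) (at s)"
    by (simp add: has_vector_derivative_def transition_def linear_cmul[OF jac_linear[OF ch]])
  have sX: "smooth_on ?N X" and sp: "smooth_on ?N p"
    using smooth_on_subset[OF X(2)] smooth_on_subset[OF p(1)] by auto
  have "smooth_on ?N (\<lambda>t. adjoint (jac d c (chart_inv c (X t))) (p t))"
    by (intro smooth_adjoint_jac c d oN sX sp) auto
  then have "smooth_on ?N ?P"
    by (rule smooth_on_eq[OF oN]) (use overlap_charts[OF c d] in \<open>auto simp: snd_cvec\<close>)
  from smooth_on_has_derivative[OF this sN] obtain D where D: "(?P has_derivative D) (at s)" by blast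
  define P' where "P' = D 1"
  have "D = (\<lambda>h. h *\<^sub>R P')"
  proof
    show "D h = h *\<^sub>R P'" for h
      using linear_cmul[OF has_derivative_linear[OF D], of h 1] by (simp add: P'_def)
  qed
  then have P: "(?P has_vector_derivative P') (at s)"
    using D by (simp add: has_vector_derivative_def)
  \<comment> \<open>The pairing of \<open>?P t\<close> with the moving vector
    \<open>jac c d (chart_inv c (X t)) w\<close> equals \<open>p t \<bullet> w\<close>.
    Differentiating both sides leaves the second derivative term \<open>?L v\<close>, which is the
    inhomogeneous term in the rule for the Christoffel symbols.\<close>
  have key: "P' \<bullet> ?J w = ?P s \<bullet> \<Gamma> d (snd d ?q) (?J v) (?J w)" for w
  proof -
    let ?L = "frechet_derivative (\<lambda>z. jac c d (chart_inv c z) w) (at (X s))"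
    have L: "((\<lambda>z. jac c d (chart_inv c z) w) has_derivative ?L) (at (X s))"
      by (rule smooth_on_has_derivative[OF smooth_jac[OF c d] Xs])
    have J: "((\<lambda>t. jac c d (chart_inv c (X t)) w) has_derivative (\<lambda>h. ?L (h *\<^sub>R v))) (at s)"
      by (rule has_derivative_compose[OF Xd L])
    have 1: "((\<lambda>t. ?P t \<bullet> jac c d (chart_inv c (X t)) w) has_derivative
        (\<lambda>h. ?P s \<bullet> ?L (h *\<^sub>R v) + (h *\<^sub>R P') \<bullet> ?J w)) (at s)"
      using has_derivative_inner[OF P[unfolded has_vector_derivative_def] J] by simp
    have 2: "((\<lambda>t. p t \<bullet> w) has_derivative (\<lambda>h. (h *\<^sub>R p') \<bullet> w)) (at s)"
      using has_derivative_inner_left[OF p(2)[unfolded has_vector_derivative_def]] by simp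
    have "((\<lambda>t. p t \<bullet> w) has_derivative
        (\<lambda>h. ?P s \<bullet> ?L (h *\<^sub>R v) + (h *\<^sub>R P') \<bullet> ?J w)) (at s)"
    proof (rule has_derivative_transform_within_open[OF 1 oN sN])
      fix t assume "t \<in> ?N"
      then have "X t \<in> snd c ` (fst c \<inter> fst d)" by simp
      from overlap_charts[OF c d this]
      show "?P t \<bullet> jac c d (chart_inv c (X t)) w = p t \<bullet> w"
        by (simp add: snd_cvec_inner jac_inverse)
    qed
    from has_derivative_unique[OF 2 this]
    have "(1 *\<^sub>R p') \<bullet> w = ?P s \<bullet> ?L (1 *\<^sub>R v) + (1 *\<^sub>R P') \<bullet> ?J w" by metis
    then have "P' \<bullet> ?J w = p s \<bullet> \<Gamma> c (X s) v w - ?P s \<bullet> ?L v" by (simp add: par)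
    also have "p s \<bullet> \<Gamma> c (X s) v w = ?P s \<bullet> ?J (\<Gamma> c (X s) v w)"
      using ch by (simp add: snd_cvec_inner jac_inverse)
    also have "\<dots> - ?P s \<bullet> ?L v = ?P s \<bullet> \<Gamma> d (transition c d (X s)) (?J v) (?J w)"
      using christoffel_change[OF c d Xs, of v w] by (simp add: inner_diff_right)
    finally show ?thesis by (simp add: transition_def)
  qed
  \<comment> \<open>\<open>key\<close> speaks of vectors of the form \<open>?J w\<close>; since the
    Jacobian is invertible, these are all vectors.\<close>
  show "vector_derivative ?P (at s) \<bullet> w = ?P s \<bullet> \<Gamma> d (snd d ?q) (?J v) w"
    using key[of "jac d c ?q w"] ch vector_derivative_at[OF P] by (simp add: jac_inverse)
qed

text \<open>The base curve is a straight line in the chart, and the covector solves a linear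
  equation along it. The order of quantifiers matters: one \<epsilon> and one base curve serve all
  initial covectors.\<close>

lemma horizontal_curve_exists:
  assumes c: "c \<in> charts_at M q"
  shows "\<exists>\<epsilon>>0. \<forall>p0. \<exists>u. horizontal_curve M \<Gamma> \<epsilon> u \<and> u 0 = cvec c q p0 \<and>
    (\<forall>s\<in>{-\<epsilon><..<\<epsilon>}. fst (u s) = chart_inv c (snd c q + s *\<^sub>R v)) \<and> velocity M (fst \<circ> u) 0 = tvec c q v"
proof -
  note cM = charts_atD[OF c]
  let ?X = "\<lambda>s. snd c q + s *\<^sub>R v"
  have X0: "snd c q \<in> img c" using cM by simp
  have sX: "smooth_on S ?X" if "open S" for S :: "real set"
    by (intro smooth_on_add smooth_on_const that
        smooth_on_linear[OF that bounded_linear_scaleR_left smooth_on_id])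
  have X': "(?X has_vector_derivative v) (at s)" for s
    by (auto intro!: derivative_eq_intros)
  have "open {s \<in> UNIV. ?X s \<in> img c}"
    by (rule smooth_on_open_vimage[OF sX open_UNIV open_img[OF cM(1)]]) simp
  moreover have "0 \<in> {s \<in> UNIV. ?X s \<in> img c}" using X0 by simp
  ultimately obtain r0 where r0: "r0 > 0" "ball 0 r0 \<subseteq> {s \<in> UNIV. ?X s \<in> img c}"
    using open_contains_ball by blast
  \<comment> \<open>Halving the radius keeps the closed interval, on which the coefficients have to
    be bounded, inside the ball.\<close>
  define r where "r = r0 / 2"
  have r: "r > 0" using r0 by (simp add: r_def)
  have Xin: "?X s \<in> img c" if "s \<in> {-r..r}" for s
  proof -
    have "s \<in> ball 0 r0" using that r0(1) by (auto simp: r_def dist_real_def)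
    then show ?thesis using r0(2) by blast
  qed
  \<comment> \<open>The transpose of \<open>\<lambda>w. \<Gamma> c (?X s) v w\<close>, as the
    parallel transport of covectors demands.\<close>
  define A where "A s p = (\<Sum>b\<in>Basis. (p \<bullet> \<Gamma> c (?X s) v b) *\<^sub>R b)" for s p
  have A: "A s p \<bullet> w = p \<bullet> \<Gamma> c (?X s) v w" if "s \<in> {-r..r}" for s p w
  proof -
    have "linear (\<lambda>w. p \<bullet> \<Gamma> c (?X s) v w)"
      using christoffel_linear(1)[OF cM(1) Xin[OF that], of v] by (simp add: linear_iff inner_add_right)
    then show ?thesis unfolding A_def by (rule linear_inner_representation)
  qed
  have Alin: "linear (A s)" for s
    by (rule linearI) (simp_all add: A_def inner_add_left scaleR_add_left sum.distrib scaleR_sum_right)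
  have r2: "ball 0 r0 \<subseteq> {s. ?X s \<in> img c}" using r0 by auto
  have Asm: "smooth_on (ball 0 r0) (\<lambda>s. A s b)" for b
    unfolding A_def
    by (intro smooth_on_sum smooth_on_scaleR smooth_on_inner smooth_on_const open_ball finite_Basis
        christoffel_smooth[OF cM(1)] sX) (use r2 in auto)
  have Acont: "continuous_on {-r..r} (\<lambda>s. A s b)" for b
    by (rule continuous_on_subset[OF smooth_on_continuous[OF Asm]])
      (use r0(1) in \<open>auto simp: r_def dist_real_def\<close>)
  obtain \<epsilon> where e: "\<epsilon> > 0" "\<epsilon> \<le> r"
    "\<forall>p0. \<exists>p. p 0 = p0 \<and> (\<forall>s\<in>{-\<epsilon><..<\<epsilon>}. (p has_vector_derivative A s (p s)) (at s))"
    using linear_ode[OF r Alin Acont] by blast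
  let ?S = "{-\<epsilon><..<\<epsilon>}"
  have Sr: "?S \<subseteq> {-r..r}" "?S \<subseteq> ball 0 r0" using e r0 by (auto simp: r_def dist_real_def)
  have XS: "?X s \<in> img c" if "s \<in> ?S" for s using Xin Sr that by blast
  have "\<exists>u. horizontal_curve M \<Gamma> \<epsilon> u \<and> u 0 = cvec c q p0 \<and>
    (\<forall>s\<in>?S. fst (u s) = chart_inv c (?X s)) \<and> velocity M (fst \<circ> u) 0 = tvec c q v" for p0
  proof -
    obtain p where p: "p 0 = p0" "\<And>s. s \<in> ?S \<Longrightarrow> (p has_vector_derivative A s (p s)) (at s)"
      using e(3) by blast
    have sp: "smooth_on ?S p"
      by (rule linear_ode_smooth[OF _ Alin smooth_on_subset[OF Asm Sr(2)] p(2)]) auto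
    define u where "u s = cvec_at c (?X s) (p s)" for s
    have ov: "?X s \<in> snd c ` (fst c \<inter> fst d)" if "s \<in> ?S" "d \<in> charts_at M (fst (u s))" for s d
      using overlap_iff[OF cM(1), of "?X s" d] XS[OF that(1)] that(2) by (simp add: u_def charts_at_def)
    have par: "((\<lambda>t. snd d (fst (u t))) has_vector_derivative jac c d (chart_inv c (?X s)) v) (at s)"
      "vector_derivative (\<lambda>t. snd (u t) d) (at s) \<bullet> w =
        snd (u s) d \<bullet> \<Gamma> d (snd d (fst (u s))) (jac c d (chart_inv c (?X s)) v) w"
      if s: "s \<in> ?S" and d: "d \<in> charts_at M (fst (u s))" for s d w
      unfolding u_def fst_cvec
      using parallel_change_chart[OF cM(1) charts_atD(1)[OF d] open_greaterThanLessThan s XS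
          sX[OF open_greaterThanLessThan] X' sp p(2)[OF s] A ov[OF s d]] s Sr(1) by blast+
    have "horizontal_curve M \<Gamma> \<epsilon> u"
      unfolding horizontal_curve_def
    proof (intro conjI ballI allI)
      show "smooth_map (euclidean_atlas ?S) (cotangent_atlas M) u"
        using smooth_map_curveI[OF open_greaterThanLessThan cM(1) sX[OF open_greaterThanLessThan] XS sp]
        by (simp add: u_def[abs_def])
      fix s d w assume s: "s \<in> ?S" "d \<in> charts_at M (fst (u s))"
      show "vector_derivative (\<lambda>t. snd (u t) d) (at s) \<bullet> w =
        snd (u s) d \<bullet> \<Gamma> d (snd d (fst (u s))) (vector_derivative (\<lambda>t. snd d (fst (u t))) (at s)) w"
        using par(2)[OF s] vector_derivative_at[OF par(1)[OF s]] by simp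
    qed
    moreover have u0: "u 0 = cvec c q p0" using chart_inv_chart cM by (simp add: u_def p(1))
    moreover have "velocity M (fst \<circ> u) 0 = tvec c q v"
    proof -
      have "vector_derivative (snd d \<circ> (fst \<circ> u)) (at 0) = jac c d q v" if "d \<in> charts_at M q" for d
        using vector_derivative_at[OF par(1)[of 0 d]] that u0 e(1) chart_inv_chart[OF cM]
        by (simp add: o_def)
      then show ?thesis by (auto simp: velocity_def tvec_def u0)
    qed
    ultimately show ?thesis by (auto simp: u_def)
  qed
  then show ?thesis using e(1) by blast
qed

end

section \<open>Base derivatives\<close>

lemma smooth_on_has_vector_derivative:
  assumes "smooth_on N f" "t \<in> N"
  shows "(f has_vector_derivative vector_derivative f (at t)) (at t)"
  using smooth_on_has_derivative[OF assms] vector_derivative_works differentiableI by blast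

context atlas
begin

definition dsharp :: "(('m, 'e) fvec \<Rightarrow> ('m, 'e) fvec \<Rightarrow> real) \<Rightarrow> ('m, 'e) chart \<Rightarrow> 'e \<Rightarrow> 'e \<Rightarrow> 'e \<Rightarrow> 'e"
  where "dsharp \<rho> c x v p = frechet_derivative (\<lambda>x. sharp_coord \<rho> c x p) (at x) v"

lemma smooth_sharp:
  assumes "riemannian_metric M \<rho>" "c \<in> M" "open S" "smooth_on S y"
    and y: "\<And>s. s \<in> S \<Longrightarrow> y s \<in> img c" and f: "smooth_on S f"
  shows "smooth_on S (\<lambda>s. sharp_coord \<rho> c (y s) (f s))"
proof (rule smooth_on_linear_family[where L = "\<lambda>s. sharp_coord \<rho> c (y s)", OF assms(3) _ _ f])
  show "linear (sharp_coord \<rho> c (y s))" if "s \<in> S" for s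
    by (rule linear_sharp_coord[OF assms(1,2) y[OF that]])
  show "smooth_on S (\<lambda>s. sharp_coord \<rho> c (y s) b)" for b
    by (rule smooth_on_compose[OF assms(3) open_img[OF assms(2)] assms(4) sharp_coord(3)[OF assms(1,2)] y])
qed

context
  fixes \<rho> c
  assumes \<rho>: "riemannian_metric M \<rho>" and c: "c \<in> M"
begin

lemma sharp_has_derivative:
  "x \<in> img c \<Longrightarrow> ((\<lambda>x. sharp_coord \<rho> c x p) has_derivative (\<lambda>v. dsharp \<rho> c x v p)) (at x)"
  unfolding dsharp_def by (rule smooth_on_has_derivative[OF sharp_coord(3)[OF \<rho> c]])

text \<open>Linearity in \<open>p\<close> is inherited from \<open>sharp_coord\<close> because the
  derivative with respect to the base point is unique.\<close>

lemma dsharp_linear: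
  assumes x: "x \<in> img c"
  shows "linear (\<lambda>v. dsharp \<rho> c x v p)" "linear (dsharp \<rho> c x v)"
proof -
  show "linear (\<lambda>v. dsharp \<rho> c x v p)" for p
    using sharp_has_derivative[OF x] has_derivative_linear by blast
  have u: "dsharp \<rho> c x v p = D v"
    if "((\<lambda>x. sharp_coord \<rho> c x p) has_derivative D) (at x)" for p D v
    using has_derivative_unique[OF sharp_has_derivative[OF x] that] by metis
  show "linear (dsharp \<rho> c x v)"
  proof (rule linearI)
    fix p r s
    have "((\<lambda>x. sharp_coord \<rho> c x (p + r)) has_derivative (\<lambda>v. dsharp \<rho> c x v p + dsharp \<rho> c x v r)) (at x)"
      by (rule has_derivative_transform_within_open[OF
            has_derivative_add[OF sharp_has_derivative[OF x] sharp_has_derivative[OF x]] open_img[OF c] x])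
        (simp add: linear_add[OF linear_sharp_coord[OF \<rho> c]])
    then show "dsharp \<rho> c x v (p + r) = dsharp \<rho> c x v p + dsharp \<rho> c x v r" by (rule u)
    have "((\<lambda>x. sharp_coord \<rho> c x (s *\<^sub>R p)) has_derivative (\<lambda>v. s *\<^sub>R dsharp \<rho> c x v p)) (at x)"
      by (rule has_derivative_transform_within_open[OF
            has_derivative_scaleR_right[OF sharp_has_derivative[OF x]] open_img[OF c] x])
        (simp add: linear_cmul[OF linear_sharp_coord[OF \<rho> c]])
    then show "dsharp \<rho> c x v (s *\<^sub>R p) = s *\<^sub>R dsharp \<rho> c x v p" by (rule u)
  qed
qed

lemma dsharp_sym:
  assumes x: "x \<in> img c"
  shows "p \<bullet> dsharp \<rho> c x v r = r \<bullet> dsharp \<rho> c x v p"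
proof -
  have 1: "((\<lambda>x. p \<bullet> sharp_coord \<rho> c x r) has_derivative (\<lambda>v. p \<bullet> dsharp \<rho> c x v r)) (at x)" for p r
    by (rule has_derivative_inner_right[OF sharp_has_derivative[OF x]])
  have "((\<lambda>x. p \<bullet> sharp_coord \<rho> c x r) has_derivative (\<lambda>v. r \<bullet> dsharp \<rho> c x v p)) (at x)"
    by (rule has_derivative_transform_within_open[OF 1 open_img[OF c] x]) (rule sharp_coord_sym[OF \<rho> c])
  from has_derivative_unique[OF 1 this] show ?thesis by metis
qed

lemma smooth_dsharp:
  assumes S: "open S" "smooth_on S y" and y: "\<And>s. s \<in> S \<Longrightarrow> y s \<in> img c"
    and f: "smooth_on S f" and g: "smooth_on S g"
  shows "smooth_on S (\<lambda>s. dsharp \<rho> c (y s) (f s) (g s))"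
proof (rule smooth_on_linear_family[where L = "\<lambda>s. dsharp \<rho> c (y s) (f s)", OF S(1) _ _ g])
  show "linear (dsharp \<rho> c (y s) (f s))" if "s \<in> S" for s
    by (rule dsharp_linear(2)[OF y[OF that]])
  show "smooth_on S (\<lambda>s. dsharp \<rho> c (y s) (f s) b)" for b
  proof (rule smooth_on_linear_family[where L = "\<lambda>s v. dsharp \<rho> c (y s) v b", OF S(1) _ _ f])
    show "linear (\<lambda>v. dsharp \<rho> c (y s) v b)" if "s \<in> S" for s
      by (rule dsharp_linear(1)[OF y[OF that]])
    have "smooth_on (img c) (\<lambda>x. dsharp \<rho> c x b' b)" for b'
      unfolding dsharp_def by (rule smooth_on_frechet[OF sharp_coord(3)[OF \<rho> c]])
    then show "smooth_on S (\<lambda>s. dsharp \<rho> c (y s) b' b)" for b'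
      by (rule smooth_on_compose[OF S(1) open_img[OF c] S(2) _ y])
  qed
qed

end

end

context connected_atlas
begin

text \<open>
  Half the derivative of \<open>p \<bullet> sharp_coord \<rho> c x r\<close> along a horizontal curve of velocity \<open>v\<close>: the
  first two terms come from the parallel transport of \<open>p\<close> and \<open>r\<close>, the last one from the metric.
\<close>

definition bform :: "(('m, 'e) fvec \<Rightarrow> ('m, 'e) fvec \<Rightarrow> real) \<Rightarrow> ('m, 'e) chart \<Rightarrow> 'e \<Rightarrow> 'e \<Rightarrow> 'e \<Rightarrow> 'e \<Rightarrow> real"
  where "bform \<rho> c x p r v = 1/2 * (p \<bullet> \<Gamma> c x v (sharp_coord \<rho> c x r) +
    r \<bullet> \<Gamma> c x v (sharp_coord \<rho> c x p) + p \<bullet> dsharp \<rho> c x v r)"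

text \<open>The coordinate of the base derivative of \<open>half_form\<close>, obtained as
  representative of the linear form \<open>bform \<rho> c x p r\<close>.\<close>

definition bcov :: "(('m, 'e) fvec \<Rightarrow> ('m, 'e) fvec \<Rightarrow> real) \<Rightarrow> ('m, 'e) chart \<Rightarrow> 'e \<Rightarrow> 'e \<Rightarrow> 'e \<Rightarrow> 'e"
  where "bcov \<rho> c x p r = (\<Sum>b\<in>Basis. bform \<rho> c x p r b *\<^sub>R b)"

context
  fixes \<rho> c
  assumes \<rho>: "riemannian_metric M \<rho>" and c: "c \<in> M"
begin

lemma bform_linear:
  assumes x: "x \<in> img c"
  shows "linear (bform \<rho> c x p r)" "linear (\<lambda>p. bform \<rho> c x p r v)" "linear (\<lambda>r. bform \<rho> c x p r v)"
    and "bform \<rho> c x p r v = bform \<rho> c x r p v"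
proof -
  note lin = christoffel_linear[OF c x] dsharp_linear[OF \<rho> c x] linear_sharp_coord[OF \<rho> c x]
  note simps = lin[THEN linear_add] lin[THEN linear_cmul]
  show "linear (bform \<rho> c x p r)" "linear (\<lambda>p. bform \<rho> c x p r v)" "linear (\<lambda>r. bform \<rho> c x p r v)"
    by (rule linearI; simp add: bform_def simps inner_add_left inner_add_right algebra_simps)+
  show "bform \<rho> c x p r v = bform \<rho> c x r p v"
    using dsharp_sym[OF \<rho> c x, of p v r] by (simp add: bform_def)
qed

lemma bcov_inner: "x \<in> img c \<Longrightarrow> bcov \<rho> c x p r \<bullet> v = bform \<rho> c x p r v"
  unfolding bcov_def by (rule linear_inner_representation[OF bform_linear(1)])

lemma smooth_bform:
  assumes S: "open S" "smooth_on S y" and y: "\<And>s. s \<in> S \<Longrightarrow> y s \<in> img c"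
    and f: "smooth_on S f" and g: "smooth_on S g" and h: "smooth_on S h"
  shows "smooth_on S (\<lambda>s. bform \<rho> c (y s) (f s) (g s) (h s))"
  unfolding bform_def
  by (intro smooth_on_mult smooth_on_const smooth_on_add smooth_on_inner S f g h christoffel_smooth c y
      smooth_sharp smooth_dsharp \<rho>)

text \<open>The Leibniz rule for three moving factors, two covectors and the inverse metric between
  them. Horizontality turns the derivatives of the covectors into Christoffel terms.\<close>

lemma half_form_horizontal_derivative:
  assumes x: "x \<in> img c" and \<epsilon>: "\<epsilon> > 0"
    and u: "horizontal_curve M \<Gamma> \<epsilon> u1" "horizontal_curve M \<Gamma> \<epsilon> u2"
    and base: "\<forall>s\<in>{-\<epsilon><..<\<epsilon>}. fst (u1 s) = fst (u2 s)"
    and u0: "u1 0 = cvec_at c x p1" "u2 0 = cvec_at c x p2"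
    and v: "velocity M (fst \<circ> u1) 0 = tvec_at c x v"
  shows "((\<lambda>s. half_form M \<rho> (u1 s) (u2 s)) has_real_derivative bform \<rho> c x p1 p2 v) (at 0)"
proof -
  let ?S = "{-\<epsilon><..<\<epsilon>}"
  have S0: "0 \<in> ?S" "open ?S" using \<epsilon> by auto
  have ch: "c \<in> charts_at M (chart_inv c x)" by (rule chart_inv_charts_at[OF c x])
  have ch': "c \<in> charts_at M (fst (u1 0))" "c \<in> charts_at M (fst (u2 0))" using ch u0 by simp_all
  have sm: "smooth_map (euclidean_atlas ?S) (cotangent_atlas M) u1" "smooth_map (euclidean_atlas ?S) (cotangent_atlas M) u2"
    using u unfolding horizontal_curve_def by blast+
  obtain N1 where N1: "open N1" "0 \<in> N1" "N1 \<subseteq> ?S" "\<forall>t\<in>N1. u1 t \<in> CT \<and> fst (u1 t) \<in> fst c"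
    "smooth_on N1 (\<lambda>t. snd c (fst (u1 t)))" "smooth_on N1 (\<lambda>t. snd (u1 t) c)"
    using curve_in_chart[OF sm(1) S0, of c] ch'(1) by blast
  obtain N2 where N2: "open N2" "0 \<in> N2" "N2 \<subseteq> ?S" "\<forall>t\<in>N2. u2 t \<in> CT \<and> fst (u2 t) \<in> fst c"
    "smooth_on N2 (\<lambda>t. snd c (fst (u2 t)))" "smooth_on N2 (\<lambda>t. snd (u2 t) c)"
    using curve_in_chart[OF sm(2) S0, of c] ch'(2) by blast
  let ?X = "\<lambda>t. snd c (fst (u1 t))" and ?P1 = "\<lambda>t. snd (u1 t) c" and ?P2 = "\<lambda>t. snd (u2 t) c"
  have X0: "?X 0 = x" "?P1 0 = p1" "?P2 0 = p2" using u0 ch chart_chart_inv[OF x] by simp_all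
  have "vector_derivative (snd c \<circ> (fst \<circ> u1)) (at 0) = v"
    using arg_cong[OF v, of "\<lambda>a. snd a c"] ch u0 by (simp add: velocity_def)
  then have X: "(?X has_vector_derivative v) (at 0)"
    using smooth_on_has_vector_derivative[OF N1(5,2)] by (simp add: o_def)
  \<comment> \<open>The velocity is given for \<open>u1\<close> only; the common base curve passes
    it on to \<open>u2\<close>.\<close>
  have X2: "vector_derivative (\<lambda>t. snd c (fst (u2 t))) (at 0) = v"
  proof (rule vector_derivative_at)
    show "((\<lambda>t. snd c (fst (u2 t))) has_vector_derivative v) (at 0)"
      by (rule has_vector_derivative_transform_within_open[OF X S0(2,1)]) (use base in simp)
  qed
  define P1' where "P1' = vector_derivative ?P1 (at 0)"
  define P2' where "P2' = vector_derivative ?P2 (at 0)"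
  have P: "(?P1 has_vector_derivative P1') (at 0)" "(?P2 has_vector_derivative P2') (at 0)"
    unfolding P1'_def P2'_def
    by (rule smooth_on_has_vector_derivative[OF N1(6,2)] smooth_on_has_vector_derivative[OF N2(6,2)])+
  have P1': "P1' \<bullet> w = p1 \<bullet> \<Gamma> c x v w" for w
    using u(1) S0(1) ch'(1) X0 vector_derivative_at[OF X] unfolding horizontal_curve_def P1'_def by metis
  have P2': "P2' \<bullet> w = p2 \<bullet> \<Gamma> c x v w" for w
    using u(2) S0(1) ch'(2) X0 X2 base unfolding horizontal_curve_def P2'_def by metis
  let ?S' = "sharp_coord \<rho> c"
  have Sb: "((\<lambda>t. ?S' (?X t) b) has_vector_derivative dsharp \<rho> c x v b) (at 0)" for b
  proof -
    have "((\<lambda>t. ?S' (?X t) b) has_derivative (\<lambda>h. dsharp \<rho> c x (h *\<^sub>R v) b)) (at 0)"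
      by (rule has_derivative_compose[OF X[unfolded has_vector_derivative_def]])
        (simp add: X0 sharp_has_derivative[OF \<rho> c x])
    then show ?thesis
      by (simp add: has_vector_derivative_def linear_cmul[OF dsharp_linear(1)[OF \<rho> c x]])
  qed
  \<comment> \<open>Expanding \<open>?P2 t\<close> in the basis separates the motion of the inverse
    metric from that of its argument, so that the product rule applies.\<close>
  have "((\<lambda>t. \<Sum>b\<in>Basis. (?P2 t \<bullet> b) *\<^sub>R ?S' (?X t) b) has_vector_derivative
      (\<Sum>b\<in>Basis. (?P2 0 \<bullet> b) *\<^sub>R dsharp \<rho> c x v b + (P2' \<bullet> b) *\<^sub>R ?S' (?X 0) b)) (at 0)"
    by (intro has_vector_derivative_sum has_vector_derivative_scaleR Sb)
      (rule bounded_linear.has_vector_derivative[OF bounded_linear_inner_left P(2),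
          unfolded has_real_derivative_iff_has_vector_derivative[symmetric]])
  also have "(\<Sum>b\<in>Basis. (?P2 0 \<bullet> b) *\<^sub>R dsharp \<rho> c x v b + (P2' \<bullet> b) *\<^sub>R ?S' (?X 0) b) =
      dsharp \<rho> c x v p2 + ?S' x P2'"
    unfolding sum.distrib X0
    by (simp add: linear_basis_sum[OF dsharp_linear(2)[OF \<rho> c x], of v p2, symmetric]
        linear_basis_sum[OF linear_sharp_coord[OF \<rho> c x], of P2', symmetric])
  finally have D: "((\<lambda>t. \<Sum>b\<in>Basis. (?P2 t \<bullet> b) *\<^sub>R ?S' (?X t) b) has_vector_derivative
      dsharp \<rho> c x v p2 + ?S' x P2') (at 0)" .
  have "((\<lambda>t. 1/2 * (?P1 t \<bullet> (\<Sum>b\<in>Basis. (?P2 t \<bullet> b) *\<^sub>R ?S' (?X t) b))) has_derivative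
      (\<lambda>h. 1/2 * (?P1 0 \<bullet> (h *\<^sub>R (dsharp \<rho> c x v p2 + ?S' x P2')) +
        (h *\<^sub>R P1') \<bullet> (\<Sum>b\<in>Basis. (?P2 0 \<bullet> b) *\<^sub>R ?S' (?X 0) b)))) (at 0)"
    by (intro has_derivative_mult_right has_derivative_inner
        P(1)[unfolded has_vector_derivative_def] D[unfolded has_vector_derivative_def])
  \<comment> \<open>Symmetry moves the sharp map from \<open>P2'\<close> to \<open>p1\<close>; only
    then can the horizontality of \<open>u2\<close> be used.\<close>
  moreover have "1/2 * (?P1 0 \<bullet> (h *\<^sub>R (dsharp \<rho> c x v p2 + ?S' x P2')) +
        (h *\<^sub>R P1') \<bullet> (\<Sum>b\<in>Basis. (?P2 0 \<bullet> b) *\<^sub>R ?S' (?X 0) b)) = bform \<rho> c x p1 p2 v * h" for h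
    unfolding X0 linear_basis_sum[OF linear_sharp_coord[OF \<rho> c x], of p2, symmetric]
    using sharp_coord_sym[OF \<rho> c x, of p1 P2']
    by (simp add: bform_def P1' P2' inner_add_right algebra_simps)
  ultimately have "((\<lambda>t. 1/2 * (?P1 t \<bullet> (\<Sum>b\<in>Basis. (?P2 t \<bullet> b) *\<^sub>R ?S' (?X t) b)))
      has_real_derivative bform \<rho> c x p1 p2 v) (at 0)"
    by (simp add: has_field_derivative_def)
  then show ?thesis
  proof (rule has_field_derivative_transform_within_open[where S = "N1 \<inter> N2"])
    show "open (N1 \<inter> N2)" "0 \<in> N1 \<inter> N2" using N1 N2 by auto
    fix t assume t: "t \<in> N1 \<inter> N2"
    have b: "fst (u2 t) = fst (u1 t)" using base t N1(3) by auto
    have cht: "c \<in> charts_at M (fst (u1 t))" using N1(4) t c by (simp add: charts_at_def)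
    have xt: "?X t \<in> img c" and q: "chart_inv c (?X t) = fst (u1 t)"
      using charts_atD[OF cht] chart_inv_chart by auto
    have "u1 t = cvec_at c (?X t) (?P1 t)" "u2 t = cvec_at c (?X t) (?P2 t)"
      using cvec_eq[of "u1 t" c] cvec_eq[of "u2 t" c] cht N1(4) N2(4) t by (simp_all add: q b)
    then have "half_form M \<rho> (u1 t) (u2 t) = 1/2 * (?P1 t \<bullet> ?S' (?X t) (?P2 t))"
      using half_form_coord[OF \<rho> c xt] by metis
    then show "1/2 * (?P1 t \<bullet> (\<Sum>b\<in>Basis. (?P2 t \<bullet> b) *\<^sub>R ?S' (?X t) b)) = half_form M \<rho> (u1 t) (u2 t)"
      by (simp add: linear_basis_sum[OF linear_sharp_coord[OF \<rho> c xt], symmetric])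
  qed
qed

text \<open>That the covector qualifies is the Leibniz computation. Its uniqueness requires test
  curves: for every velocity there are horizontal curves with the two given initial covectors, over
  one base curve and on one interval.\<close>

lemma base_deriv2_coord:
  assumes x: "x \<in> img c"
  shows "base_deriv2 M \<Gamma> (half_form M \<rho>) (cvec_at c x p1) (cvec_at c x p2) =
    cvec_at c x (bcov \<rho> c x p1 p2)"
proof -
  let ?q = "chart_inv c x"
  have ch: "c \<in> charts_at M ?q" by (rule chart_inv_charts_at[OF c x])
  show ?thesis
    unfolding base_deriv2_def
  proof (rule the_equality)
    show "cvec c ?q (bcov \<rho> c x p1 p2) \<in> CT \<and> fst (cvec c ?q (bcov \<rho> c x p1 p2)) = fst (cvec c ?q p1) \<and>
      (\<forall>v\<in>tangent_bundle M. fst v = fst (cvec c ?q p1) \<longrightarrow>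
       (\<forall>\<epsilon>>0. \<forall>u1 u2. horizontal_curve M \<Gamma> \<epsilon> u1 \<and> horizontal_curve M \<Gamma> \<epsilon> u2 \<and>
          (\<forall>s\<in>{-\<epsilon><..<\<epsilon>}. fst (u1 s) = fst (u2 s)) \<and>
          u1 0 = cvec c ?q p1 \<and> u2 0 = cvec c ?q p2 \<and> velocity M (fst \<circ> u1) 0 = v \<longrightarrow>
          ((\<lambda>s. half_form M \<rho> (u1 s) (u2 s)) has_real_derivative
            pairing M (cvec c ?q (bcov \<rho> c x p1 p2)) v) (at 0)))"
    proof (intro conjI ballI allI impI)
      fix v and \<epsilon> :: real and u1 u2
      assume v: "v \<in> tangent_bundle M" "fst v = fst (cvec c ?q p1)" and e: "\<epsilon> > 0"
        and u: "horizontal_curve M \<Gamma> \<epsilon> u1 \<and> horizontal_curve M \<Gamma> \<epsilon> u2 \<and>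
          (\<forall>s\<in>{-\<epsilon><..<\<epsilon>}. fst (u1 s) = fst (u2 s)) \<and>
          u1 0 = cvec c ?q p1 \<and> u2 0 = cvec c ?q p2 \<and> velocity M (fst \<circ> u1) 0 = v"
      obtain w where w: "v = tvec c ?q w" using tangent_cases[OF v(1), of c] v(2) ch by (metis fst_cvec)
      have "((\<lambda>s. half_form M \<rho> (u1 s) (u2 s)) has_real_derivative bform \<rho> c x p1 p2 w) (at 0)"
        by (rule half_form_horizontal_derivative[OF x e]) (use u w in auto)
      then show "((\<lambda>s. half_form M \<rho> (u1 s) (u2 s)) has_real_derivative
            pairing M (cvec c ?q (bcov \<rho> c x p1 p2)) v) (at 0)"
        using ch by (simp add: w bcov_inner[OF x])
    qed (use ch in simp_all)
  next
    fix \<beta> assume \<beta>: "\<beta> \<in> CT \<and> fst \<beta> = fst (cvec c ?q p1) \<and>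
      (\<forall>v\<in>tangent_bundle M. fst v = fst (cvec c ?q p1) \<longrightarrow>
       (\<forall>\<epsilon>>0. \<forall>u1 u2. horizontal_curve M \<Gamma> \<epsilon> u1 \<and> horizontal_curve M \<Gamma> \<epsilon> u2 \<and>
          (\<forall>s\<in>{-\<epsilon><..<\<epsilon>}. fst (u1 s) = fst (u2 s)) \<and>
          u1 0 = cvec c ?q p1 \<and> u2 0 = cvec c ?q p2 \<and> velocity M (fst \<circ> u1) 0 = v \<longrightarrow>
          ((\<lambda>s. half_form M \<rho> (u1 s) (u2 s)) has_real_derivative pairing M \<beta> v) (at 0)))"
    then obtain b where b: "\<beta> = cvec c ?q b" using cotangent_cases[of \<beta> c] ch by (metis fst_cvec)
    have "b \<bullet> w = bcov \<rho> c x p1 p2 \<bullet> w" for w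
    proof -
      obtain \<epsilon> where e: "\<epsilon> > 0" "\<forall>p0. \<exists>u. horizontal_curve M \<Gamma> \<epsilon> u \<and> u 0 = cvec c ?q p0 \<and>
          (\<forall>s\<in>{-\<epsilon><..<\<epsilon>}. fst (u s) = chart_inv c (snd c ?q + s *\<^sub>R w)) \<and>
          velocity M (fst \<circ> u) 0 = tvec c ?q w"
        using horizontal_curve_exists[OF ch] by blast
      obtain u1 where u1: "horizontal_curve M \<Gamma> \<epsilon> u1" "u1 0 = cvec c ?q p1"
        "\<forall>s\<in>{-\<epsilon><..<\<epsilon>}. fst (u1 s) = chart_inv c (snd c ?q + s *\<^sub>R w)"
        "velocity M (fst \<circ> u1) 0 = tvec c ?q w" using e(2) by blast
      obtain u2 where u2: "horizontal_curve M \<Gamma> \<epsilon> u2" "u2 0 = cvec c ?q p2"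
        "\<forall>s\<in>{-\<epsilon><..<\<epsilon>}. fst (u2 s) = chart_inv c (snd c ?q + s *\<^sub>R w)" using e(2) by blast
      have base: "\<forall>s\<in>{-\<epsilon><..<\<epsilon>}. fst (u1 s) = fst (u2 s)" using u1(3) u2(3) by simp
      have "((\<lambda>s. half_form M \<rho> (u1 s) (u2 s)) has_real_derivative pairing M \<beta> (tvec c ?q w)) (at 0)"
      proof -
        have "\<forall>\<epsilon>>0. \<forall>u1 u2. horizontal_curve M \<Gamma> \<epsilon> u1 \<and> horizontal_curve M \<Gamma> \<epsilon> u2 \<and>
          (\<forall>s\<in>{-\<epsilon><..<\<epsilon>}. fst (u1 s) = fst (u2 s)) \<and>
          u1 0 = cvec c ?q p1 \<and> u2 0 = cvec c ?q p2 \<and> velocity M (fst \<circ> u1) 0 = tvec c ?q w \<longrightarrow>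
          ((\<lambda>s. half_form M \<rho> (u1 s) (u2 s)) has_real_derivative pairing M \<beta> (tvec c ?q w)) (at 0)"
          using \<beta> tvec_in[OF ch, of w] by simp
        then show ?thesis using e(1) u1 u2 base by blast
      qed
      moreover have "((\<lambda>s. half_form M \<rho> (u1 s) (u2 s)) has_real_derivative bform \<rho> c x p1 p2 w) (at 0)"
        by (rule half_form_horizontal_derivative[OF x e(1) u1(1) u2(1) base u1(2) u2(2) u1(4)])
      ultimately have "pairing M \<beta> (tvec c ?q w) = bform \<rho> c x p1 p2 w" by (rule DERIV_unique)
      then show ?thesis using ch by (simp add: b bcov_inner[OF x])
    qed
    then have "b = bcov \<rho> c x p1 p2" using vector_eq_rdot by blast
    then show "\<beta> = cvec c ?q (bcov \<rho> c x p1 p2)" by (simp add: b)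
  qed
qed

text \<open>The kinetic energy is \<open>half_form\<close> on the diagonal, so one horizontal curve
  is used in both slots.\<close>

lemma base_deriv_kinetic_coord:
  assumes x: "x \<in> img c"
  shows "base_deriv M \<Gamma> (kinetic M \<rho>) (cvec_at c x p) =
    cvec_at c x (bcov \<rho> c x p p)"
proof -
  let ?q = "chart_inv c x"
  have ch: "c \<in> charts_at M ?q" by (rule chart_inv_charts_at[OF c x])
  have k: "kinetic M \<rho> (u s) = half_form M \<rho> (u s) (u s)" for u :: "real \<Rightarrow> ('m, 'e) fvec" and s
    by (simp add: kinetic_def half_form_def)
  show ?thesis
    unfolding base_deriv_def k
  proof (rule the_equality)
    show "cvec c ?q (bcov \<rho> c x p p) \<in> CT \<and> fst (cvec c ?q (bcov \<rho> c x p p)) = fst (cvec c ?q p) \<and>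
      (\<forall>v\<in>tangent_bundle M. fst v = fst (cvec c ?q p) \<longrightarrow>
       (\<forall>\<epsilon>>0. \<forall>u. horizontal_curve M \<Gamma> \<epsilon> u \<and> u 0 = cvec c ?q p \<and> velocity M (fst \<circ> u) 0 = v \<longrightarrow>
          ((\<lambda>s. half_form M \<rho> (u s) (u s)) has_real_derivative
            pairing M (cvec c ?q (bcov \<rho> c x p p)) v) (at 0)))"
    proof (intro conjI ballI allI impI)
      fix v and \<epsilon> :: real and u
      assume v: "v \<in> tangent_bundle M" "fst v = fst (cvec c ?q p)" and e: "\<epsilon> > 0"
        and u: "horizontal_curve M \<Gamma> \<epsilon> u \<and> u 0 = cvec c ?q p \<and> velocity M (fst \<circ> u) 0 = v"
      obtain w where w: "v = tvec c ?q w" using tangent_cases[OF v(1), of c] v(2) ch by (metis fst_cvec)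
      have "((\<lambda>s. half_form M \<rho> (u s) (u s)) has_real_derivative bform \<rho> c x p p w) (at 0)"
        by (rule half_form_horizontal_derivative[OF x e]) (use u w in auto)
      then show "((\<lambda>s. half_form M \<rho> (u s) (u s)) has_real_derivative
            pairing M (cvec c ?q (bcov \<rho> c x p p)) v) (at 0)"
        using ch by (simp add: w bcov_inner[OF x])
    qed (use ch in simp_all)
  next
    fix \<beta> assume \<beta>: "\<beta> \<in> CT \<and> fst \<beta> = fst (cvec c ?q p) \<and>
      (\<forall>v\<in>tangent_bundle M. fst v = fst (cvec c ?q p) \<longrightarrow>
       (\<forall>\<epsilon>>0. \<forall>u. horizontal_curve M \<Gamma> \<epsilon> u \<and> u 0 = cvec c ?q p \<and> velocity M (fst \<circ> u) 0 = v \<longrightarrow>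
          ((\<lambda>s. half_form M \<rho> (u s) (u s)) has_real_derivative pairing M \<beta> v) (at 0)))"
    then obtain b where b: "\<beta> = cvec c ?q b" using cotangent_cases[of \<beta> c] ch by (metis fst_cvec)
    have "b \<bullet> w = bcov \<rho> c x p p \<bullet> w" for w
    proof -
      obtain \<epsilon> u where u: "\<epsilon> > 0" "horizontal_curve M \<Gamma> \<epsilon> u" "u 0 = cvec c ?q p"
          "velocity M (fst \<circ> u) 0 = tvec c ?q w"
        using horizontal_curve_exists[OF ch] by metis
      have "((\<lambda>s. half_form M \<rho> (u s) (u s)) has_real_derivative pairing M \<beta> (tvec c ?q w)) (at 0)"
      proof -
        have "\<forall>\<epsilon>>0. \<forall>u. horizontal_curve M \<Gamma> \<epsilon> u \<and> u 0 = cvec c ?q p \<and>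
            velocity M (fst \<circ> u) 0 = tvec c ?q w \<longrightarrow>
          ((\<lambda>s. half_form M \<rho> (u s) (u s)) has_real_derivative pairing M \<beta> (tvec c ?q w)) (at 0)"
          using \<beta> tvec_in[OF ch, of w] by simp
        then show ?thesis using u by blast
      qed
      moreover have "((\<lambda>s. half_form M \<rho> (u s) (u s)) has_real_derivative bform \<rho> c x p p w) (at 0)"
        by (rule half_form_horizontal_derivative[OF x u(1,2,2) _ u(3,3,4)]) simp
      ultimately have "pairing M \<beta> (tvec c ?q w) = bform \<rho> c x p p w" by (rule DERIV_unique)
      then show ?thesis using ch by (simp add: b bcov_inner[OF x])
    qed
    then have "b = bcov \<rho> c x p p" using vector_eq_rdot by blast
    then show "\<beta> = cvec c ?q (bcov \<rho> c x p p)" by (simp add: b)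
  qed
qed

end

section \<open>The tensor Upsilon in coordinates\<close>

definition Ups :: "(('m, 'e) fvec \<Rightarrow> ('m, 'e) fvec \<Rightarrow> real) \<Rightarrow> (('m, 'e) fvec \<Rightarrow> ('m, 'e) fvec \<Rightarrow> real) \<Rightarrow>
    ('m, 'e) chart \<Rightarrow> 'e \<Rightarrow> 'e \<Rightarrow> 'e \<Rightarrow> 'e \<Rightarrow> real" where
  "Ups \<rho> \<rho>' c x p1 p2 p3 =
    bform \<rho>' c x p1 p2 (sharp_coord \<rho> c x p3) - bform \<rho> c x p1 p2 (sharp_coord \<rho>' c x p3)"

context
  fixes \<rho> \<rho>' c
  assumes \<rho>: "riemannian_metric M \<rho>" and \<rho>': "riemannian_metric M \<rho>'" and c: "c \<in> M"
begin

lemma fiber_deriv_kinetic_coord: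
  assumes "riemannian_metric M g" "x \<in> img c"
  shows "fiber_deriv M (kinetic M g) (cvec_at c x p) = tvec_at c x (sharp_coord g c x p)"
  by (rule fiber_deriv_coord[OF assms(1) c assms(2), where h = "\<lambda>_. 0"]) simp

lemma Upsilon_coord:
  assumes x: "x \<in> img c"
  shows "Upsilon M \<Gamma> \<rho> \<rho>' (cvec_at c x p1) (cvec_at c x p2) (cvec_at c x p3) =
    Ups \<rho> \<rho>' c x p1 p2 p3"
  using chart_inv_charts_at[OF c x]
  by (simp add: Upsilon_def Ups_def base_deriv2_coord[OF _ c x] fiber_deriv_kinetic_coord \<rho> \<rho>' x bcov_inner[OF _ c x])

lemma Ups_linear:
  assumes x: "x \<in> img c"
  shows "linear (\<lambda>p. Ups \<rho> \<rho>' c x p p2 p3)" "linear (\<lambda>p. Ups \<rho> \<rho>' c x p1 p p3)" "linear (Ups \<rho> \<rho>' c x p1 p2)"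
    and "Ups \<rho> \<rho>' c x p1 p2 p3 = Ups \<rho> \<rho>' c x p2 p1 p3"
proof -
  note lin = bform_linear(1-3)[OF \<rho> c x] bform_linear(1-3)[OF \<rho>' c x]
    linear_sharp_coord[OF \<rho> c x] linear_sharp_coord[OF \<rho>' c x]
  note simps = lin[THEN linear_add] lin[THEN linear_cmul]
  show "linear (\<lambda>p. Ups \<rho> \<rho>' c x p p2 p3)" "linear (\<lambda>p. Ups \<rho> \<rho>' c x p1 p p3)" "linear (Ups \<rho> \<rho>' c x p1 p2)"
    by (rule linearI; simp add: Ups_def simps algebra_simps)+
  show "Ups \<rho> \<rho>' c x p1 p2 p3 = Ups \<rho> \<rho>' c x p2 p1 p3"
    unfolding Ups_def using bform_linear(4)[OF \<rho> c x] bform_linear(4)[OF \<rho>' c x] by metis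
qed

lemma smooth_Ups:
  assumes S: "open S" "smooth_on S y" and y: "\<And>s. s \<in> S \<Longrightarrow> y s \<in> img c"
    and f: "smooth_on S f" and g: "smooth_on S g" and h: "smooth_on S h"
  shows "smooth_on S (\<lambda>s. Ups \<rho> \<rho>' c (y s) (f s) (g s) (h s))"
  unfolding Ups_def
  by (intro smooth_on_diff smooth_bform S f g h c y smooth_sharp \<rho> \<rho>')

end

end

section \<open>The Poisson bracket\<close>

lemma grad_inner:
  assumes "(f has_derivative D) (at x)"
  shows "grad f x \<bullet> v = D v"
  unfolding grad_def frechet_derivative_at[OF assms, symmetric]
  by (rule linear_inner_representation[OF has_derivative_linear[OF assms]])

context atlas
begin

definition dbase :: "('m \<Rightarrow> real) \<Rightarrow> ('m, 'e) chart \<Rightarrow> 'e \<Rightarrow> 'e \<Rightarrow> real" where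
  "dbase h c x v = frechet_derivative (h \<circ> chart_inv c) (at x) v"

lemma dbase_has_derivative:
  assumes "smooth_fun M h" "c \<in> M" "x \<in> img c"
  shows "((h \<circ> chart_inv c) has_derivative dbase h c x) (at x)"
  unfolding dbase_def
  using smooth_on_has_derivative[OF smooth_fun_baseD[OF assms(1,2)] assms(3)] by (simp add: o_def)

lemma dbase_linear:
  assumes "smooth_fun M h" "c \<in> M" "x \<in> img c"
  shows "linear (dbase h c x)"
  using dbase_has_derivative[OF assms] has_derivative_linear by blast

text \<open>\<open>pairing\<close> evaluates in an arbitrary chart; the chain rule along the
  transition map brings the result back to \<open>c\<close>.\<close>

lemma differential_pairing:
  assumes h: "smooth_fun M h" and c: "c \<in> M" and x: "x \<in> img c"
  shows "pairing M (differential M h (chart_inv c x)) (tvec_at c x v) = dbase h c x v"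
proof -
  let ?q = "chart_inv c x"
  have ch: "c \<in> charts_at M ?q" by (rule chart_inv_charts_at[OF c x])
  have d: "chart_at M ?q \<in> charts_at M ?q" (is "?d \<in> _") by (rule chart_at[OF charts_at_points[OF ch]])
  note dM = charts_atD[OF d]
  have xd: "snd ?d ?q \<in> img ?d" using dM by simp
  have xo: "x \<in> snd c ` (fst c \<inter> fst ?d)" using overlap_iff[OF c, of x ?d] x dM(2) by simp
  have sx: "snd c ?q = x" by (rule chart_chart_inv[OF x])
  have tr: "(transition c ?d has_derivative jac c ?d ?q) (at x)"
    using transition_has_derivative[OF ch d] by (simp add: sx)
  have dh: "((h \<circ> chart_inv ?d) has_derivative dbase h ?d (snd ?d ?q)) (at (transition c ?d x))"
    using dbase_has_derivative[OF h dM(1) xd] by (simp add: transition_def)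
  have "((\<lambda>y. (h \<circ> chart_inv ?d) (transition c ?d y)) has_derivative
      (\<lambda>v. dbase h ?d (snd ?d ?q) (jac c ?d ?q v))) (at x)"
    by (rule has_derivative_compose[OF tr dh])
  then have "((h \<circ> chart_inv c) has_derivative (\<lambda>v. dbase h ?d (snd ?d ?q) (jac c ?d ?q v))) (at x)"
    by (rule has_derivative_transform_within_open[OF _ open_overlap[OF c dM(1)] xo])
      (simp add: chart_inv_transition[OF c dM(1)])
  then have "dbase h c x v = dbase h ?d (snd ?d ?q) (jac c ?d ?q v)"
    using has_derivative_unique[OF dbase_has_derivative[OF h c x]] by metis
  moreover have "pairing M (differential M h ?q) (tvec c ?q v) =
      grad (h \<circ> chart_inv ?d) (snd ?d ?q) \<bullet> jac c ?d ?q v"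
    using d by (simp add: pairing_def differential_def snd_tvec)
  ultimately show ?thesis using grad_inner[OF dbase_has_derivative[OF h dM(1) xd]] by simp
qed

text \<open>In the momentum direction the two terms of the product rule coincide by symmetry of the
  inverse metric, which cancels the factor \<open>1/2\<close>; in the base direction only the
  inverse metric and the potential are differentiated.\<close>

lemma simple_grad:
  assumes H: "simple_with M H \<rho> h" and c: "c \<in> M" and x: "x \<in> img c"
  shows "fst (grad (H \<circ> chart_inv (bundle_chart CT c)) (x, p)) \<bullet> v =
      1/2 * (p \<bullet> dsharp \<rho> c x v p) + dbase h c x v"
    and "snd (grad (H \<circ> chart_inv (bundle_chart CT c)) (x, p)) = sharp_coord \<rho> c x p"
proof -
  have \<rho>: "riemannian_metric M \<rho>" and h: "smooth_fun M h"
    and Hk: "\<And>a. a \<in> CT \<Longrightarrow> H a = kinetic M \<rho> a + h (fst a)"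
    using H by (auto simp: simple_with_def)
  let ?S = "sharp_coord \<rho> c" and ?F = "H \<circ> chart_inv (bundle_chart CT c)"
  have Sb: "((\<lambda>y. ?S (fst y) b) has_derivative (\<lambda>k. dsharp \<rho> c x (fst k) b)) (at (x, p))" for b
    by (rule has_derivative_compose[OF has_derivative_fst[OF has_derivative_ident]])
      (simp add: sharp_has_derivative[OF \<rho> c x])
  have "((\<lambda>y. \<Sum>b\<in>Basis. (snd y \<bullet> b) *\<^sub>R ?S (fst y) b) has_derivative
      (\<lambda>k. \<Sum>b\<in>Basis. (snd (x, p) \<bullet> b) *\<^sub>R dsharp \<rho> c x (fst k) b + (snd k \<bullet> b) *\<^sub>R ?S (fst (x, p)) b)) (at (x, p))"
    by (intro has_derivative_sum has_derivative_scaleR Sb has_derivative_inner_left has_derivative_snd has_derivative_ident)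
  also have "(\<lambda>k. \<Sum>b\<in>Basis. (snd (x, p) \<bullet> b) *\<^sub>R dsharp \<rho> c x (fst k) b + (snd k \<bullet> b) *\<^sub>R ?S (fst (x, p)) b) =
      (\<lambda>k. dsharp \<rho> c x (fst k) p + ?S x (snd k))"
  proof
    fix k :: "'e \<times> 'e"
    show "(\<Sum>b\<in>Basis. (snd (x, p) \<bullet> b) *\<^sub>R dsharp \<rho> c x (fst k) b + (snd k \<bullet> b) *\<^sub>R ?S (fst (x, p)) b) =
      dsharp \<rho> c x (fst k) p + ?S x (snd k)"
      unfolding sum.distrib
      by (simp add: linear_basis_sum[OF dsharp_linear(2)[OF \<rho> c x], of "fst k" p, symmetric]
        linear_basis_sum[OF linear_sharp_coord[OF \<rho> c x], of "snd k", symmetric])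
  qed
  finally have D: "((\<lambda>y. \<Sum>b\<in>Basis. (snd y \<bullet> b) *\<^sub>R ?S (fst y) b) has_derivative
      (\<lambda>k. dsharp \<rho> c x (fst k) p + ?S x (snd k))) (at (x, p))" .
  have dh: "((\<lambda>y. (h \<circ> chart_inv c) (fst y)) has_derivative (\<lambda>k. dbase h c x (fst k))) (at (x, p))"
    by (rule has_derivative_compose[OF has_derivative_fst[OF has_derivative_ident]])
      (use dbase_has_derivative[OF h c x] in \<open>simp add: o_def\<close>)
  let ?D = "\<lambda>k. 1/2 * (snd (x, p) \<bullet> (dsharp \<rho> c x (fst k) p + ?S x (snd k)) +
      snd k \<bullet> (\<Sum>b\<in>Basis. (snd (x, p) \<bullet> b) *\<^sub>R ?S (fst (x, p)) b)) + dbase h c x (fst k)"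
  have 1: "((\<lambda>y. 1/2 * (snd y \<bullet> (\<Sum>b\<in>Basis. (snd y \<bullet> b) *\<^sub>R ?S (fst y) b)) + (h \<circ> chart_inv c) (fst y))
      has_derivative ?D) (at (x, p))"
    by (intro has_derivative_add has_derivative_mult_right has_derivative_inner D dh
        has_derivative_snd has_derivative_ident)
  have 2: "(?F has_derivative ?D) (at (x, p))"
  proof (rule has_derivative_transform_within_open[OF 1 open_coords[OF c]])
    show "(x, p) \<in> coords c" using x by simp
    fix y :: "'e \<times> 'e" assume y: "y \<in> coords c"
    then have yx: "fst y \<in> img c" by auto
    have "?F y = H (cvec_at c (fst y) (snd y))"
      using bundle_chart_inv[OF c yx, of "snd y"] by simp
    also have "\<dots> = 1/2 * (snd y \<bullet> ?S (fst y) (snd y)) + h (chart_inv c (fst y))"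
      by (simp add: Hk[OF cvec_in_CT[OF c yx]] kinetic_coord[OF \<rho> c yx])
    finally show "1/2 * (snd y \<bullet> (\<Sum>b\<in>Basis. (snd y \<bullet> b) *\<^sub>R ?S (fst y) b)) + (h \<circ> chart_inv c) (fst y) = ?F y"
      by (simp add: linear_basis_sum[OF linear_sharp_coord[OF \<rho> c yx], symmetric])
  qed
  note g = grad_inner[OF 2]
  have D': "?D k = 1/2 * (p \<bullet> dsharp \<rho> c x (fst k) p) + snd k \<bullet> ?S x p + dbase h c x (fst k)" for k
    using sharp_coord_sym[OF \<rho> c x, of p "snd k"]
    by (simp add: linear_basis_sum[OF linear_sharp_coord[OF \<rho> c x], symmetric] inner_add_right algebra_simps)
  have "fst (grad ?F (x, p)) \<bullet> v = grad ?F (x, p) \<bullet> (v, 0)" by (simp add: inner_prod_def)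
  then show "fst (grad ?F (x, p)) \<bullet> v = 1/2 * (p \<bullet> dsharp \<rho> c x v p) + dbase h c x v"
    unfolding g D' by simp
  have "snd (grad ?F (x, p)) \<bullet> r = ?S x p \<bullet> r" for r
  proof -
    have "snd (grad ?F (x, p)) \<bullet> r = grad ?F (x, p) \<bullet> (0, r)" by (simp add: inner_prod_def)
    then show ?thesis
      unfolding g D'
      using linear_0[OF dsharp_linear(1)[OF \<rho> c x]] linear_0[OF dbase_linear[OF h c x]]
      by (simp add: inner_commute)
  qed
  then show "snd (grad ?F (x, p)) = ?S x p" using vector_eq_rdot by blast
qed

text \<open>The bracket is evaluated in the chart picked by \<open>chart_at\<close>, of which it is
  only known that it comes from some chart of the base; hence the existential form. The right-hand
  side is a cubic part plus a linear part in the covector.\<close>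

lemma poisson_bracket_coord:
  assumes H: "simple_with M H \<rho> h" "simple_with M H' \<rho>' h'" and a: "a \<in> CT"
  shows "\<exists>c\<in>charts_at M (fst a). poisson_bracket M H' H a =
    1/2 * (snd a c \<bullet> dsharp \<rho>' c (snd c (fst a)) (sharp_coord \<rho> c (snd c (fst a)) (snd a c)) (snd a c)) -
    1/2 * (snd a c \<bullet> dsharp \<rho> c (snd c (fst a)) (sharp_coord \<rho>' c (snd c (fst a)) (snd a c)) (snd a c)) +
    (dbase h' c (snd c (fst a)) (sharp_coord \<rho> c (snd c (fst a)) (snd a c)) -
     dbase h c (snd c (fst a)) (sharp_coord \<rho>' c (snd c (fst a)) (snd a c)))"
proof -
  let ?\<Phi> = "chart_at (cotangent_atlas M) a"
  have "\<exists>\<Phi>. \<Phi> \<in> charts_at (cotangent_atlas M) a"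
  proof -
    obtain d where "d \<in> charts_at M (fst a)" using chart_at cotangent_points a by blast
    then have "bundle_chart CT d \<in> charts_at (cotangent_atlas M) a"
      using a by (auto simp: charts_at_def cotangent_atlas_def fst_bundle_chart)
    then show ?thesis ..
  qed
  then have "?\<Phi> \<in> charts_at (cotangent_atlas M) a" unfolding chart_at_def by (rule someI_ex)
  then obtain c where c: "c \<in> M" "?\<Phi> = bundle_chart CT c" "fst a \<in> fst c"
    by (auto simp: charts_at_def cotangent_atlas_def fst_bundle_chart)
  have x: "snd c (fst a) \<in> img c" using c by simp
  note g = simple_grad[OF H(1) c(1) x] simple_grad[OF H(2) c(1) x]
  show ?thesis
  proof (rule bexI[of _ c])
    show "c \<in> charts_at M (fst a)" using c by (simp add: charts_at_def)
  qed (simp add: poisson_bracket_def Let_def c(2) snd_bundle_chart g algebra_simps)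
qed

end

context connected_atlas
begin

text \<open>Let \<open>v\<close> and \<open>v'\<close> be the vectors that \<open>\<rho>\<close> and
  \<open>\<rho>'\<close> assign to \<open>p\<close>. The two halves of \<open>Ups\<close> contain
  the Christoffel terms \<open>p \<bullet> \<Gamma> c x v v'\<close> and
  \<open>p \<bullet> \<Gamma> c x v' v\<close>, which cancel by torsion-freeness; what remains is
  the cubic part of the bracket.\<close>

lemma Ups_diagonal:
  assumes \<rho>: "riemannian_metric M \<rho>" "riemannian_metric M \<rho>'" and c: "c \<in> M" and x: "x \<in> img c"
  shows "Ups \<rho> \<rho>' c x p p p = 1/2 * (p \<bullet> dsharp \<rho>' c x (sharp_coord \<rho> c x p) p) -
    1/2 * (p \<bullet> dsharp \<rho> c x (sharp_coord \<rho>' c x p) p)"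
  using christoffel_sym[OF c x, of "sharp_coord \<rho> c x p" "sharp_coord \<rho>' c x p"]
  by (simp add: Ups_def bform_def algebra_simps)

definition potential_matching :: "(('m, 'e) fvec \<Rightarrow> ('m, 'e) fvec \<Rightarrow> real) \<Rightarrow> ('m \<Rightarrow> real) \<Rightarrow>
    (('m, 'e) fvec \<Rightarrow> ('m, 'e) fvec \<Rightarrow> real) \<Rightarrow> ('m \<Rightarrow> real) \<Rightarrow> ('m, 'e) fvec \<Rightarrow> real" where
  "potential_matching \<rho> h \<rho>' h' \<sigma> = pairing M (differential M h' (fst \<sigma>)) (fiber_deriv M (kinetic M \<rho>) \<sigma>) -
     pairing M (differential M h (fst \<sigma>)) (fiber_deriv M (kinetic M \<rho>') \<sigma>)"

lemma potential_matching_coord: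
  assumes \<rho>: "riemannian_metric M \<rho>" "riemannian_metric M \<rho>'" and h: "smooth_fun M h" "smooth_fun M h'"
    and c: "c \<in> M" and x: "x \<in> img c"
  shows "potential_matching \<rho> h \<rho>' h' (cvec_at c x p) =
    dbase h' c x (sharp_coord \<rho> c x p) - dbase h c x (sharp_coord \<rho>' c x p)"
  by (simp add: potential_matching_def fiber_deriv_kinetic_coord[OF \<rho> c _ x] \<rho> differential_pairing[OF _ c x] h)

text \<open>The kinetic equation of the CH method is \<open>Ups\<close> on the diagonal, and this is
  how it meets the cubic part of the bracket.\<close>

lemma kinetic_matching_coord:
  assumes \<rho>: "riemannian_metric M \<rho>" "riemannian_metric M \<rho>'" and c: "c \<in> M" and x: "x \<in> img c"
  shows "pairing M (base_deriv M \<Gamma> (kinetic M \<rho>') (cvec_at c x p))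
      (fiber_deriv M (kinetic M \<rho>) (cvec_at c x p)) -
     pairing M (base_deriv M \<Gamma> (kinetic M \<rho>) (cvec_at c x p))
      (fiber_deriv M (kinetic M \<rho>') (cvec_at c x p)) = Ups \<rho> \<rho>' c x p p p"
  using chart_inv_charts_at[OF c x]
  by (simp add: fiber_deriv_kinetic_coord[OF \<rho> c _ x] base_deriv_kinetic_coord[OF _ c x] \<rho> bcov_inner[OF _ c x] Ups_def)

text \<open>
  On the fibers the bracket is the sum of a cubic and a linear part, so on a set that is closed
  under scaling it vanishes iff both parts do.
\<close>

lemma LCB_equation_iff_CH_equations:
  assumes H: "simple_with M H \<rho> h" "simple_with M H' \<rho>' h'"
    and What: "What M W \<rho>' \<subseteq> CT" "\<And>\<sigma> s. \<sigma> \<in> What M W \<rho>' \<Longrightarrow> vscale s \<sigma> \<in> What M W \<rho>'"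
  shows "LCB_equation M W H H' \<rho>' \<longleftrightarrow> CH_equations M \<Gamma> W \<rho> h \<rho>' h'"
proof -
  have \<rho>: "riemannian_metric M \<rho>" "riemannian_metric M \<rho>'" and h: "smooth_fun M h" "smooth_fun M h'"
    using H by (auto simp: simple_with_def)
  define K where "K \<sigma> = pairing M (base_deriv M \<Gamma> (kinetic M \<rho>') \<sigma>) (fiber_deriv M (kinetic M \<rho>) \<sigma>) -
     pairing M (base_deriv M \<Gamma> (kinetic M \<rho>) \<sigma>) (fiber_deriv M (kinetic M \<rho>') \<sigma>)" for \<sigma>
  have coord: "\<exists>c x p. c \<in> M \<and> x \<in> img c \<and> \<sigma> = cvec_at c x p \<and>
      poisson_bracket M H' H \<sigma> = K \<sigma> + potential_matching \<rho> h \<rho>' h' \<sigma>" if \<sigma>: "\<sigma> \<in> CT" for \<sigma>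
  proof -
    obtain c where c: "c \<in> charts_at M (fst \<sigma>)" and pb: "poisson_bracket M H' H \<sigma> =
    1/2 * (snd \<sigma> c \<bullet> dsharp \<rho>' c (snd c (fst \<sigma>)) (sharp_coord \<rho> c (snd c (fst \<sigma>)) (snd \<sigma> c)) (snd \<sigma> c)) -
    1/2 * (snd \<sigma> c \<bullet> dsharp \<rho> c (snd c (fst \<sigma>)) (sharp_coord \<rho>' c (snd c (fst \<sigma>)) (snd \<sigma> c)) (snd \<sigma> c)) +
    (dbase h' c (snd c (fst \<sigma>)) (sharp_coord \<rho> c (snd c (fst \<sigma>)) (snd \<sigma> c)) -
     dbase h c (snd c (fst \<sigma>)) (sharp_coord \<rho>' c (snd c (fst \<sigma>)) (snd \<sigma> c)))"
      using poisson_bracket_coord[OF H \<sigma>] by blast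
    note cM = charts_atD[OF c]
    let ?x = "snd c (fst \<sigma>)" and ?p = "snd \<sigma> c"
    have x: "?x \<in> img c" using cM by simp
    have \<sigma>': "\<sigma> = cvec_at c ?x ?p" using cvec_eq[OF \<sigma> c] cM by (simp add: chart_inv_chart)
    have "poisson_bracket M H' H \<sigma> = Ups \<rho> \<rho>' c ?x ?p ?p ?p +
        (dbase h' c ?x (sharp_coord \<rho> c ?x ?p) - dbase h c ?x (sharp_coord \<rho>' c ?x ?p))"
      unfolding pb Ups_diagonal[OF \<rho> cM(1) x] ..
    also have "\<dots> = K \<sigma> + potential_matching \<rho> h \<rho>' h' \<sigma>"
      unfolding K_def using potential_matching_coord[OF \<rho> h cM(1) x, of ?p] kinetic_matching_coord[OF \<rho> cM(1) x, of ?p] \<sigma>'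
      by metis
    finally show ?thesis using cM(1) x \<sigma>' by blast
  qed
  have "K \<sigma> = 0 \<and> potential_matching \<rho> h \<rho>' h' \<sigma> = 0"
    if L: "\<forall>\<sigma>\<in>What M W \<rho>'. poisson_bracket M H' H \<sigma> = 0" and \<sigma>: "\<sigma> \<in> What M W \<rho>'" for \<sigma>
  proof -
    obtain c x p where c: "c \<in> M" "x \<in> img c" "\<sigma> = cvec_at c x p"
      "poisson_bracket M H' H \<sigma> = K \<sigma> + potential_matching \<rho> h \<rho>' h' \<sigma>" using coord \<sigma> What(1) by blast
    have ch: "c \<in> charts_at M (chart_inv c x)" by (rule chart_inv_charts_at[OF c(1,2)])
    \<comment> \<open>Doubling separates the degrees: a cubic part \<open>a\<close> and a linear
      part \<open>b\<close> with \<open>a + b = 0\<close> and \<open>8 * a + 2 * b = 0\<close> both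
      vanish.\<close>
    have 2: "vscale 2 \<sigma> \<in> What M W \<rho>'" by (rule What(2)[OF \<sigma>])
    have v2: "vscale 2 \<sigma> = cvec_at c x (2 *\<^sub>R p)" by (simp add: c(3) vscale_cvec[OF ch])
    have "K (vscale 2 \<sigma>) + potential_matching \<rho> h \<rho>' h' (vscale 2 \<sigma>) = 0"
      using coord[of "vscale 2 \<sigma>"] 2 What(1) L by fastforce
    moreover have "K (vscale 2 \<sigma>) = 8 * K \<sigma>"
      unfolding v2 unfolding c(3) K_def kinetic_matching_coord[OF \<rho> c(1,2)]
      by (simp add: linear_cmul[OF Ups_linear(1)[OF \<rho> c(1,2)]] linear_cmul[OF Ups_linear(2)[OF \<rho> c(1,2)]]
          linear_cmul[OF Ups_linear(3)[OF \<rho> c(1,2)]])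
    moreover have "potential_matching \<rho> h \<rho>' h' (vscale 2 \<sigma>) = 2 * potential_matching \<rho> h \<rho>' h' \<sigma>"
      unfolding v2 unfolding c(3) potential_matching_coord[OF \<rho> h c(1,2)]
      by (simp add: linear_cmul[OF linear_sharp_coord[OF \<rho>(1) c(1,2)]] linear_cmul[OF linear_sharp_coord[OF \<rho>(2) c(1,2)]]
          linear_cmul[OF dbase_linear[OF h(1) c(1,2)]] linear_cmul[OF dbase_linear[OF h(2) c(1,2)]])
    moreover have "K \<sigma> + potential_matching \<rho> h \<rho>' h' \<sigma> = 0" using c(4) L \<sigma> by simp
    ultimately show ?thesis by simp
  qed
  moreover have "poisson_bracket M H' H \<sigma> = 0"
    if "\<forall>\<sigma>\<in>What M W \<rho>'. K \<sigma> = 0 \<and> potential_matching \<rho> h \<rho>' h' \<sigma> = 0" "\<sigma> \<in> What M W \<rho>'" for \<sigma>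
    using coord[of \<sigma>] that What(1) by force
  ultimately show ?thesis
    unfolding LCB_equation_def CH_equations_def K_def[symmetric] potential_matching_def[symmetric] by blast
qed

end

section \<open>The decomposition of the cotangent bundle\<close>

locale actuated_system = connected_atlas M \<Gamma>
  for M :: "('m, 'e::euclidean_space) chart set" and \<Gamma> :: "('m, 'e) christoffel" +
  fixes k :: nat and W :: "('m, 'e) fvec set"
    and \<rho> \<rho>' :: "('m, 'e) fvec \<Rightarrow> ('m, 'e) fvec \<Rightarrow> real" and H' :: "('m, 'e) fvec \<Rightarrow> real" and h' :: "'m \<Rightarrow> real"
  assumes rank: "k \<ge> 1" and subbundle: "linear_subbundle M k W"
    and metric: "riemannian_metric M \<rho>" and H': "simple_with M H' \<rho>' h'"
begin

lemma metric': "riemannian_metric M \<rho>'"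
  and H'_kinetic: "a \<in> CT \<Longrightarrow> H' a = kinetic M \<rho>' a + h' (fst a)"
  using H' by (auto simp: simple_with_def)

abbreviation S' where "S' \<equiv> sharp_coord \<rho>'"
abbreviation What' where "What' \<equiv> What M W \<rho>'"

section \<open>The fibers of the subbundle and of its complement in a chart\<close>

definition Wc :: "('m, 'e) chart \<Rightarrow> 'e \<Rightarrow> 'e set" where
  "Wc c x = {p. cvec_at c x p \<in> W}"

text \<open>The complement is introduced by orthogonality for the dual metric;
  \<open>What_coord\<close> identifies it with the image of the annihilator.\<close>

definition Hc :: "('m, 'e) chart \<Rightarrow> 'e \<Rightarrow> 'e set" where
  "Hc c x = {p. \<forall>w\<in>Wc c x. w \<bullet> S' c x p = 0}"

definition Pc :: "('m, 'e) chart \<Rightarrow> 'e \<Rightarrow> 'e \<Rightarrow> 'e" where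
  "Pc c x p = snd (projW M W \<rho>' (cvec_at c x p)) c"

lemma W_CT: "W \<subseteq> CT"
  using subbundle by (simp add: linear_subbundle_def)

text \<open>A subbundle comes with frames in charts of its own choice. Transport by the transition
  map and the transposed Jacobian gives a frame in the prescribed chart; independence and span
  survive because the transport is a linear isomorphism on each fiber.\<close>

lemma smooth_frame:
  assumes c: "c \<in> M" and x: "x \<in> img c"
  shows "\<exists>V b. open V \<and> x \<in> V \<and> V \<subseteq> img c \<and> (\<forall>i<k. smooth_on V (b i)) \<and>
    (\<forall>y\<in>V. inj_on (\<lambda>i. b i y) {..<k} \<and> independent ((\<lambda>i. b i y) ` {..<k}) \<and>
      Wc c y = span ((\<lambda>i. b i y) ` {..<k}))"
proof -
  let ?q = "chart_inv c x"
  have ch: "c \<in> charts_at M ?q" by (rule chart_inv_charts_at[OF c x])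
  from subbundle charts_at_points[OF ch] obtain d V b where d: "d \<in> charts_at M ?q"
    and V: "open V" "snd d ?q \<in> V" "V \<subseteq> img d"
    and sb: "\<forall>i<k. smooth_on V (b i)"
    and b: "\<forall>x\<in>V. inj_on (\<lambda>i. b i x) {..<k} \<and> independent ((\<lambda>i. b i x) ` {..<k}) \<and>
           {snd a d | a. a \<in> W \<and> fst a = chart_inv d x} = span ((\<lambda>i. b i x) ` {..<k})"
    unfolding linear_subbundle_def by blast
  note dM = charts_atD[OF d]
  let ?N = "{y \<in> snd c ` (fst c \<inter> fst d). transition c d y \<in> V}"
  have oN: "open ?N"
    by (rule smooth_on_open_vimage[OF smooth_transition[OF c dM(1)] open_overlap[OF c dM(1)] V(1)])
  define b' where "b' i y = adjoint (jac c d (chart_inv c y)) (b i (transition c d y))" for i y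
  have str: "smooth_on ?N (transition c d)" by (rule smooth_on_subset[OF smooth_transition[OF c dM(1)]]) auto
  have "smooth_on ?N (b' i)" if i: "i < k" for i
  proof -
    have "smooth_on ?N (\<lambda>y. b i (transition c d y))"
      by (rule smooth_on_compose[OF oN V(1) str]) (use sb i in auto)
    then have "smooth_on ?N (\<lambda>y. adjoint (jac c d (chart_inv d (transition c d y))) (b i (transition c d y)))"
    proof (rule smooth_adjoint_jac[OF dM(1) c oN str])
      show "transition c d y \<in> snd d ` (fst d \<inter> fst c)" if "y \<in> ?N" for y
        using transition_overlap[OF c, of y d] that by (simp add: Int_commute)
    qed
    then show ?thesis
      by (rule smooth_on_eq[OF oN]) (simp add: b'_def chart_inv_transition[OF c dM(1)])
  qed
  moreover have "inj_on (\<lambda>i. b' i y) {..<k} \<and> independent ((\<lambda>i. b' i y) ` {..<k}) \<and>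
      Wc c y = span ((\<lambda>i. b' i y) ` {..<k})" if y: "y \<in> ?N" for y
  proof -
    have yo: "y \<in> snd c ` (fst c \<inter> fst d)" and yV: "transition c d y \<in> V" using y by auto
    let ?r = "chart_inv c y" and ?A = "adjoint (jac c d (chart_inv c y))"
    note cy = overlap_charts[OF c dM(1) yo]
    have r: "chart_inv d (transition c d y) = ?r" by (rule chart_inv_transition[OF c dM(1) yo])
    have A: "cvec c ?r (?A p) = cvec d ?r p" for p by (rule cvec_change[OF cy(2,1)])
    have lin: "linear ?A" by (rule adjoint_linear[OF jac_linear[OF cy]])
    have inj: "inj ?A" using A cvec_eq_iff[OF cy(2)] by (metis injI)
    let ?b = "(\<lambda>i. b i (transition c d y))"
    have im: "(\<lambda>i. b' i y) ` {..<k} = ?A ` ?b ` {..<k}" by (simp add: b'_def image_image)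
    have bd: "inj_on ?b {..<k}" "independent (?b ` {..<k})"
      "{snd a d | a. a \<in> W \<and> fst a = ?r} = span (?b ` {..<k})" using b[THEN bspec, OF yV] unfolding r by blast+
    have "Wc c y = ?A ` {snd a d | a. a \<in> W \<and> fst a = ?r}"
    proof (intro equalityI subsetI)
      fix p assume p: "p \<in> Wc c y"
      have "cvec c ?r (?A (snd (cvec c ?r p) d)) = cvec d ?r (snd (cvec c ?r p) d)" by (rule A)
      also have "\<dots> = cvec c ?r p" using cvec_eq[of "cvec c ?r p" d] cy by simp
      finally have "p = ?A (snd (cvec c ?r p) d)" using cvec_eq_iff[OF cy(1)] by simp
      moreover have "snd (cvec c ?r p) d \<in> {snd a d | a. a \<in> W \<and> fst a = ?r}"
        using p fst_cvec unfolding Wc_def by blast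
      ultimately show "p \<in> ?A ` {snd a d | a. a \<in> W \<and> fst a = ?r}" by (rule image_eqI)
    next
      fix p assume "p \<in> ?A ` {snd a d | a. a \<in> W \<and> fst a = ?r}"
      then obtain a where a: "a \<in> W" "fst a = ?r" "p = ?A (snd a d)" by blast
      have "cvec c ?r p = cvec d ?r (snd a d)" by (simp add: a(3) A)
      also have "\<dots> = a" using cvec_eq[of a d] a cy W_CT by auto
      finally show "p \<in> Wc c y" using a(1) by (simp add: Wc_def)
    qed
    moreover have "inj_on (\<lambda>i. b' i y) {..<k}"
      unfolding b'_def using bd(1) inj by (auto simp: inj_on_def)
    moreover have "independent (?A ` ?b ` {..<k})"
      by (rule linear_independent_injective_image[OF lin bd(2)]) (use inj in \<open>auto intro: inj_on_subset\<close>)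
    ultimately show ?thesis unfolding im bd(3) linear_span_image[OF lin] by simp
  qed
  moreover have "x \<in> ?N"
    using V(2) overlap_iff[OF c, of x d] x dM(2) by (simp add: transition_def)
  moreover have "?N \<subseteq> img c" by auto
  ultimately show ?thesis using oN by (intro exI[of _ ?N] exI[of _ b']) blast
qed

lemma orthogonal_frame:
  assumes c: "c \<in> M" and x: "x \<in> img c"
  shows "\<exists>V u. open V \<and> x \<in> V \<and> V \<subseteq> img c \<and> (\<forall>i<k. smooth_on V (u i)) \<and>
    (\<forall>y\<in>V. form_orthogonal (\<lambda>p r. p \<bullet> S' c y r) k (\<lambda>i. u i y) \<and>
      Wc c y = span ((\<lambda>i. u i y) ` {..<k}))"
proof -
  obtain V b where V: "open V" "x \<in> V" "V \<subseteq> img c" and sb: "\<And>i. i < k \<Longrightarrow> smooth_on V (b i)"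
    and b: "\<And>y. y \<in> V \<Longrightarrow> inj_on (\<lambda>i. b i y) {..<k} \<and> independent ((\<lambda>i. b i y) ` {..<k})"
      "\<And>y. y \<in> V \<Longrightarrow> Wc c y = span ((\<lambda>i. b i y) ` {..<k})"
    using smooth_frame[OF c x] by blast
  have "\<exists>u. (\<forall>i<k. smooth_on V (u i)) \<and>
    (\<forall>y\<in>V. form_orthogonal (\<lambda>p r. p \<bullet> S' c y r) k (\<lambda>i. u i y) \<and>
      span ((\<lambda>i. u i y) ` {..<k}) = span ((\<lambda>i. b i y) ` {..<k}))"
  proof (rule smooth_gram_schmidt[OF V(1) _ _ sb b(1)])
    show "inner_form (\<lambda>p r. p \<bullet> S' c y r)" if "y \<in> V" for y
      by (rule inner_form_sharp_coord[OF metric' c]) (use that V in auto)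
    show "smooth_on V (\<lambda>y. v \<bullet> S' c y w)" for v w
      by (intro smooth_on_inner V(1) smooth_on_const smooth_on_subset[OF sharp_coord(3)[OF metric' c] V(3)])
  qed
  then show ?thesis using V b(2) by metis
qed

context
  fixes c x
  assumes c: "c \<in> M" and x: "x \<in> img c"
begin

lemmas chart_mem = chart_inv_charts_at[OF c x]
lemmas sharp_form = inner_form_sharp_coord[OF metric' c x]
lemmas sharp_sym = sharp_coord_sym[OF metric' c x]
lemmas S'_linear = linear_sharp_coord[OF metric' c x]

lemma Wc_subspace: "subspace (Wc c x)"
  using orthogonal_frame[OF c x] by (metis subspace_span)

text \<open>Rank at least 1 provides a direction transverse to the complement, along which points of
  the complement can be approached from outside. Both limit arguments at the end depend on
  it.\<close>

lemma Wc_nonzero: "\<exists>w\<in>Wc c x. w \<noteq> 0"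
proof -
  obtain u where "form_orthogonal (\<lambda>p r. p \<bullet> S' c x r) k (\<lambda>i. u i x)" "Wc c x = span ((\<lambda>i. u i x) ` {..<k})"
    using orthogonal_frame[OF c x] by blast
  moreover have "u 0 x \<in> span ((\<lambda>i. u i x) ` {..<k})" using rank by (intro span_base) auto
  ultimately show ?thesis using rank unfolding form_orthogonal_def by (intro bexI[of _ "u 0 x"]) auto
qed

lemma Hc_subspace: "subspace (Hc c x)"
  unfolding Hc_def subspace_def
  by (simp add: linear_0[OF S'_linear] linear_add[OF S'_linear] linear_cmul[OF S'_linear] inner_add_right)

lemma sharp_form_zero: "p \<bullet> S' c x p = 0 \<Longrightarrow> p = 0"
  using inner_formD(4)[OF sharp_form, of p] by fastforce

text \<open>A covector is the flat of a vector exactly if \<open>S'\<close> maps it to that vector,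
  so annihilating \<open>W\<close> turns into orthogonality to \<open>W\<close>.\<close>

lemma What_coord: "cvec_at c x p \<in> What' \<longleftrightarrow> p \<in> Hc c x"
proof -
  let ?q = "chart_inv c x"
  have inv: "fiber_deriv_inv M (kinetic M \<rho>') (tvec_at d y v) = cvec_at d y (flat_coord \<rho>' d y v)"
    if "d \<in> M" "y \<in> img d" for d y v
    by (rule fiber_deriv_inv_coord[OF metric' _ that, where h = "\<lambda>_. 0"]) simp
  have ann: "tvec c ?q v \<in> annihilator M W \<longleftrightarrow> (\<forall>w\<in>Wc c x. w \<bullet> v = 0)" for v
  proof
    assume "tvec c ?q v \<in> annihilator M W"
    then show "\<forall>w\<in>Wc c x. w \<bullet> v = 0"
      using chart_mem unfolding annihilator_def Wc_def by (auto dest: bspec)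
  next
    assume *: "\<forall>w\<in>Wc c x. w \<bullet> v = 0"
    have "pairing M a (tvec c ?q v) = 0" if a: "a \<in> W" "fst a = ?q" for a
    proof -
      obtain w where w: "a = cvec c ?q w" using cotangent_cases[of a c] a W_CT chart_mem by (metis subsetD)
      then have "w \<in> Wc c x" using a by (simp add: Wc_def)
      then show ?thesis using * chart_mem by (simp add: w)
    qed
    then show "tvec c ?q v \<in> annihilator M W" using chart_mem by (simp add: annihilator_def)
  qed
  show ?thesis
  proof
    assume "cvec c ?q p \<in> What'"
    then obtain v where v: "v \<in> annihilator M W" "cvec c ?q p = fiber_deriv_inv M (kinetic M \<rho>') v"
      unfolding What_def by blast
    have vT: "v \<in> tangent_bundle M" using v(1) by (simp add: annihilator_def)
    \<comment> \<open>It is not yet known that \<open>v\<close> sits over \<open>?q\<close>, so it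
      is first written in a chart around its own base point.\<close>
    obtain d where d: "d \<in> charts_at M (fst v)" using chart_at tangent_points vT by blast
    note dM = charts_atD[OF d]
    have "v = tvec d (chart_inv d (snd d (fst v))) (snd v d)"
      using tvec_eq[OF vT d] dM by (simp add: chart_inv_chart)
    then have "fst (cvec c ?q p) = chart_inv d (snd d (fst v))"
      using inv[OF dM(1), of "snd d (fst v)" "snd v d"] v(2) dM(2) by (metis fst_cvec imageI)
    then have "fst v = ?q" using dM by (simp add: chart_inv_chart)
    then obtain w where w: "v = tvec c ?q w" using tangent_cases[OF vT, of c] chart_mem by metis
    then have "p = flat_coord \<rho>' c x w" using v(2) inv[OF c x] cvec_eq_iff[OF chart_mem] by simp
    then show "p \<in> Hc c x" using v(1) unfolding w ann Hc_def by (simp add: sharp_flat[OF metric' c x])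
  next
    assume p: "p \<in> Hc c x"
    then have "tvec c ?q (S' c x p) \<in> annihilator M W" unfolding ann Hc_def by simp
    moreover have "cvec c ?q p = fiber_deriv_inv M (kinetic M \<rho>') (tvec c ?q (S' c x p))"
      by (simp add: inv[OF c x] flat_sharp[OF metric' c x])
    ultimately show "cvec c ?q p \<in> What'" unfolding What_def by blast
  qed
qed

lemma What_in_CT: "a \<in> What' \<Longrightarrow> a \<in> CT"
proof -
  assume "a \<in> What'"
  then obtain v where v: "v \<in> annihilator M W" "a = fiber_deriv_inv M (kinetic M \<rho>') v"
    unfolding What_def by blast
  have vT: "v \<in> tangent_bundle M" using v(1) by (simp add: annihilator_def)
  obtain d where d: "d \<in> charts_at M (fst v)" using chart_at tangent_points vT by blast
  note dM = charts_atD[OF d]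
  have y: "snd d (fst v) \<in> img d" using dM by simp
  have "v = tvec d (chart_inv d (snd d (fst v))) (snd v d)"
    using tvec_eq[OF vT d] dM by (simp add: chart_inv_chart)
  moreover have "fiber_deriv_inv M (kinetic M \<rho>') (tvec d (chart_inv d (snd d (fst v))) (snd v d)) \<in> CT"
    by (subst fiber_deriv_inv_coord[OF metric' _ dM(1) y, where h = "\<lambda>_. 0"]) (simp_all add: cvec_in_CT[OF dM(1) y])
  ultimately show ?thesis using v(2) by metis
qed

lemma orthogonal_decomposition: "\<exists>p'\<in>Wc c x. p - p' \<in> Hc c x"
proof -
  obtain u where u: "form_orthogonal (\<lambda>p r. p \<bullet> S' c x r) k (\<lambda>i. u i x)" "Wc c x = span ((\<lambda>i. u i x) ` {..<k})"
    using orthogonal_frame[OF c x] by blast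
  let ?p = "form_proj (\<lambda>p r. p \<bullet> S' c x r) k (\<lambda>i. u i x) p"
  have "?p \<in> Wc c x" unfolding u(2) by (rule form_proj_in_span)
  moreover have "p - ?p \<in> Hc c x"
    unfolding Hc_def u(2) using form_proj_orthogonal[OF sharp_form u(1)] sharp_sym by simp
  ultimately show ?thesis by blast
qed

lemma Wc_Hc_zero: "p \<in> Wc c x \<Longrightarrow> p \<in> Hc c x \<Longrightarrow> p = 0"
  by (rule sharp_form_zero) (simp add: Hc_def)

text \<open>The difference of two candidates lies in \<open>W\<close> and in the complement at once,
  hence is zero.\<close>

lemma projW_unique:
  assumes p': "p' \<in> Wc c x" "p - p' \<in> Hc c x"
  shows "projW M W \<rho>' (cvec_at c x p) = cvec_at c x p'"
  unfolding projW_def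
proof (rule the_equality)
  let ?q = "chart_inv c x"
  have 1: "cvec c ?q (p - p') \<in> What'" using p'(2) by (simp add: What_coord)
  have 2: "cvec c ?q p = vadd (cvec c ?q p') (cvec c ?q (p - p'))" by (simp add: vadd_cvec[OF chart_mem])
  show "cvec c ?q p' \<in> W \<and> fst (cvec c ?q p') = fst (cvec c ?q p) \<and>
      (\<exists>\<sigma>\<in>What'. fst \<sigma> = fst (cvec c ?q p) \<and> cvec c ?q p = vadd (cvec c ?q p') \<sigma>)"
    using p'(1) by (intro conjI bexI[OF _ 1] 2) (simp_all add: Wc_def)
next
  let ?q = "chart_inv c x"
  fix \<gamma> assume \<gamma>: "\<gamma> \<in> W \<and> fst \<gamma> = fst (cvec c ?q p) \<and>
      (\<exists>\<sigma>\<in>What'. fst \<sigma> = fst (cvec c ?q p) \<and> cvec c ?q p = vadd \<gamma> \<sigma>)"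
  then obtain \<sigma> where \<sigma>: "\<sigma> \<in> What'" "fst \<sigma> = ?q" "cvec c ?q p = vadd \<gamma> \<sigma>" by auto
  obtain w where w: "\<gamma> = cvec c ?q w" using cotangent_cases[of \<gamma> c] \<gamma> W_CT chart_mem by (metis fst_cvec subsetD)
  obtain s where s: "\<sigma> = cvec c ?q s" using cotangent_cases[of \<sigma> c] What_in_CT \<sigma> chart_mem by metis
  have ws: "p = w + s" using \<sigma>(3) cvec_eq_iff[OF chart_mem] by (simp add: w s vadd_cvec[OF chart_mem])
  have "w \<in> Wc c x" using \<gamma> w by (simp add: Wc_def)
  moreover have "s \<in> Hc c x" using \<sigma>(1) by (simp add: s What_coord)
  ultimately have "w - p' \<in> Wc c x" "(p - p') - s \<in> Hc c x"
    using p' Wc_subspace Hc_subspace by (auto intro: subspace_diff)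
  then have "w - p' = 0" by (intro Wc_Hc_zero) (simp_all add: ws)
  then show "\<gamma> = cvec c ?q p'" by (simp add: w)
qed

lemma Pc_unique:
  assumes p': "p' \<in> Wc c x" "p - p' \<in> Hc c x"
  shows "Pc c x p = p'"
  unfolding Pc_def projW_unique[OF assms] using chart_mem by simp

lemma Pc: "Pc c x p \<in> Wc c x" "p - Pc c x p \<in> Hc c x"
proof -
  obtain p' where p': "p' \<in> Wc c x" "p - p' \<in> Hc c x" using orthogonal_decomposition by blast
  then show "Pc c x p \<in> Wc c x" "p - Pc c x p \<in> Hc c x" using Pc_unique[OF p'] by auto
qed

lemma projW_coord: "projW M W \<rho>' (cvec_at c x p) = cvec_at c x (Pc c x p)"
  by (rule projW_unique[OF Pc])

lemma Pc_Wc: "p \<in> Wc c x \<Longrightarrow> Pc c x p = p"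
  by (rule Pc_unique) (use subspace_0[OF Hc_subspace] in auto)

lemma Pc_Hc: "p \<in> Hc c x \<Longrightarrow> Pc c x p = 0"
  by (rule Pc_unique) (use subspace_0[OF Wc_subspace] in auto)

lemma Pc_eq_0_iff: "Pc c x p = 0 \<longleftrightarrow> p \<in> Hc c x"
  using Pc(2)[of p] Pc_Hc by auto

lemma linear_Pc: "linear (Pc c x)"
proof (rule linearI)
  fix p r s
  have "(p - Pc c x p) + (r - Pc c x r) \<in> Hc c x" "Pc c x p + Pc c x r \<in> Wc c x"
    using Pc subspace_add[OF Hc_subspace] subspace_add[OF Wc_subspace] by auto
  then show "Pc c x (p + r) = Pc c x p + Pc c x r" by (intro Pc_unique) (simp_all add: algebra_simps)
  have "s *\<^sub>R (p - Pc c x p) \<in> Hc c x" "s *\<^sub>R Pc c x p \<in> Wc c x"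
    using Pc subspace_scale[OF Hc_subspace] subspace_scale[OF Wc_subspace] by auto
  then show "Pc c x (s *\<^sub>R p) = s *\<^sub>R Pc c x p" by (intro Pc_unique) (simp_all add: algebra_simps)
qed

lemma Wc_orthogonal_Hc: "w \<in> Wc c x \<Longrightarrow> p \<in> Hc c x \<Longrightarrow> w \<bullet> S' c x p = 0 \<and> p \<bullet> S' c x w = 0"
  using sharp_sym by (auto simp: Hc_def)

end

text \<open>On the domain of an orthogonal frame the projection is the sum \<open>form_proj\<close>,
  whose coefficients are quotients of smooth functions; smoothness is then glued from such
  domains.\<close>

lemma smooth_Pc:
  assumes c: "c \<in> M" and S: "open S" "smooth_on S y" and y: "\<And>s. s \<in> S \<Longrightarrow> y s \<in> img c"
    and f: "smooth_on S f"
  shows "smooth_on S (\<lambda>s. Pc c (y s) (f s))"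
proof (rule smooth_on_locally)
  fix s0 assume s0: "s0 \<in> S"
  obtain V u where V: "open V" "y s0 \<in> V" "V \<subseteq> img c" and u: "\<And>i. i < k \<Longrightarrow> smooth_on V (u i)"
    "\<And>y. y \<in> V \<Longrightarrow> form_orthogonal (\<lambda>p r. p \<bullet> S' c y r) k (\<lambda>i. u i y)"
    "\<And>y. y \<in> V \<Longrightarrow> Wc c y = span ((\<lambda>i. u i y) ` {..<k})"
    using orthogonal_frame[OF c y[OF s0]] by blast
  let ?N = "{s \<in> S. y s \<in> V}"
  have oN: "open ?N" by (rule smooth_on_open_vimage[OF S(2,1) V(1)])
  have sy: "smooth_on ?N y" and sf: "smooth_on ?N f"
    using smooth_on_subset[OF S(2)] smooth_on_subset[OF f] by auto
  have su: "smooth_on ?N (\<lambda>s. u i (y s))" if "i < k" for i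
    by (rule smooth_on_compose[OF oN V(1) sy u(1)[OF that]]) simp
  have pos: "u i y \<bullet> S' c y (u i y) \<noteq> 0" if "y \<in> V" "i < k" for y i
    using sharp_form_zero[OF c, of y "u i y"] u(2)[OF that(1)] that V(3) by (auto simp: form_orthogonal_def)
  have "smooth_on ?N (\<lambda>s. \<Sum>i<k. (f s \<bullet> S' c (y s) (u i (y s)) / (u i (y s) \<bullet> S' c (y s) (u i (y s)))) *\<^sub>R u i (y s))"
    by (intro smooth_on_sum smooth_on_scaleR smooth_on_divide smooth_on_inner smooth_sharp[OF metric' c] oN sy sf su pos)
      (use y in auto)
  moreover have "Pc c (y s) (f s) = (\<Sum>i<k. (f s \<bullet> S' c (y s) (u i (y s)) / (u i (y s) \<bullet> S' c (y s) (u i (y s)))) *\<^sub>R u i (y s))"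
    if s: "s \<in> ?N" for s
  proof -
    have ys: "y s \<in> img c" "y s \<in> V" using s y by auto
    let ?p = "form_proj (\<lambda>p r. p \<bullet> S' c (y s) r) k (\<lambda>i. u i (y s)) (f s)"
    have "?p \<in> Wc c (y s)" unfolding u(3)[OF ys(2)] by (rule form_proj_in_span)
    moreover have "f s - ?p \<in> Hc c (y s)"
      unfolding Hc_def u(3)[OF ys(2)]
      using form_proj_orthogonal[OF sharp_form[OF c ys(1)] u(2)[OF ys(2)]] sharp_sym[OF c ys(1)] by simp
    ultimately have "Pc c (y s) (f s) = ?p" by (rule Pc_unique[OF c ys(1)])
    then show ?thesis by (simp add: form_proj_def)
  qed
  ultimately have "smooth_on ?N (\<lambda>s. Pc c (y s) (f s))" by (rule smooth_on_eq[OF oN])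
  then show "\<exists>V. open V \<and> s0 \<in> V \<and> smooth_on V (\<lambda>s. Pc c (y s) (f s))"
    using oN s0 V(2) by (intro exI[of _ ?N]) simp
qed

lemma What_CT: "What' \<subseteq> CT"
proof
  fix a assume a: "a \<in> What'"
  then obtain v where v: "v \<in> annihilator M W" unfolding What_def by blast
  then have "v \<in> tangent_bundle M" by (simp add: annihilator_def)
  then obtain d where d: "d \<in> charts_at M (fst v)" using chart_at tangent_points by blast
  show "a \<in> CT" by (rule What_in_CT[OF charts_atD(1)[OF d] _ a]) (use charts_atD(2)[OF d] in blast)
qed

lemma What_scale:
  assumes "\<sigma> \<in> What'"
  shows "vscale s \<sigma> \<in> What'"
proof -
  have \<sigma>: "\<sigma> \<in> CT" using assms What_CT by auto
  obtain c where c: "c \<in> charts_at M (fst \<sigma>)" using chart_at cotangent_points \<sigma> by blast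
  obtain x p where x: "x \<in> img c" "\<sigma> = cvec_at c x p"
    by (rule CT_chart_cases[OF \<sigma> charts_atD[OF c]]) (rule that; assumption)
  note cx = charts_atD(1)[OF c] x(1)
  show ?thesis
    using assms subspace_scale[OF Hc_subspace[OF cx]]
    by (simp add: x(2) vscale_cvec[OF chart_mem[OF cx]] What_coord[OF cx])
qed

text \<open>The representative of a linear form with respect to \<open>\<lambda>p r. p \<bullet> S' c x r\<close>.\<close>

definition rvec :: "('m, 'e) chart \<Rightarrow> 'e \<Rightarrow> ('e \<Rightarrow> real) \<Rightarrow> 'e" where
  "rvec c x L = (\<Sum>b\<in>Basis. L (flat_coord \<rho>' c x b) *\<^sub>R b)"

lemma smooth_flat:
  assumes c: "c \<in> M"
  shows "smooth_on (img c) (\<lambda>x. flat_coord \<rho>' c x v)"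
  unfolding flat_coord_def metric_coord_def
  using metric' by (intro smooth_on_sum smooth_on_scaleR smooth_on_const open_img[OF c] finite_Basis tangent_tensor2_smooth c)
    (simp add: riemannian_metric_def)

context
  fixes c x
  assumes c: "c \<in> M" and x: "x \<in> img c"
begin

lemma rvec_inner:
  assumes "linear L"
  shows "rvec c x L \<bullet> v = L (flat_coord \<rho>' c x v)"
proof -
  have "linear (\<lambda>v. L (flat_coord \<rho>' c x v))"
    using linear_compose[OF linear_flat_coord[OF metric' c x] assms] by (simp add: o_def)
  then show ?thesis unfolding rvec_def by (rule linear_inner_representation)
qed

lemma rvec_sharp: "linear L \<Longrightarrow> rvec c x L \<bullet> S' c x r = L r"
  by (simp add: rvec_inner flat_sharp[OF metric' c x])

lemma linear_Ups_diag: "linear (\<lambda>r. - Ups \<rho> \<rho>' c x p p r)"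
  using Ups_linear(3)[OF metric metric' c x] by (rule linear_compose_neg)

text \<open>The vector \<open>a\<close> represents \<open>- Ups\<close> against every direction.
  Removing its \<open>W\<close> part keeps the products with the complement and makes those with
  \<open>W\<close> vanish, as \<open>z_perp\<close> requires.\<close>

lemma z_perp_coord:
  fixes p
  defines "a \<equiv> rvec c x (\<lambda>r. - Ups \<rho> \<rho>' c x p p r)"
  shows "z_perp M \<Gamma> W \<rho> H' \<rho>' (cvec_at c x p) = cvec_at c x (a - Pc c x a)"
proof -
  let ?q = "chart_inv c x"
  note ch = chart_mem[OF c x]
  have aS: "a \<bullet> S' c x r = - Ups \<rho> \<rho>' c x p p r" for r
    unfolding a_def by (rule rvec_sharp[OF linear_Ups_diag])
  have gh: "ghat M H' (cvec c ?q z) (cvec c ?q r) = z \<bullet> S' c x r" for z r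
    by (rule ghat_coord[OF metric' c x H'_kinetic])
  have U: "Upsilon M \<Gamma> \<rho> \<rho>' (cvec c ?q p) (cvec c ?q p) (cvec c ?q r) = Ups \<rho> \<rho>' c x p p r" for r
    by (rule Upsilon_coord[OF metric metric' c x])
  show ?thesis
    unfolding z_perp_def
  proof (rule the_equality)
    have "ghat M H' (cvec c ?q (a - Pc c x a)) \<sigma> = 0" if \<sigma>: "\<sigma> \<in> W" "fst \<sigma> = ?q" for \<sigma>
    proof -
      obtain w where w: "\<sigma> = cvec c ?q w" using cotangent_cases[of \<sigma> c] \<sigma> W_CT ch by (metis subsetD)
      then have "w \<in> Wc c x" using \<sigma> by (simp add: Wc_def)
      then show ?thesis using Wc_orthogonal_Hc[OF c x _ Pc(2)[OF c x]] by (simp add: w gh)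
    qed
    moreover have "ghat M H' (cvec c ?q (a - Pc c x a)) \<sigma> = - Upsilon M \<Gamma> \<rho> \<rho>' (cvec c ?q p) (cvec c ?q p) \<sigma>"
      if \<sigma>: "\<sigma> \<in> What'" "fst \<sigma> = ?q" for \<sigma>
    proof -
      obtain r where r: "\<sigma> = cvec c ?q r" using cotangent_cases[of \<sigma> c] What_CT \<sigma> ch by (metis subsetD)
      then have "r \<in> Hc c x" using \<sigma> by (simp add: What_coord[OF c x])
      then show ?thesis using Wc_orthogonal_Hc[OF c x Pc(1)[OF c x]] by (simp add: r gh U inner_diff_left aS)
    qed
    ultimately show "cvec c ?q (a - Pc c x a) \<in> What' \<and> fst (cvec c ?q (a - Pc c x a)) = fst (cvec c ?q p) \<and>
      (\<forall>\<sigma>\<in>W. fst \<sigma> = fst (cvec c ?q p) \<longrightarrow> ghat M H' (cvec c ?q (a - Pc c x a)) \<sigma> = 0) \<and>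
      (\<forall>\<sigma>\<in>What'. fst \<sigma> = fst (cvec c ?q p) \<longrightarrow>
        ghat M H' (cvec c ?q (a - Pc c x a)) \<sigma> = - Upsilon M \<Gamma> \<rho> \<rho>' (cvec c ?q p) (cvec c ?q p) \<sigma>)"
      using Pc(2)[OF c x] by (simp add: What_coord[OF c x])
  next
    fix \<zeta> assume \<zeta>: "\<zeta> \<in> What' \<and> fst \<zeta> = fst (cvec c ?q p) \<and>
      (\<forall>\<sigma>\<in>W. fst \<sigma> = fst (cvec c ?q p) \<longrightarrow> ghat M H' \<zeta> \<sigma> = 0) \<and>
      (\<forall>\<sigma>\<in>What'. fst \<sigma> = fst (cvec c ?q p) \<longrightarrow>
        ghat M H' \<zeta> \<sigma> = - Upsilon M \<Gamma> \<rho> \<rho>' (cvec c ?q p) (cvec c ?q p) \<sigma>)"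
    then obtain z where z: "\<zeta> = cvec c ?q z" using cotangent_cases[of \<zeta> c] What_CT ch by (metis fst_cvec subsetD)
    have zH: "z \<in> Hc c x" using \<zeta> by (simp add: z What_coord[OF c x])
    have 1: "z \<bullet> S' c x r = - Ups \<rho> \<rho>' c x p p r" if "r \<in> Hc c x" for r
    proof -
      have "cvec c ?q r \<in> What'" using that by (simp add: What_coord[OF c x])
      then have "ghat M H' \<zeta> (cvec c ?q r) = - Upsilon M \<Gamma> \<rho> \<rho>' (cvec c ?q p) (cvec c ?q p) (cvec c ?q r)"
        using \<zeta> by simp
      then show ?thesis by (simp add: z gh U)
    qed
    have D: "z - (a - Pc c x a) \<in> Hc c x" (is "?D \<in> _") using zH Pc(2)[OF c x] subspace_diff[OF Hc_subspace[OF c x]] by blast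
    \<comment> \<open>The difference of two solutions lies in the complement and is orthogonal to
      it, in particular to itself.\<close>
    have "?D \<bullet> S' c x ?D = z \<bullet> S' c x ?D - a \<bullet> S' c x ?D + Pc c x a \<bullet> S' c x ?D"
      by (simp add: inner_diff_left)
    also have "\<dots> = 0" using 1[OF D] aS Wc_orthogonal_Hc[OF c x Pc(1)[OF c x] D] by simp
    finally have "?D = 0" by (rule sharp_form_zero[OF c x])
    then show "\<zeta> = cvec c ?q (a - Pc c x a)" by (simp add: z)
  qed
qed

lemma gyroscopic_force_coord:
  assumes L: "linear (\<lambda>r. Z (cvec_at c x p) (cvec_at c x p) (cvec_at c x r))"
      (is "linear ?L")
  shows "gyroscopic_force M H' Z (cvec_at c x p) = cvec_at c x (rvec c x ?L)"
proof -
  let ?q = "chart_inv c x"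
  note ch = chart_mem[OF c x]
  have inv: "fiber_deriv_inv M H' (tvec c ?q v) = cvec c ?q (flat_coord \<rho>' c x v)" for v
    by (rule fiber_deriv_inv_coord[OF metric' H'_kinetic c x])
  show ?thesis
    unfolding gyroscopic_force_def
  proof (rule the_equality)
    have "pairing M (cvec c ?q (rvec c x ?L)) v = Z (cvec c ?q p) (cvec c ?q p) (fiber_deriv_inv M H' v)"
      if v: "v \<in> tangent_bundle M" "fst v = ?q" for v
    proof -
      obtain w where w: "v = tvec c ?q w" using tangent_cases[of v c] v ch by metis
      show ?thesis using ch by (simp add: w inv rvec_inner[OF L])
    qed
    then show "cvec c ?q (rvec c x ?L) \<in> CT \<and> fst (cvec c ?q (rvec c x ?L)) = fst (cvec c ?q p) \<and>
      (\<forall>v\<in>tangent_bundle M. fst v = fst (cvec c ?q p) \<longrightarrow>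
        pairing M (cvec c ?q (rvec c x ?L)) v = Z (cvec c ?q p) (cvec c ?q p) (fiber_deriv_inv M H' v))"
      using ch by simp
  next
    fix \<beta> assume \<beta>: "\<beta> \<in> CT \<and> fst \<beta> = fst (cvec c ?q p) \<and>
      (\<forall>v\<in>tangent_bundle M. fst v = fst (cvec c ?q p) \<longrightarrow>
        pairing M \<beta> v = Z (cvec c ?q p) (cvec c ?q p) (fiber_deriv_inv M H' v))"
    then obtain b where b: "\<beta> = cvec c ?q b" using cotangent_cases[of \<beta> c] ch by (metis fst_cvec)
    have "b \<bullet> w = rvec c x ?L \<bullet> w" for w
    proof -
      have "pairing M \<beta> (tvec c ?q w) = Z (cvec c ?q p) (cvec c ?q p) (fiber_deriv_inv M H' (tvec c ?q w))"
        using \<beta> ch by simp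
      then show ?thesis using ch by (simp add: b inv rvec_inner[OF L])
    qed
    then have "b = rvec c x ?L" using vector_eq_rdot by blast
    then show "\<beta> = cvec c ?q (rvec c x ?L)" by (simp add: b)
  qed
qed

text \<open>
  On the complement of \<open>W\<close> both \<open>z_perp\<close> and the gyroscopic force are determined by \<open>Upsilon\<close>,
  with opposite signs.
\<close>

lemma rvec_complement:
  assumes L: "linear L" and LU: "\<And>r. r \<in> Hc c x \<Longrightarrow> L r = Ups \<rho> \<rho>' c x p p r"
  defines "a \<equiv> rvec c x (\<lambda>r. - Ups \<rho> \<rho>' c x p p r)" and "g \<equiv> rvec c x L"
  shows "g - Pc c x g = - (a - Pc c x a)"
proof -
  \<comment> \<open>\<open>?D\<close> is the complement part of \<open>g + a\<close>. The values of
    \<open>Ups\<close> cancel, so \<open>g + a\<close> is orthogonal to the whole complement, and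
    \<open>?D\<close> is orthogonal to itself.\<close>
  have D: "(g + a) - Pc c x (g + a) \<in> Hc c x" (is "?D \<in> _") by (rule Pc(2)[OF c x])
  have "(g + a) \<bullet> S' c x ?D = 0"
    using LU[OF D] by (simp add: inner_add_left g_def a_def rvec_sharp[OF L] rvec_sharp[OF linear_Ups_diag])
  then have "?D \<bullet> S' c x ?D = 0"
    using Wc_orthogonal_Hc[OF c x Pc(1)[OF c x] D] by (simp add: inner_diff_left[of "g + a" "Pc c x (g + a)"])
  then have "?D = 0" by (rule sharp_form_zero[OF c x])
  then show ?thesis using linear_add[OF linear_Pc[OF c x], of g a] by (simp add: algebra_simps)
qed

end

end

section \<open>The canonical gyroscopic tensor\<close>

context atlas
begin

lemma fiber_linear_coord:
  assumes ch: "c \<in> charts_at M q"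
  shows "fiber_linear CT q L \<longleftrightarrow> linear (\<lambda>p. L (cvec c q p))"
proof
  assume "fiber_linear CT q L"
  then show "linear (\<lambda>p. L (cvec c q p))"
    using ch unfolding fiber_linear_def
    by (intro linearI) (simp_all add: vadd_cvec[symmetric] vscale_cvec[symmetric])
next
  assume l: "linear (\<lambda>p. L (cvec c q p))"
  have rep: "\<exists>p. a = cvec c q p" if "a \<in> CT" "fst a = q" for a
    using cotangent_cases[of a c] that ch by metis
  have "L (vadd a b) = L a + L b" if ab: "a \<in> CT" "b \<in> CT" "fst a = q" "fst b = q" for a b
  proof -
    obtain p r where "a = cvec c q p" "b = cvec c q r" using rep ab by metis
    then show ?thesis by (simp add: vadd_cvec[OF ch] linear_add[OF l])
  qed
  moreover have "L (vscale s a) = s * L a" if a: "a \<in> CT" "fst a = q" for a s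
  proof -
    obtain p where "a = cvec c q p" using rep a by metis
    then show ?thesis by (simp add: vscale_cvec[OF ch] linear_cmul[OF l])
  qed
  ultimately show "fiber_linear CT q L" unfolding fiber_linear_def by blast
qed

lemma CT_coord_cases:
  assumes "a \<in> CT"
  obtains c x p where "c \<in> M" "x \<in> img c" "a = cvec_at c x p"
proof -
  obtain c where c: "c \<in> charts_at M (fst a)" using chart_at cotangent_points assms by blast
  show ?thesis
    by (rule CT_chart_cases[OF assms charts_atD[OF c]]) (rule that[OF charts_atD(1)[OF c]]; assumption)
qed

lemma CT_same_fiber:
  assumes "b \<in> CT" "fst b = chart_inv c x" "c \<in> M" "x \<in> img c"
  obtains p where "b = cvec_at c x p"
  using cotangent_cases[of b c] assms chart_inv_charts_at by metis

lemma tensor3_linear: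
  assumes T: "tensor3 M CT CT CT T" and c: "c \<in> M" and x: "x \<in> img c"
  shows "linear (\<lambda>p. T (cvec_at c x p) (cvec_at c x p2) (cvec_at c x p3))"
    and "linear (\<lambda>p. T (cvec_at c x p1) (cvec_at c x p) (cvec_at c x p3))"
    and "linear (\<lambda>p. T (cvec_at c x p1) (cvec_at c x p2) (cvec_at c x p))"
proof -
  let ?q = "chart_inv c x"
  note in' = cvec_in_CT[OF c x]
  note coord = fiber_linear_coord[OF chart_inv_charts_at[OF c x], THEN iffD1]
  have T1: "\<forall>a2\<in>CT. \<forall>a3\<in>CT. fst a2 = fst a3 \<longrightarrow> fiber_linear CT (fst a2) (\<lambda>a1. T a1 a2 a3)"
    and T2: "\<forall>a1\<in>CT. \<forall>a3\<in>CT. fst a1 = fst a3 \<longrightarrow> fiber_linear CT (fst a1) (\<lambda>a2. T a1 a2 a3)"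
    and T3: "\<forall>a1\<in>CT. \<forall>a2\<in>CT. fst a1 = fst a2 \<longrightarrow> fiber_linear CT (fst a1) (\<lambda>a3. T a1 a2 a3)"
    using T unfolding tensor3_def by blast+
  show "linear (\<lambda>p. T (cvec c ?q p) (cvec c ?q p2) (cvec c ?q p3))"
    using T1[rule_format, OF in'[of p2] in'[of p3]] by (intro coord) simp
  show "linear (\<lambda>p. T (cvec c ?q p1) (cvec c ?q p) (cvec c ?q p3))"
    using T2[rule_format, OF in'[of p1] in'[of p3]] by (intro coord) simp
  show "linear (\<lambda>p. T (cvec c ?q p1) (cvec c ?q p2) (cvec c ?q p))"
    using T3[rule_format, OF in'[of p1] in'[of p2]] by (intro coord) simp
qed

lemma tensor3I:
  assumes s: "\<And>c. c \<in> M \<Longrightarrow> smooth_on (coords c)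
      (\<lambda>(x, p1, p2, p3). T (cvec_at c x p1) (cvec_at c x p2) (cvec_at c x p3))"
    and l: "\<And>c x p1 p2 p3. c \<in> M \<Longrightarrow> x \<in> img c \<Longrightarrow>
      linear (\<lambda>p. T (cvec_at c x p) (cvec_at c x p2) (cvec_at c x p3)) \<and>
      linear (\<lambda>p. T (cvec_at c x p1) (cvec_at c x p) (cvec_at c x p3)) \<and>
      linear (\<lambda>p. T (cvec_at c x p1) (cvec_at c x p2) (cvec_at c x p))"
  shows "tensor3 M CT CT CT T"
proof -
  have F: "fiber_linear CT (fst a) (\<lambda>a1. T a1 a b) \<and> fiber_linear CT (fst a) (\<lambda>a2. T a a2 b) \<and>
      fiber_linear CT (fst a) (\<lambda>a3. T a b a3)" if a: "a \<in> CT" "b \<in> CT" "fst a = fst b" for a b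
  proof -
    obtain c x p where c: "c \<in> M" "x \<in> img c" "a = cvec_at c x p"
      using CT_coord_cases[OF a(1)] by blast
    obtain r where r: "b = cvec_at c x r"
      using CT_same_fiber[OF a(2) _ c(1,2)] a(3) c(3) by (metis fst_cvec)
    show ?thesis
      using l[OF c(1,2)] by (simp add: c(3) r fiber_linear_coord[OF chart_inv_charts_at[OF c(1,2)]])
  qed
  show ?thesis
    unfolding tensor3_def
    by (intro conjI ballI impI smooth_whitney3I[of T, OF s] F[THEN conjunct1]
        F[THEN conjunct2, THEN conjunct1] F[THEN conjunct2, THEN conjunct2])
qed

text \<open>Smoothness on a subset asks for local extensions; here the zero function on a chart
  neighbourhood is one.\<close>

lemma tensor3_zero:
  assumes "V1 \<subseteq> CT" "V2 \<subseteq> CT" "V3 \<subseteq> CT"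
  shows "tensor3 M V1 V2 V3 (\<lambda>_ _ _. 0)"
proof -
  have "smooth_fun_on_subset (whitney3_chart CT ` M) CT3 (\<lambda>(a1, a2, a3). 0)"
    by (rule smooth_whitney3I[of "\<lambda>_ _ _. 0"]) (simp add: smooth_on_const case_prod_unfold)
  then have "smooth_fun_on_subset (whitney3_chart CT ` M)
      {(a1, a2, a3). a1 \<in> V1 \<and> a2 \<in> V2 \<and> a3 \<in> V3 \<and> fst a1 = fst a2 \<and> fst a1 = fst a3} (\<lambda>(a1, a2, a3). 0)"
    unfolding smooth_fun_on_subset_def
  proof (intro ballI)
    fix m
    assume *: "\<forall>m\<in>CT3. \<exists>c\<in>charts_at (whitney3_chart CT ` M) m. \<exists>V G. open V \<and> snd c m \<in> V \<and>
        V \<subseteq> img c \<and> smooth_on V G \<and>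
        (\<forall>x\<in>V. chart_inv c x \<in> CT3 \<longrightarrow> G x = (case chart_inv c x of (a1, a2, a3) \<Rightarrow> 0))"
      and m: "m \<in> {(a1, a2, a3). a1 \<in> V1 \<and> a2 \<in> V2 \<and> a3 \<in> V3 \<and> fst a1 = fst a2 \<and> fst a1 = fst a3}"
    have "m \<in> CT3" using m assms by auto
    from *[THEN bspec, OF this] obtain c V where "c \<in> charts_at (whitney3_chart CT ` M) m"
      "open V" "snd c m \<in> V" "V \<subseteq> img c"
      by (elim bexE exE conjE) (rule that; assumption)
    then show "\<exists>c\<in>charts_at (whitney3_chart CT ` M) m. \<exists>V G. open V \<and> snd c m \<in> V \<and>
        V \<subseteq> img c \<and> smooth_on V G \<and>
        (\<forall>x\<in>V. chart_inv c x \<in> {(a1, a2, a3). a1 \<in> V1 \<and> a2 \<in> V2 \<and> a3 \<in> V3 \<and> fst a1 = fst a2 \<and> fst a1 = fst a3} \<longrightarrow>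
          G x = (case chart_inv c x of (a1, a2, a3) \<Rightarrow> 0))"
      by (intro bexI[of _ c] exI[of _ V] exI[of _ "\<lambda>_. 0"]) (simp_all add: smooth_on_const case_prod_unfold)
  qed
  then show ?thesis by (simp add: tensor3_def fiber_linear_def)
qed

lemma fiber_preserving_vadd:
  assumes "fiber_preserving M z1" "fiber_preserving M z2"
  shows "fiber_preserving M (\<lambda>a. vadd (z1 a) (z2 a))" and "fiber_preserving M (\<lambda>a. vsub (z1 a) (z2 a))"
proof -
  note z = fiber_preservingD[OF assms(1)] fiber_preservingD[OF assms(2)]
  have in': "vadd (z1 a) (z2 a) \<in> CT \<and> fst (vadd (z1 a) (z2 a)) = fst a"
    "vsub (z1 a) (z2 a) \<in> CT \<and> fst (vsub (z1 a) (z2 a)) = fst a" if a: "a \<in> CT" for a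
  proof -
    obtain c x p where c: "c \<in> M" "x \<in> img c" "a = cvec_at c x p"
      using CT_coord_cases[OF a] by blast
    obtain r1 where r1: "z1 a = cvec_at c x r1"
      using CT_same_fiber[OF z(1)[OF a] _ c(1,2)] z(2)[OF a] c(3) by (metis fst_cvec)
    obtain r2 where r2: "z2 a = cvec_at c x r2"
      using CT_same_fiber[OF z(4)[OF a] _ c(1,2)] z(5)[OF a] c(3) by (metis fst_cvec)
    note ch = chart_inv_charts_at[OF c(1,2)]
    show "vadd (z1 a) (z2 a) \<in> CT \<and> fst (vadd (z1 a) (z2 a)) = fst a"
      "vsub (z1 a) (z2 a) \<in> CT \<and> fst (vsub (z1 a) (z2 a)) = fst a"
      unfolding r1 r2 using ch by (simp_all add: c(3) vadd_cvec vsub_cvec)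
  qed
  show "fiber_preserving M (\<lambda>a. vadd (z1 a) (z2 a))"
  proof (rule fiber_preservingI[OF in'(1)])
    fix c assume c: "c \<in> M"
    show "smooth_on (coords c)
        (\<lambda>(x, p). snd (vadd (z1 (cvec_at c x p)) (z2 (cvec_at c x p))) c)"
      using smooth_on_add[OF open_coords[OF c] z(3)[OF c] z(6)[OF c]] by (simp add: vadd_def case_prod_unfold)
  qed
  show "fiber_preserving M (\<lambda>a. vsub (z1 a) (z2 a))"
  proof (rule fiber_preservingI[OF in'(2)])
    fix c assume c: "c \<in> M"
    show "smooth_on (coords c)
        (\<lambda>(x, p). snd (vsub (z1 (cvec_at c x p)) (z2 (cvec_at c x p))) c)"
      using smooth_on_diff[OF open_coords[OF c] z(3)[OF c] z(6)[OF c]]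
      by (simp add: vsub_def vadd_def vscale_def case_prod_unfold)
  qed
qed

text \<open>Passing to the zero covector of the same fiber lowers \<open>H\<close> by the kinetic
  energy of \<open>p\<close>. As the value at \<open>p\<close> is already the minimum
  \<open>0\<close>, the kinetic energy vanishes.\<close>

lemma positive_definite_zero:
  assumes H: "simple_with M H \<rho> h" and pd: "positive_definite_wrt M H (cvec_at c x p)"
    and c: "c \<in> M" and x: "x \<in> img c"
  shows "p = 0"
proof (rule ccontr)
  assume p: "p \<noteq> 0"
  have \<rho>: "riemannian_metric M \<rho>" and Hk: "\<And>a. a \<in> CT \<Longrightarrow> H a = kinetic M \<rho> a + h (fst a)"
    using H by (auto simp: simple_with_def)
  note HC = Hk[OF cvec_in_CT[OF c x]]
  have "H (cvec_at c x p) = 0" "H (cvec_at c x 0) \<ge> 0"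
    using pd cvec_in_CT[OF c x] unfolding positive_definite_wrt_def by auto
  then have "p \<bullet> sharp_coord \<rho> c x p \<le> 0" by (simp add: HC kinetic_coord[OF \<rho> c x])
  then show False using inner_formD(4)[OF inner_form_sharp_coord[OF \<rho> c x] p] by simp
qed

end

context actuated_system
begin

lemma fiber_preserving_projW:
  assumes "fiber_preserving M z"
  shows "fiber_preserving M (\<lambda>a. projW M W \<rho>' (z a))"
proof (rule fiber_preservingI)
  note z = fiber_preservingD[OF assms]
  show "projW M W \<rho>' (z a) \<in> CT \<and> fst (projW M W \<rho>' (z a)) = fst a" if a: "a \<in> CT" for a
  proof -
    obtain c x p where c: "c \<in> M" "x \<in> img c" "z a = cvec_at c x p"
      using CT_coord_cases[OF z(1)[OF a]] by blast
    have "projW M W \<rho>' (z a) = cvec_at c x (Pc c x p)"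
      unfolding c(3) by (rule projW_coord[OF c(1,2)])
    moreover have "chart_inv c x = fst a" using z(2)[OF a] c(3) by (metis fst_cvec)
    ultimately show ?thesis using chart_mem[OF c(1,2)] by simp
  qed
  fix c assume c: "c \<in> M"
  have "smooth_on (coords c) (\<lambda>y. Pc c (fst y) (snd (z (cvec_at c (fst y) (snd y))) c))"
    using z(3)[OF c]
    by (intro smooth_Pc[OF c] open_coords[OF c] smooth_on_fst smooth_on_id) (auto simp: case_prod_unfold)
  then show "smooth_on (coords c) (\<lambda>(x, p). snd (projW M W \<rho>' (z (cvec_at c x p))) c)"
  proof (rule smooth_on_eq[OF open_coords[OF c]])
    fix y :: "'e \<times> 'e" assume y: "y \<in> coords c"
    then have yx: "fst y \<in> img c" by auto
    let ?a = "cvec_at c (fst y) (snd y)"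
    have a: "?a \<in> CT" by (rule cvec_in_CT[OF c yx])
    obtain r where r: "z ?a = cvec_at c (fst y) r"
      using CT_same_fiber[OF z(1)[OF a] _ c yx] z(2)[OF a] by (metis fst_cvec)
    show "(\<lambda>(x, p). snd (projW M W \<rho>' (z (cvec_at c x p))) c) y =
        Pc c (fst y) (snd (z ?a) c)"
      using chart_mem[OF c yx] by (simp add: case_prod_unfold r projW_coord[OF c yx])
  qed
qed

lemma projW_in_W:
  assumes "a \<in> CT"
  shows "projW M W \<rho>' a \<in> W"
proof -
  obtain c x p where c: "c \<in> M" "x \<in> img c" "a = cvec_at c x p"
    using CT_coord_cases[OF assms] by blast
  show ?thesis using Pc(1)[OF c(1,2), of p] by (simp add: c(3) projW_coord[OF c(1,2)] Wc_def)
qed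

lemma W_coord_cases:
  assumes "a \<in> W" "fst a = chart_inv c x" "c \<in> M" "x \<in> img c"
  obtains w where "w \<in> Wc c x" "a = cvec_at c x w"
  using CT_same_fiber[OF _ assms(2-4)] assms(1) W_CT unfolding Wc_def by (metis (mono_tags) mem_Collect_eq subsetD)

lemma What_coord_cases:
  assumes "a \<in> What'" "fst a = chart_inv c x" "c \<in> M" "x \<in> img c"
  obtains s where "s \<in> Hc c x" "a = cvec_at c x s"
  using CT_same_fiber[OF _ assms(2-4)] assms(1) What_CT What_coord[OF assms(3,4)] by (metis subsetD)

text \<open>The first summand carries the values with last argument in the complement, the next two
  those on two complement arguments followed by one from \<open>W\<close>, and the last two the
  mixed ones. On three arguments from \<open>W\<close> all summands vanish.\<close>

definition canonical_coord :: "('m, 'e) chart \<Rightarrow> 'e \<Rightarrow> 'e \<Rightarrow> 'e \<Rightarrow> 'e \<Rightarrow> real" where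
  "canonical_coord c x p1 p2 p3 = (let U = Ups \<rho> \<rho>' c x; P = Pc c x in
     U p1 p2 (p3 - P p3) - U (P p3) (p2 - P p2) (p1 - P p1) - U (P p3) (p1 - P p1) (p2 - P p2) -
     1/2 * U (P p1) (P p3) (p2 - P p2) - 1/2 * U (P p2) (P p3) (p1 - P p1))"

text \<open>The tensor that \<open>gyroscopic_tensor\<close> prescribes when \<open>A\<close> and \<open>B\<close> vanish.\<close>

definition canonical_tensor :: "('m, 'e) fvec \<Rightarrow> ('m, 'e) fvec \<Rightarrow> ('m, 'e) fvec \<Rightarrow> real" where
  "canonical_tensor a1 a2 a3 = (let U = Upsilon M \<Gamma> \<rho> \<rho>'; P = projW M W \<rho>' in
     U a1 a2 (vsub a3 (P a3)) - U (P a3) (vsub a2 (P a2)) (vsub a1 (P a1)) -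
     U (P a3) (vsub a1 (P a1)) (vsub a2 (P a2)) -
     1/2 * U (P a1) (P a3) (vsub a2 (P a2)) - 1/2 * U (P a2) (P a3) (vsub a1 (P a1)))"

context
  fixes c x
  assumes c: "c \<in> M" and x: "x \<in> img c"
begin

lemma canonical_tensor_coord:
  "canonical_tensor (cvec_at c x p1) (cvec_at c x p2) (cvec_at c x p3) =
    canonical_coord c x p1 p2 p3"
  by (simp add: canonical_tensor_def canonical_coord_def Let_def projW_coord[OF c x] vsub_cvec[OF chart_mem[OF c x]]
      Upsilon_coord[OF metric metric' c x])

lemma canonical_coord_linear:
  "linear (\<lambda>p. canonical_coord c x p p2 p3)" "linear (\<lambda>p. canonical_coord c x p1 p p3)" "linear (canonical_coord c x p1 p2)"
proof -
  note lin = Ups_linear(1-3)[OF metric metric' c x] linear_Pc[OF c x]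
  note simps = lin[THEN linear_add] lin[THEN linear_diff] lin[THEN linear_cmul]
  show "linear (\<lambda>p. canonical_coord c x p p2 p3)" "linear (\<lambda>p. canonical_coord c x p1 p p3)" "linear (canonical_coord c x p1 p2)"
    by (rule linearI; simp add: canonical_coord_def Let_def simps algebra_simps add_divide_distrib diff_divide_distrib)+
qed

end

lemma smooth_canonical_coord:
  assumes c: "c \<in> M"
  shows "smooth_on (coords c) (\<lambda>(x, p1, p2, p3). canonical_coord c x p1 p2 p3)"
proof -
  let ?S = "coords c :: ('e \<times> 'e \<times> 'e \<times> 'e) set"
  note oS = open_coords[OF c, where 'a = "'e \<times> 'e \<times> 'e"]
  note U = smooth_Ups[OF metric metric' c oS] and P = smooth_Pc[OF c oS]
  have s: "smooth_on ?S fst" "smooth_on ?S (\<lambda>y. fst (snd y))" "smooth_on ?S (\<lambda>y. fst (snd (snd y)))"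
    "smooth_on ?S (\<lambda>y. snd (snd (snd y)))"
    by (intro smooth_on_fst smooth_on_snd smooth_on_id oS)+
  have i: "fst y \<in> img c" if "y \<in> ?S" for y using that by auto
  show ?thesis
    unfolding canonical_coord_def Let_def case_prod_unfold
    by (intro smooth_on_diff smooth_on_mult smooth_on_const U P s i oS)
qed

lemma canonical_tensor_tensor3: "tensor3 M CT CT CT canonical_tensor"
proof (rule tensor3I)
  fix c assume c: "c \<in> M"
  show "smooth_on (coords c) (\<lambda>(x, p1, p2, p3). canonical_tensor (cvec_at c x p1)
      (cvec_at c x p2) (cvec_at c x p3))"
    by (rule smooth_on_eq[OF open_coords[OF c] smooth_canonical_coord[OF c]]) (auto simp: canonical_tensor_coord[OF c])
qed (use canonical_coord_linear in \<open>simp add: canonical_tensor_coord\<close>)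

text \<open>On each prescribed combination of arguments the projection fixes or annihilates every
  argument, so all summands except the required ones drop out.\<close>

lemma canonical_gyroscopic_tensor:
  "gyroscopic_tensor M \<Gamma> W \<rho> \<rho>' (\<lambda>_ _ _. 0) (\<lambda>_ _ _. 0) canonical_tensor"
  unfolding gyroscopic_tensor_def Let_def
proof (intro conjI ballI impI canonical_tensor_tensor3 tensor3_zero W_CT What_CT)
  have U: "Upsilon M \<Gamma> \<rho> \<rho>' (cvec_at c x p1) (cvec_at c x p2) (cvec_at c x p3) =
      Ups \<rho> \<rho>' c x p1 p2 p3" if "c \<in> M" "x \<in> img c" for c x p1 p2 p3
    by (rule Upsilon_coord[OF metric metric' that])
  have z: "Ups \<rho> \<rho>' c x 0 p2 p3 = 0" "Ups \<rho> \<rho>' c x p1 0 p3 = 0" "Ups \<rho> \<rho>' c x p1 p2 0 = 0" "Pc c x 0 = 0"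
    if "c \<in> M" "x \<in> img c" for c x p1 p2 p3
    using Ups_linear(1-3)[OF metric metric' that, THEN linear_0] linear_0[OF linear_Pc[OF that]] by simp_all
  note simps = canonical_tensor_coord U canonical_coord_def Let_def Pc_Wc Pc_Hc z
  {
    fix a1 a2 \<sigma> assume a: "a1 \<in> CT" "a2 \<in> CT" "\<sigma> \<in> What'" "fst a1 = fst a2" "fst a1 = fst \<sigma>"
    obtain c x p1 where c: "c \<in> M" "x \<in> img c" "a1 = cvec_at c x p1"
      using CT_coord_cases[OF a(1)] by blast
    obtain p2 where p2: "a2 = cvec_at c x p2"
      using CT_same_fiber[OF a(2) _ c(1,2)] a(4) c(3) by (metis fst_cvec)
    obtain s where s: "s \<in> Hc c x" "\<sigma> = cvec_at c x s"
      using What_coord_cases[OF a(3) _ c(1,2)] a(5) c(3) by (metis fst_cvec)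
    show "canonical_tensor a1 a2 \<sigma> = Upsilon M \<Gamma> \<rho> \<rho>' a1 a2 \<sigma>"
      using c(1,2) s(1) by (simp add: c(3) p2 s(2) simps)
  next
    fix \<sigma>1 \<sigma>2 \<gamma> assume a: "\<sigma>1 \<in> What'" "\<sigma>2 \<in> What'" "\<gamma> \<in> W" "fst \<sigma>1 = fst \<sigma>2" "fst \<sigma>1 = fst \<gamma>"
    obtain c x p where c: "c \<in> M" "x \<in> img c" "\<sigma>1 = cvec_at c x p"
      using CT_coord_cases a(1) What_CT by (metis subsetD)
    have p: "p \<in> Hc c x" using a(1) by (simp add: c(3) What_coord[OF c(1,2)])
    obtain s where s: "s \<in> Hc c x" "\<sigma>2 = cvec_at c x s"
      using What_coord_cases[OF a(2) _ c(1,2)] a(4) c(3) by (metis fst_cvec)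
    obtain w where w: "w \<in> Wc c x" "\<gamma> = cvec_at c x w"
      using W_coord_cases[OF a(3) _ c(1,2)] a(5) c(3) by (metis fst_cvec)
    show "canonical_tensor \<sigma>1 \<sigma>2 \<gamma> = - Upsilon M \<Gamma> \<rho> \<rho>' \<gamma> \<sigma>2 \<sigma>1 - Upsilon M \<Gamma> \<rho> \<rho>' \<gamma> \<sigma>1 \<sigma>2"
      using c(1,2) s(1) w(1) p by (simp add: c(3) w(2) s(2) simps)
  next
    fix \<gamma>1 \<sigma> \<gamma>2 assume a: "\<gamma>1 \<in> W" "\<sigma> \<in> What'" "\<gamma>2 \<in> W" "fst \<gamma>1 = fst \<sigma>" "fst \<gamma>1 = fst \<gamma>2"
    obtain c x p where c: "c \<in> M" "x \<in> img c" "\<gamma>1 = cvec_at c x p"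
      using CT_coord_cases a(1) W_CT by (metis subsetD)
    have p: "p \<in> Wc c x" using a(1) by (simp add: c(3) Wc_def)
    obtain s where s: "s \<in> Hc c x" "\<sigma> = cvec_at c x s"
      using What_coord_cases[OF a(2) _ c(1,2)] a(4) c(3) by (metis fst_cvec)
    obtain w where w: "w \<in> Wc c x" "\<gamma>2 = cvec_at c x w"
      using W_coord_cases[OF a(3) _ c(1,2)] a(5) c(3) by (metis fst_cvec)
    show "canonical_tensor \<gamma>1 \<sigma> \<gamma>2 = - 1/2 * (Upsilon M \<Gamma> \<rho> \<rho>' \<gamma>1 \<gamma>2 \<sigma> + 0)"
      "canonical_tensor \<sigma> \<gamma>1 \<gamma>2 = - 1/2 * (Upsilon M \<Gamma> \<rho> \<rho>' \<gamma>1 \<gamma>2 \<sigma> + 0)"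
      using c(1,2) s(1) w(1) p by (simp_all add: c(3) w(2) s(2) simps)
  next
    fix \<gamma>1 \<gamma>2 \<gamma>3 assume a: "\<gamma>1 \<in> W" "\<gamma>2 \<in> W" "\<gamma>3 \<in> W" "fst \<gamma>1 = fst \<gamma>2" "fst \<gamma>1 = fst \<gamma>3"
    obtain c x p where c: "c \<in> M" "x \<in> img c" "\<gamma>1 = cvec_at c x p"
      using CT_coord_cases a(1) W_CT by (metis subsetD)
    have p: "p \<in> Wc c x" using a(1) by (simp add: c(3) Wc_def)
    obtain w where w: "w \<in> Wc c x" "\<gamma>2 = cvec_at c x w"
      using W_coord_cases[OF a(2) _ c(1,2)] a(4) c(3) by (metis fst_cvec)
    obtain r where r: "r \<in> Wc c x" "\<gamma>3 = cvec_at c x r"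
      using W_coord_cases[OF a(3) _ c(1,2)] a(5) c(3) by (metis fst_cvec)
    show "canonical_tensor \<gamma>1 \<gamma>2 \<gamma>3 = 0"
      using c(1,2) r(1) w(1) p by (simp add: c(3) w(2) r(2) simps)
  }
qed simp_all

end

section \<open>Equivalence of the two methods\<close>

locale gyroscopic_system = actuated_system M \<Gamma> k W \<rho> \<rho>' H' h'
  for M :: "('m, 'e::euclidean_space) chart set" and \<Gamma> :: "('m, 'e) christoffel"
    and k :: nat and W :: "('m, 'e) fvec set" and \<rho> \<rho>' H' h' +
  fixes h :: "'m \<Rightarrow> real"
    and A B Z :: "('m, 'e) fvec \<Rightarrow> ('m, 'e) fvec \<Rightarrow> ('m, 'e) fvec \<Rightarrow> real"
  assumes CH: "CH_equations M \<Gamma> W \<rho> h \<rho>' h'" and gyro: "gyroscopic_tensor M \<Gamma> W \<rho> \<rho>' A B Z"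
begin

definition gyro_force :: "('m, 'e) fvec \<Rightarrow> ('m, 'e) fvec" where "gyro_force = gyroscopic_force M H' Z"

text \<open>The component of the gyroscopic force along \<open>W\<close>: the amount by which the
  parallel force of the LCB method exceeds the dissipative force of the CH method.\<close>

definition gyro_W :: "('m, 'e) fvec \<Rightarrow> ('m, 'e) fvec" where "gyro_W a = projW M W \<rho>' (gyro_force a)"

definition Z_coord :: "('m, 'e) chart \<Rightarrow> 'e \<Rightarrow> 'e \<Rightarrow> 'e \<Rightarrow> 'e \<Rightarrow> real" where
  "Z_coord c x p1 p2 p3 = Z (cvec_at c x p1) (cvec_at c x p2) (cvec_at c x p3)"

definition gyro_coord :: "('m, 'e) chart \<Rightarrow> 'e \<Rightarrow> 'e \<Rightarrow> 'e" where
  "gyro_coord c x p = rvec c x (\<lambda>r. Z_coord c x p p r)"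

lemma Z_tensor: "tensor3 M CT CT CT Z"
  using gyro unfolding gyroscopic_tensor_def Let_def by blast

context
  fixes c x
  assumes c: "c \<in> M" and x: "x \<in> img c"
begin

lemma Z_coord_linear: "linear (\<lambda>p. Z_coord c x p p2 p3)" "linear (\<lambda>p. Z_coord c x p1 p p3)" "linear (Z_coord c x p1 p2)"
  unfolding Z_coord_def using tensor3_linear[OF Z_tensor c x] by auto

lemma Upsilon_coord': "Upsilon M \<Gamma> \<rho> \<rho>' (cvec_at c x p1) (cvec_at c x p2)
    (cvec_at c x p3) = Ups \<rho> \<rho>' c x p1 p2 p3"
  by (rule Upsilon_coord[OF metric metric' c x])

text \<open>When the covectors from \<open>W\<close> coincide, the free data disappear: antisymmetry
  removes \<open>A\<close>, and the condition on the diagonal removes \<open>B\<close>.\<close>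

lemma Z_coord_clauses:
  shows "s \<in> Hc c x \<Longrightarrow> Z_coord c x p1 p2 s = Ups \<rho> \<rho>' c x p1 p2 s"
    and "s \<in> Hc c x \<Longrightarrow> w \<in> Wc c x \<Longrightarrow> Z_coord c x s s w = - 2 * Ups \<rho> \<rho>' c x w s s"
    and "s \<in> Hc c x \<Longrightarrow> w \<in> Wc c x \<Longrightarrow> Z_coord c x w s w = - 1/2 * Ups \<rho> \<rho>' c x w w s"
    and "s \<in> Hc c x \<Longrightarrow> w \<in> Wc c x \<Longrightarrow> Z_coord c x s w w = - 1/2 * Ups \<rho> \<rho>' c x w w s"
    and "w \<in> Wc c x \<Longrightarrow> Z_coord c x w w w = 0"
proof -
  let ?q = "chart_inv c x"
  note in' = cvec_in_CT[OF c x]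
  have Wi: "cvec c ?q w \<in> W" if "w \<in> Wc c x" for w using that by (simp add: Wc_def)
  have Hi: "cvec c ?q s \<in> What'" if "s \<in> Hc c x" for s using that by (simp add: What_coord[OF c x])
  note g = gyro[unfolded gyroscopic_tensor_def Let_def]
  note g1 = g[THEN conjunct2, THEN conjunct1]
    and r5 = g[THEN conjunct2, THEN conjunct2, THEN conjunct2, THEN conjunct2]
  note g2 = r5[THEN conjunct1] and r7 = r5[THEN conjunct2, THEN conjunct2]
  note g3 = r7[THEN conjunct1] and r8 = r7[THEN conjunct2]
  note g4 = r8[THEN conjunct1] and r9 = r8[THEN conjunct2]
  note g5 = r9[THEN conjunct1] and g6 = r9[THEN conjunct2]
  show "Z_coord c x p1 p2 s = Ups \<rho> \<rho>' c x p1 p2 s" if s: "s \<in> Hc c x"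
    using g3[rule_format, OF in'[of p1] in'[of p2] Hi[OF s]] by (simp add: Z_coord_def Upsilon_coord')
  show "Z_coord c x s s w = - 2 * Ups \<rho> \<rho>' c x w s s" if s: "s \<in> Hc c x" and w: "w \<in> Wc c x"
    using g4[rule_format, OF Hi[OF s] Hi[OF s] Wi[OF w]] by (simp add: Z_coord_def Upsilon_coord')
  have A0: "A (cvec c ?q w) (cvec c ?q w) (cvec c ?q s) = 0" if s: "s \<in> Hc c x" and w: "w \<in> Wc c x" for s w
    using g1[rule_format, OF Wi[OF w] Wi[OF w] Hi[OF s]] by simp
  show "Z_coord c x w s w = - 1/2 * Ups \<rho> \<rho>' c x w w s" "Z_coord c x s w w = - 1/2 * Ups \<rho> \<rho>' c x w w s"
    if s: "s \<in> Hc c x" and w: "w \<in> Wc c x"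
    using g5[rule_format, OF Wi[OF w] Hi[OF s] Wi[OF w]] A0[OF s w] by (simp_all add: Z_coord_def Upsilon_coord')
  show "Z_coord c x w w w = 0" if w: "w \<in> Wc c x"
    using g6[rule_format, OF Wi[OF w] Wi[OF w] Wi[OF w]] g2[rule_format, OF Wi[OF w]] by (simp add: Z_coord_def)
qed

lemma Ups_Hc_zero: "s \<in> Hc c x \<Longrightarrow> Ups \<rho> \<rho>' c x s s s = 0"
  using CH kinetic_matching_coord[OF metric metric' c x, of s] What_coord[OF c x, of s]
  unfolding CH_equations_def by metis

text \<open>With \<open>p = w + s\<close>, the last argument \<open>s\<close> contributes
  \<open>Ups w w s + 2 * Ups w s s\<close>, the cubic term in \<open>s\<close> being zero by the
  kinetic equation. The last argument \<open>w\<close> contributes the negative: twice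
  \<open>- 1/2\<close> from the two mixed values, and \<open>- 2\<close> from the value on
  \<open>s s w\<close>. The factors prescribed for \<open>Z\<close> are those that make this
  cancel.\<close>

lemma Z_coord_diagonal: "Z_coord c x p p p = 0"
proof -
  define w where "w = Pc c x p"
  define s where "s = p - w"
  have w: "w \<in> Wc c x" and s: "s \<in> Hc c x" and p: "p = w + s"
    using Pc[OF c x, of p] by (simp_all add: w_def s_def)
  note Ul = Ups_linear(1,2)[OF metric metric' c x, THEN linear_add]
  have "Z_coord c x p p p = Z_coord c x p p s + Z_coord c x p p w"
    using linear_add[OF Z_coord_linear(3), of p p w s] by (simp add: p)
  also have "Z_coord c x p p s = Ups \<rho> \<rho>' c x p p s" by (rule Z_coord_clauses(1)[OF s])
  also have "\<dots> = Ups \<rho> \<rho>' c x w w s + 2 * Ups \<rho> \<rho>' c x w s s"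
    using Ups_Hc_zero[OF s] Ups_linear(4)[OF metric metric' c x, of s w s] by (simp add: p Ul)
  also have "Z_coord c x p p w = Z_coord c x w w w + Z_coord c x w s w + Z_coord c x s w w + Z_coord c x s s w"
    by (simp add: p linear_add[OF Z_coord_linear(1)] linear_add[OF Z_coord_linear(2)])
  finally show ?thesis by (simp add: Z_coord_clauses w s)
qed

lemma gyro_force_coord: "gyro_force (cvec_at c x p) = cvec_at c x (gyro_coord c x p)"
proof -
  have e: "Z_coord c x p p = (\<lambda>r. Z (cvec_at c x p) (cvec_at c x p) (cvec_at c x r))"
    by (simp add: Z_coord_def fun_eq_iff)
  show ?thesis
    unfolding gyro_force_def gyro_coord_def using gyroscopic_force_coord[OF c x, of Z p] Z_coord_linear(3)[of p p] unfolding e .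
qed

lemma gyro_W_coord: "gyro_W (cvec_at c x p) = cvec_at c x (Pc c x (gyro_coord c x p))"
  by (simp add: gyro_W_def gyro_force_coord projW_coord[OF c x])

text \<open>Replaces \<open>z_perp\<close> by the gyroscopic force, so that every term in which the
  two laws differ is expressed through \<open>gyro_coord\<close>.\<close>

lemma z_perp_gyro: "z_perp M \<Gamma> W \<rho> H' \<rho>' (cvec_at c x p) =
    cvec_at c x (Pc c x (gyro_coord c x p) - gyro_coord c x p)"
proof -
  let ?a = "rvec c x (\<lambda>r. - Ups \<rho> \<rho>' c x p p r)"
  have "gyro_coord c x p - Pc c x (gyro_coord c x p) = - (?a - Pc c x ?a)"
    unfolding gyro_coord_def by (rule rvec_complement[OF c x Z_coord_linear(3) Z_coord_clauses(1)])
  then have "?a - Pc c x ?a = Pc c x (gyro_coord c x p) - gyro_coord c x p" by (simp add: algebra_simps)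
  then show ?thesis unfolding z_perp_coord[OF c x] by simp
qed

lemma gyro_coord_inner: "gyro_coord c x p \<bullet> S' c x r = Z_coord c x p p r"
  unfolding gyro_coord_def by (rule rvec_sharp[OF c x Z_coord_linear(3)])

lemma Pc_inner: "w \<in> Wc c x \<Longrightarrow> w \<bullet> S' c x p = w \<bullet> S' c x (Pc c x p)"
proof -
  assume w: "w \<in> Wc c x"
  have "w \<bullet> S' c x (p - Pc c x p) = 0" using Wc_orthogonal_Hc[OF c x w Pc(2)[OF c x]] by blast
  then show ?thesis by (simp add: linear_diff[OF S'_linear[OF c x]] inner_diff_right)
qed

text \<open>By \<open>Z_coord_diagonal\<close> the term with the full force vanishes, and its
  \<open>W\<close> part sees only the \<open>W\<close> part of \<open>p\<close>. The left-hand side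
  is the extra term in the LCB formula.\<close>

lemma z_perp_inner: "(Pc c x (gyro_coord c x p) - gyro_coord c x p) \<bullet> S' c x p = Pc c x (gyro_coord c x p) \<bullet> S' c x (Pc c x p)"
  using Pc_inner[OF Pc(1)[OF c x]] by (simp add: inner_diff_left gyro_coord_inner Z_coord_diagonal)

lemma ghat_sharp: "ghat M H' (cvec_at c x p) (cvec_at c x r) = p \<bullet> S' c x r"
  by (rule ghat_coord[OF metric' c x H'_kinetic])

end

lemma fiber_preserving_gyro_force: "fiber_preserving M gyro_force"
proof (rule fiber_preservingI)
  show "gyro_force a \<in> CT \<and> fst (gyro_force a) = fst a" if a: "a \<in> CT" for a
  proof -
    obtain c x p where c: "c \<in> M" "x \<in> img c" "a = cvec_at c x p"
      using CT_coord_cases[OF a] by blast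
    then show ?thesis using chart_mem[OF c(1,2)] by (simp add: gyro_force_coord[OF c(1,2)])
  qed
  fix c assume c: "c \<in> M"
  let ?S = "coords c :: ('e \<times> 'e) set"
  note oS = open_coords[OF c, where 'a = 'e] and oS4 = open_coords[OF c, where 'a = "'e \<times> 'e \<times> 'e"]
  have s: "smooth_on ?S fst" "smooth_on ?S snd"
    using smooth_on_fst[OF oS smooth_on_id[OF oS]] smooth_on_snd[OF oS smooth_on_id[OF oS]] .
  have f: "smooth_on ?S (\<lambda>y. flat_coord \<rho>' c (fst y) b)" for b
    by (rule smooth_on_compose[OF oS open_img[OF c] s(1) smooth_flat[OF c]]) auto
  have Z: "smooth_on (coords c) (\<lambda>(x, p1, p2, p3). Z_coord c x p1 p2 p3)"
    unfolding Z_coord_def using Z_tensor c unfolding tensor3_def by (intro smooth_whitney3D) auto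
  have "smooth_on ?S (\<lambda>y. (\<lambda>(x, p1, p2, p3). Z_coord c x p1 p2 p3) (fst y, snd y, snd y, flat_coord \<rho>' c (fst y) b))" for b
    by (rule smooth_on_compose[OF oS oS4 _ Z]) (auto intro!: smooth_on_Pair s f oS)
  then have "smooth_on ?S (\<lambda>y. gyro_coord c (fst y) (snd y))"
    unfolding gyro_coord_def rvec_def by (intro smooth_on_sum smooth_on_scaleR smooth_on_const oS finite_Basis) simp
  then show "smooth_on (coords c) (\<lambda>(x, p). snd (gyro_force (cvec_at c x p)) c)"
    by (rule smooth_on_eq[OF oS]) (use chart_mem[OF c] in \<open>auto simp: gyro_force_coord[OF c]\<close>)
qed

lemma fiber_preserving_gyro_W: "fiber_preserving M gyro_W"
  unfolding gyro_W_def[abs_def] by (rule fiber_preserving_projW[OF fiber_preserving_gyro_force])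

text \<open>Since \<open>z_perp a\<close> is \<open>gyro_W a\<close> minus
  \<open>gyro_force a\<close>, the shift by \<open>gyro_W\<close> turns either expression for the
  force into the other.\<close>

lemma law_eq:
  assumes a: "a \<in> CT" and z: "z \<in> CT" "fst z = fst a"
  shows "vsub (vadd z (gyro_W a)) (z_perp M \<Gamma> W \<rho> H' \<rho>' a) = vadd z (gyro_force a)"
    and "vadd (vsub z (gyro_W a)) (gyro_force a) = vsub z (z_perp M \<Gamma> W \<rho> H' \<rho>' a)"
proof -
  obtain c x p where c: "c \<in> M" "x \<in> img c" "a = cvec_at c x p"
    using CT_coord_cases[OF a] by blast
  obtain r where r: "z = cvec_at c x r"
    using CT_same_fiber[OF z(1) _ c(1,2)] z(2) c(3) by (metis fst_cvec)
  note simps = c(3) r z_perp_gyro[OF c(1,2)] gyro_W_coord[OF c(1,2)] gyro_force_coord[OF c(1,2)]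
    vadd_cvec[OF chart_mem[OF c(1,2)]] vsub_cvec[OF chart_mem[OF c(1,2)]]
  show "vsub (vadd z (gyro_W a)) (z_perp M \<Gamma> W \<rho> H' \<rho>' a) = vadd z (gyro_force a)"
    "vadd (vsub z (gyro_W a)) (gyro_force a) = vsub z (z_perp M \<Gamma> W \<rho> H' \<rho>' a)"
    by (simp_all add: simps algebra_simps)
qed

section \<open>Transfer between dissipative and parallel forces\<close>

context
  fixes \<alpha>0
  assumes \<alpha>0: "\<alpha>0 \<in> CT" and pd: "positive_definite_wrt M H' \<alpha>0"
begin

text \<open>Positive definiteness puts \<open>\<alpha>0\<close> on the zero section, and the
  gyroscopic force is quadratic in the covector.\<close>

lemma gyro_W_critical: "gyro_W \<alpha>0 = vzero (fst \<alpha>0)" and critical_zero: "\<alpha>0 = vzero (fst \<alpha>0)"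
proof -
  obtain c x p where c: "c \<in> M" "x \<in> img c" "\<alpha>0 = cvec_at c x p"
    using CT_coord_cases[OF \<alpha>0] by blast
  have p: "p = 0" using positive_definite_zero[OF H' _ c(1,2)] pd c(3) by simp
  have "gyro_coord c x 0 = 0"
    using linear_0[OF Z_coord_linear(1)[OF c(1,2)]] by (simp add: gyro_coord_def rvec_def)
  then show "gyro_W \<alpha>0 = vzero (fst \<alpha>0)" "\<alpha>0 = vzero (fst \<alpha>0)"
    using linear_0[OF linear_Pc[OF c(1,2)]]
    by (simp_all add: c(3) p gyro_W_coord[OF c(1,2)] vzero_cvec[OF chart_mem[OF c(1,2)]])
qed

text \<open>From the zero covector a line in a direction of \<open>W\<close> leaves the complement
  at once, so the limit of the formula dictates the value of its extension.\<close>

lemma extension_vanishes: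
  assumes "extends_and_vanishes M What' \<alpha>0 f z"
  shows "z \<alpha>0 = vzero (fst \<alpha>0)"
proof -
  obtain c x p where c: "c \<in> M" "x \<in> img c" "\<alpha>0 = cvec_at c x p"
    using CT_coord_cases[OF \<alpha>0] by blast
  note ch = chart_mem[OF c(1,2)]
  have p: "p = 0" using critical_zero cvec_eq_iff[OF ch] by (simp add: c(3) vzero_cvec[OF ch])
  obtain w where w: "w \<in> Wc c x" "w \<noteq> 0" using Wc_nonzero[OF c(1,2)] by blast
  have "z (cvec_at c x p) = vzero (chart_inv c x)"
  proof (rule limit_zeroD[OF _ ch])
    show "fiber_preserving M z" "\<And>b. b \<in> CT - What' \<Longrightarrow> z b = f b"
      "limitin CTtop f (vzero (chart_inv c x)) (atin_within CTtop (cvec_at c x p) (CT - What'))"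
      using assms by (simp_all add: extends_and_vanishes_def c(3))
    show "w \<noteq> 0" by (rule w)
    fix t :: real assume "t \<noteq> 0"
    then show "cvec_at c x (p + t *\<^sub>R w) \<notin> What'"
      using Wc_Hc_zero[OF c(1,2) subspace_scale[OF Wc_subspace[OF c(1,2)] w(1)], of t] w(2)
      by (auto simp: What_coord[OF c(1,2)] p)
  qed
  then show ?thesis by (simp add: c(3))
qed

text \<open>The map \<open>x\<close> for the LCB side is the projection of the new force itself.
  Outside the complement that force lies in \<open>W\<close>, and its product with
  \<open>P a\<close> is \<open>- \<mu> a\<close> plus the extra term; hence the coefficient of
  \<open>P a\<close> is zero and the formula returns the force.\<close>

lemma parallel_of_dissipative:
  assumes "CH_dissipative M W \<alpha>0 H' \<rho>' zd"
  shows "LCB_parallel M \<Gamma> W \<alpha>0 \<rho> H' \<rho>' (\<lambda>a. vadd (zd a) (gyro_W a))"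
proof -
  obtain \<mu> y where \<mu>: "smooth_fun (cotangent_atlas M) \<mu>" "\<forall>a\<in>CT. \<mu> a \<ge> 0"
    and y: "fiber_preserving M y" "y ` CT \<subseteq> W"
    and ev: "extends_and_vanishes M What' \<alpha>0 (\<lambda>a. vsub (y a) (vscale ((ghat M H' (y a) (projW M W \<rho>' a) + \<mu> a) /
            ghat M H' (projW M W \<rho>' a) (projW M W \<rho>' a)) (projW M W \<rho>' a))) zd"
    using assms unfolding CH_dissipative_def Let_def by blast
  have zd: "fiber_preserving M zd" using ev by (simp add: extends_and_vanishes_def)
  let ?zp = "\<lambda>a. vadd (zd a) (gyro_W a)" and ?P = "projW M W \<rho>'"
  let ?y = "\<lambda>a. ?P (?zp a)"
  let ?f = "\<lambda>a. vsub (?y a) (vscale ((ghat M H' (?y a) (?P a) + \<mu> a -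
      ghat M H' (z_perp M \<Gamma> W \<rho> H' \<rho>' a) a) / ghat M H' (?P a) (?P a)) (?P a))"
  have zp: "fiber_preserving M ?zp" by (rule fiber_preserving_vadd(1)[OF zd fiber_preserving_gyro_W])
  have f: "?zp a = ?f a" if a: "a \<in> CT - What'" for a
  proof -
    obtain c x p where c: "c \<in> M" "x \<in> img c" "a = cvec_at c x p"
      using CT_coord_cases a by blast
    note ch = chart_mem[OF c(1,2)]
    have aCT: "a \<in> CT" using a by simp
    obtain r where r: "r \<in> Wc c x" "y a = cvec_at c x r"
      using W_coord_cases[OF _ _ c(1,2), of "y a"] y(2) fiber_preservingD(2)[OF y(1) aCT] aCT c(3)
      by (metis fst_cvec image_subset_iff)
    define Pp where "Pp = Pc c x p"
    define Pg where "Pg = Pc c x (gyro_coord c x p)"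
    have "Pp \<noteq> 0" using a Pc_eq_0_iff[OF c(1,2)] by (simp add: Pp_def c(3) What_coord[OF c(1,2)])
    then have n: "Pp \<bullet> S' c x Pp \<noteq> 0" using sharp_form_zero[OF c(1,2)] by blast
    define z where "z = r - ((r \<bullet> S' c x Pp + \<mu> a) / (Pp \<bullet> S' c x Pp)) *\<^sub>R Pp"
    have za: "zd a = cvec_at c x z"
      using ev a unfolding extends_and_vanishes_def
      by (simp add: r(2)) (simp add: c(3) projW_coord[OF c(1,2)] ghat_sharp[OF c(1,2)] vscale_cvec[OF ch]
          vsub_cvec[OF ch] z_def Pp_def)
    have zpa: "?zp a = cvec_at c x (z + Pg)"
      by (simp add: za) (simp add: c(3) gyro_W_coord[OF c(1,2)] vadd_cvec[OF ch] Pg_def)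
    have "z + Pg \<in> Wc c x"
      unfolding z_def Pp_def Pg_def
      using r(1) Pc(1)[OF c(1,2)] Wc_subspace[OF c(1,2)]
      by (intro subspace_add subspace_diff subspace_scale) auto
    then have ya: "?y a = cvec_at c x (z + Pg)"
      unfolding zpa by (simp add: projW_coord[OF c(1,2)] Pc_Wc[OF c(1,2)])
    have "z \<bullet> S' c x Pp = - \<mu> a" using n by (simp add: z_def inner_diff_left)
    then have n0: "ghat M H' (?y a) (?P a) + \<mu> a - ghat M H' (z_perp M \<Gamma> W \<rho> H' \<rho>' a) a = 0"
      unfolding ya using z_perp_inner[OF c(1,2), of p]
      by (simp add: c(3) projW_coord[OF c(1,2)] ghat_sharp[OF c(1,2)] z_perp_gyro[OF c(1,2)] Pp_def Pg_def inner_add_left)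
    have "?f a = vsub (?y a) (vscale 0 (?P a))" by (simp only: n0 div_0)
    also have "\<dots> = cvec_at c x (z + Pg)"
      unfolding ya by (simp add: c(3) projW_coord[OF c(1,2)] vscale_cvec[OF ch] vsub_cvec[OF ch])
    finally show ?thesis unfolding zpa by (rule sym)
  qed
  \<comment> \<open>The limit is read off from the continuous extension, both summands of which
    vanish at \<open>\<alpha>0\<close>.\<close>
  have "?zp \<alpha>0 = vzero (fst \<alpha>0)"
    using extension_vanishes[OF ev] by (simp add: gyro_W_critical vadd_def vzero_def)
  then have "extends_and_vanishes M What' \<alpha>0 ?f ?zp"
    unfolding extends_and_vanishes_def
    by (intro conjI ballI zp f limit_zeroI[where z = ?zp] \<alpha>0) auto
  moreover have "?y ` CT \<subseteq> W" by (intro image_subsetI projW_in_W fiber_preservingD(1)[OF zp])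
  ultimately show ?thesis
    unfolding LCB_parallel_def Let_def using \<mu> fiber_preserving_projW[OF zp] by blast
qed

text \<open>Again \<open>x\<close> is replaced by the projection of the new force. In addition
  \<open>\<mu>\<close> has to vanish on the complement, which the LCB side does not demand but
  smoothness of the extension forces.\<close>

lemma dissipative_of_parallel:
  assumes "LCB_parallel M \<Gamma> W \<alpha>0 \<rho> H' \<rho>' zp"
  shows "CH_dissipative M W \<alpha>0 H' \<rho>' (\<lambda>a. vsub (zp a) (gyro_W a))"
proof -
  obtain \<mu> y where \<mu>: "smooth_fun (cotangent_atlas M) \<mu>" "\<forall>a\<in>CT. \<mu> a \<ge> 0"
    and y: "fiber_preserving M y" "y ` CT \<subseteq> W"
    and ev: "extends_and_vanishes M What' \<alpha>0 (\<lambda>a. vsub (y a) (vscale ((ghat M H' (y a) (projW M W \<rho>' a) + \<mu> a -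
            ghat M H' (z_perp M \<Gamma> W \<rho> H' \<rho>' a) a) /
            ghat M H' (projW M W \<rho>' a) (projW M W \<rho>' a)) (projW M W \<rho>' a))) zp"
    using assms unfolding LCB_parallel_def Let_def by blast
  have zp: "fiber_preserving M zp" using ev by (simp add: extends_and_vanishes_def)
  let ?zd = "\<lambda>a. vsub (zp a) (gyro_W a)" and ?P = "projW M W \<rho>'"
  let ?y = "\<lambda>a. ?P (?zd a)"
  let ?f = "\<lambda>a. vsub (?y a) (vscale ((ghat M H' (?y a) (?P a) + \<mu> a) / ghat M H' (?P a) (?P a)) (?P a))"
  have zd: "fiber_preserving M ?zd" by (rule fiber_preserving_vadd(2)[OF zp fiber_preserving_gyro_W])
  \<comment> \<open>Outside the complement the shifted force lies in \<open>W\<close> and dissipates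
    exactly \<open>\<mu>\<close>. This yields the formula for the extension and, in the limit, the
    vanishing of \<open>\<mu>\<close>.\<close>
  have key: "\<exists>z\<in>Wc c x. ?zd (cvec_at c x p) = cvec_at c x z \<and>
      z \<bullet> S' c x (Pc c x p) = - \<mu> (cvec_at c x p)"
    if c: "c \<in> M" "x \<in> img c" and pH: "p \<notin> Hc c x" for c x p
  proof -
    note ch = chart_mem[OF c]
    let ?a = "cvec_at c x p"
    have aCT: "?a \<in> CT" and aW: "?a \<notin> What'" using pH ch by (simp_all add: What_coord[OF c])
    obtain r where r: "r \<in> Wc c x" "y ?a = cvec_at c x r"
      using W_coord_cases[OF _ _ c, of "y ?a"] y(2) fiber_preservingD(2)[OF y(1) aCT] aCT
      by (metis fst_cvec image_subset_iff)
    define Pp where "Pp = Pc c x p"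
    define Pg where "Pg = Pc c x (gyro_coord c x p)"
    have "Pp \<noteq> 0" using pH Pc_eq_0_iff[OF c] by (simp add: Pp_def)
    then have n: "Pp \<bullet> S' c x Pp \<noteq> 0" using sharp_form_zero[OF c] by blast
    define z where "z = r - ((r \<bullet> S' c x Pp + \<mu> ?a - Pg \<bullet> S' c x Pp) / (Pp \<bullet> S' c x Pp)) *\<^sub>R Pp"
    have za: "zp ?a = cvec_at c x z"
      using ev aCT aW z_perp_inner[OF c, of p] unfolding extends_and_vanishes_def
      by (simp add: r(2) projW_coord[OF c] ghat_sharp[OF c] vscale_cvec[OF ch] z_perp_gyro[OF c]
          vsub_cvec[OF ch] z_def Pp_def Pg_def)
    have "?zd ?a = cvec_at c x (z - Pg)"
      by (simp add: za gyro_W_coord[OF c] vsub_cvec[OF ch] Pg_def)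
    moreover have "z - Pg \<in> Wc c x"
      unfolding z_def Pp_def Pg_def
      using r(1) Pc(1)[OF c] Wc_subspace[OF c] by (intro subspace_diff subspace_scale) auto
    moreover have "(z - Pg) \<bullet> S' c x Pp = - \<mu> ?a" using n by (simp add: z_def inner_diff_left)
    ultimately show ?thesis unfolding Pp_def by blast
  qed
  have f: "?zd a = ?f a" if a: "a \<in> CT - What'" for a
  proof -
    obtain c x p where c: "c \<in> M" "x \<in> img c" "a = cvec_at c x p"
      using CT_coord_cases a by blast
    note ch = chart_mem[OF c(1,2)]
    have "p \<notin> Hc c x" using a by (simp add: c(3) What_coord[OF c(1,2)])
    then obtain z where z: "z \<in> Wc c x" "?zd a = cvec_at c x z" "z \<bullet> S' c x (Pc c x p) = - \<mu> a"
      using key[OF c(1,2)] c(3) by blast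
    have ya: "?y a = cvec_at c x z"
      unfolding z(2) by (simp add: projW_coord[OF c(1,2)] Pc_Wc[OF c(1,2) z(1)])
    have n0: "ghat M H' (?y a) (?P a) + \<mu> a = 0"
      unfolding ya using z(3) by (simp add: c(3) projW_coord[OF c(1,2)] ghat_sharp[OF c(1,2)])
    have "?f a = vsub (?y a) (vscale 0 (?P a))" by (simp only: n0 div_0)
    also have "\<dots> = cvec_at c x z"
      unfolding ya by (simp add: c(3) projW_coord[OF c(1,2)] vscale_cvec[OF ch] vsub_cvec[OF ch])
    finally show ?thesis unfolding z(2) by (rule sym)
  qed
  have "?zd \<alpha>0 = vzero (fst \<alpha>0)"
    using extension_vanishes[OF ev] by (simp add: gyro_W_critical vsub_def vadd_def vscale_def vzero_def)
  then have ev': "extends_and_vanishes M What' \<alpha>0 ?f ?zd"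
    unfolding extends_and_vanishes_def
    by (intro conjI ballI zd f limit_zeroI[where z = ?zd] \<alpha>0) auto
  have y': "?y ` CT \<subseteq> W" by (intro image_subsetI projW_in_W fiber_preservingD(1)[OF zd])
  have "\<mu> \<sigma> = 0" if \<sigma>: "\<sigma> \<in> What'" for \<sigma>
  proof -
    have "\<sigma> \<in> CT" using \<sigma> What_CT by auto
    then obtain c x s where c: "c \<in> M" "x \<in> img c" "\<sigma> = cvec_at c x s"
      using CT_coord_cases by blast
    note ch = chart_mem[OF c(1,2)]
    have s: "s \<in> Hc c x" using \<sigma> by (simp add: c(3) What_coord[OF c(1,2)])
    obtain w where w: "w \<in> Wc c x" "w \<noteq> 0" using Wc_nonzero[OF c(1,2)] by blast
    \<comment> \<open>Along this line the projection of the covector is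
      \<open>t *\<^sub>R w\<close>, so \<open>key\<close> expresses \<open>\<mu>\<close> as
      \<open>- t\<close> times the product of the force with \<open>w\<close>. The force has a limit
      at \<open>\<sigma>\<close>, hence \<open>\<mu>\<close> tends to \<open>0\<close>.\<close>
    let ?a = "\<lambda>t. cvec_at c x (s + t *\<^sub>R w)"
    let ?z = "\<lambda>t. snd (?zd (?a t)) c"
    have 1: "((\<lambda>t. \<mu> (?a t)) \<longlongrightarrow> \<mu> \<sigma>) (at 0)"
      unfolding c(3) by (rule smooth_on_fiber_line[OF c(1,2) smooth_fun_cotangentD[OF \<mu>(1) c(1)]])
    have "(?z \<longlongrightarrow> snd (?zd (cvec_at c x s)) c) (at 0)"
      by (rule smooth_on_fiber_line[OF c(1,2) fiber_preservingD(3)[OF zd c(1)]])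
    then have "((\<lambda>t. - (t * (?z t \<bullet> S' c x w))) \<longlongrightarrow> - (0 * (snd (?zd (cvec_at c x s)) c \<bullet> S' c x w))) (at 0)"
      by (intro tendsto_intros)
    then have 2: "((\<lambda>t. - (t * (?z t \<bullet> S' c x w))) \<longlongrightarrow> 0) (at 0)" by simp
    have "\<forall>\<^sub>F t in at 0. t \<noteq> (0::real)" by (simp add: eventually_at_filter)
    then have "\<forall>\<^sub>F t in at 0. - (t * (?z t \<bullet> S' c x w)) = \<mu> (?a t)"
    proof eventually_elim
      case (elim t)
      have P: "Pc c x (s + t *\<^sub>R w) = t *\<^sub>R w"
        using Pc_Hc[OF c(1,2) s] Pc_Wc[OF c(1,2) w(1)]
        by (simp add: linear_add[OF linear_Pc[OF c(1,2)]] linear_cmul[OF linear_Pc[OF c(1,2)]])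
      then have "s + t *\<^sub>R w \<notin> Hc c x" using Pc_eq_0_iff[OF c(1,2), of "s + t *\<^sub>R w"] elim w(2) by simp
      then obtain z where z: "?zd (?a t) = cvec_at c x z" "z \<bullet> S' c x (t *\<^sub>R w) = - \<mu> (?a t)"
        using key[OF c(1,2)] P by metis
      have "?z t = z" unfolding z(1) using ch by simp
      then show ?case using z(2) by (simp add: linear_cmul[OF S'_linear[OF c(1,2)]])
    qed
    then have "((\<lambda>t. \<mu> (?a t)) \<longlongrightarrow> 0) (at 0)" using 2 by (simp add: tendsto_cong)
    then show ?thesis using tendsto_unique[OF _ 1] by simp
  qed
  then show ?thesis
    unfolding CH_dissipative_def Let_def using \<mu> fiber_preserving_projW[OF zd] y' ev' by blast
qed

end

end

theorem theorem45:
  fixes M :: "('q, 'e::euclidean_space) chart set"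
    and \<Gamma> :: "('q, 'e) christoffel"
  assumes "smooth_manifold M"
    and "connection M \<Gamma>"
    and "torsion_free M \<Gamma>"
  shows "\<forall>(H, VW, \<alpha>0) \<in> simple_underactuated_systems M.
           LCB_laws M \<Gamma> (H, VW, \<alpha>0) = CH_laws M \<Gamma> (H, VW, \<alpha>0)"
proof -
  interpret connected_atlas M \<Gamma>
    by unfold_locales (use assms in \<open>auto simp: smooth_manifold_def\<close>)
  have eq: "LCB_laws M \<Gamma> (H, VW, \<alpha>0) = CH_laws M \<Gamma> (H, VW, \<alpha>0)" if \<alpha>0: "\<alpha>0 \<in> CT" for H VW \<alpha>0
  proof (intro equalityI subsetI)
    fix Y assume "Y \<in> LCB_laws M \<Gamma> (H, VW, \<alpha>0)"
    then obtain k W \<rho> h H' \<rho>' h' zp where Y: "Y \<in> vector_fields (cotangent_atlas M)"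
      and k: "k \<ge> 1" "linear_subbundle M k W" "VW = vertical_subbundle M W"
      and H: "simple_with M H \<rho> h" "simple_with M H' \<rho>' h'" "positive_definite_wrt M H' \<alpha>0"
      and eq: "LCB_equation M W H H' \<rho>'" and zp: "LCB_parallel M \<Gamma> W \<alpha>0 \<rho> H' \<rho>' zp"
      and law: "Y = vertical_lift_field M
         (\<lambda>\<alpha>. vsub (vsub (zp \<alpha>) (z_perp M \<Gamma> W \<rho> H' \<rho>' \<alpha>)) (matching_term M \<Gamma> H H' \<alpha>))"
      unfolding LCB_laws_def by auto
    interpret actuated_system M \<Gamma> k W \<rho> \<rho>' H' h'
      by unfold_locales (use k H in \<open>auto simp: simple_with_def\<close>)
    have CH: "CH_equations M \<Gamma> W \<rho> h \<rho>' h'"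
      using LCB_equation_iff_CH_equations[OF H(1,2) What_CT What_scale] eq by blast
    interpret gyroscopic_system M \<Gamma> k W \<rho> \<rho>' H' h' h "\<lambda>_ _ _. 0" "\<lambda>_ _ _. 0" canonical_tensor
      by unfold_locales (rule CH, rule canonical_gyroscopic_tensor)
    have fp: "fiber_preserving M zp"
      using zp unfolding LCB_parallel_def Let_def extends_and_vanishes_def by blast
    \<comment> \<open>\<open>vertical_lift_field\<close> is restricted to the cotangent bundle, so
      the two lifted maps have to be compared only there.\<close>
    have "Y = vertical_lift_field M (\<lambda>\<alpha>. vsub (vadd (vsub (zp \<alpha>) (gyro_W \<alpha>)) (gyroscopic_force M H' canonical_tensor \<alpha>))
        (matching_term M \<Gamma> H H' \<alpha>))"
      unfolding law vertical_lift_field_def gyro_force_def[symmetric]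
      by (intro restrict_ext) (simp add: law_eq(2) fiber_preservingD[OF fp])
    then show "Y \<in> CH_laws M \<Gamma> (H, VW, \<alpha>0)"
      unfolding CH_laws_def
      using Y k H CH canonical_gyroscopic_tensor dissipative_of_parallel[OF \<alpha>0 H(3) zp] by blast
  next
    fix Y assume "Y \<in> CH_laws M \<Gamma> (H, VW, \<alpha>0)"
    then obtain k W \<rho> h H' \<rho>' h' A B Z zd where Y: "Y \<in> vector_fields (cotangent_atlas M)"
      and k: "k \<ge> 1" "linear_subbundle M k W" "VW = vertical_subbundle M W"
      and H: "simple_with M H \<rho> h" "simple_with M H' \<rho>' h'" "positive_definite_wrt M H' \<alpha>0"
      and CH: "CH_equations M \<Gamma> W \<rho> h \<rho>' h'" and gyro: "gyroscopic_tensor M \<Gamma> W \<rho> \<rho>' A B Z"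
      and zd: "CH_dissipative M W \<alpha>0 H' \<rho>' zd"
      and law: "Y = vertical_lift_field M
         (\<lambda>\<alpha>. vsub (vadd (zd \<alpha>) (gyroscopic_force M H' Z \<alpha>)) (matching_term M \<Gamma> H H' \<alpha>))"
      unfolding CH_laws_def by auto
    interpret actuated_system M \<Gamma> k W \<rho> \<rho>' H' h'
      by unfold_locales (use k H in \<open>auto simp: simple_with_def\<close>)
    interpret gyroscopic_system M \<Gamma> k W \<rho> \<rho>' H' h' h A B Z
      by unfold_locales (rule CH, rule gyro)
    have eq: "LCB_equation M W H H' \<rho>'"
      using LCB_equation_iff_CH_equations[OF H(1,2) What_CT What_scale] CH by blast
    have fp: "fiber_preserving M zd"
      using zd unfolding CH_dissipative_def Let_def extends_and_vanishes_def by blast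
    \<comment> \<open>Whatever freedom \<open>A\<close> and \<open>B\<close> add to the gyroscopic
      force lies along \<open>W\<close> and is absorbed in the shift by
      \<open>gyro_W\<close>.\<close>
    have "Y = vertical_lift_field M (\<lambda>\<alpha>. vsub (vsub (vadd (zd \<alpha>) (gyro_W \<alpha>)) (z_perp M \<Gamma> W \<rho> H' \<rho>' \<alpha>))
        (matching_term M \<Gamma> H H' \<alpha>))"
      unfolding law vertical_lift_field_def gyro_force_def[symmetric]
      by (intro restrict_ext) (simp add: law_eq(1) fiber_preservingD[OF fp])
    then show "Y \<in> LCB_laws M \<Gamma> (H, VW, \<alpha>0)"
      unfolding LCB_laws_def
      using Y k H eq parallel_of_dissipative[OF \<alpha>0 H(3) zd] by blast
  qed
  show ?thesis
  proof (rule ballI, clarify)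
    fix H VW \<alpha>0 assume "(H, VW, \<alpha>0) \<in> simple_underactuated_systems M"
    then show "LCB_laws M \<Gamma> (H, VW, \<alpha>0) = CH_laws M \<Gamma> (H, VW, \<alpha>0)"
      by (intro eq) (simp add: simple_underactuated_systems_def)
  qed
qed

end
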